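(* Let $\mathcal A\subseteq\Omega$ be an infinite set that is compact in the quotient topology on $\mathbb R^d/\mathcal V$, and let $f$ be a weak G-type potential. For $\lambda\in\mathcal M_{+,1}(\mathcal A)$ put $\mathcal L_f(\lambda)=\iint K_f^{\mathrm p}(x,y)\,d\lambda(x)\,d\lambda(y)$. Assume that $$\int_0^\infty\frac{\pi^{d/2}}{t^{d/2}}e^{-\pi^2|w|^2/t}\,d\mu_f(t)>0\qquad\text{for all } w\in\mathcal V^*\setminus\{0\}.$$ (I) If $\mathcal L_f(\lambda)<\infty$ for some $\lambda\in\mathcal M_{+,1}(\mathcal A)$, then $$\lim_{N\to\infty}\frac{\mathcal E_f^{\mathrm p}(\mathcal A,N)}{N^2}=\int_{\mathcal A}\int_{\mathcal A}K_f^{\mathrm p}(x,y)\,d\nu_f(x)\,d\nu_f(y),$$ where $\nu_f$ is the unique element of $\{\lambda\in\mathcal M_{+,1}(\mathcal A):\mathcal L_f(\lambda)=\inf_{\nu\in\mathcal M_{+,1}(\mathcal A)}\mathcal L_f(\nu)\}$. (II) If $\mathcal L_f(\lambda)=\infty$ for all $\lambda\in\mathcal M_{+,1}(\mathcal A)$, then $\lim_{N\to\infty}\mathcal E_f^{\mathrm p}(\mathcal A,N)/N^2=+\infty$.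
   Context: Let $V$ be a real $d\times d$ matrix with linearly independent columns $v_1,\dots,v_d$ and $\det V=1$; $\mathcal V=\{Vk:k\in\mathbb Z^d\}$; $\mathcal V^*=\{w\in\mathbb R^d: w\cdot v\in\mathbb Z\ \forall v\in\mathcal V\}$; $\Omega=\{\sum_j\alpha_jv_j:\alpha_j\in[0,1)\}$, identified with the fundamental cell of $\mathbb R^d/\mathcal V$ (compact in the quotient topology). $\mathcal M_{+,1}(\mathcal A)$ is the set of positive Borel probability measures with support in $\mathcal A$, the support being taken in the topology of $\mathbb R^d/\mathcal V$. $\int_a^b h\,d\mu$ means integration over $[a,b)$ (over $(0,b)$ if $a=0$ and $\mu$ is a measure on $(0,\infty)$). Weak G-type potential: a lower-semicontinuous $f:\mathbb R^d\to\mathbb R\cup\{\infty\}$ for which there are a function $f^*:(0,1)\to\mathbb R$ and a signed measure $\mu_f$ on $(0,\infty)$ with finite negative part such that (W1) for every $q\neq0$, $f(q)$ is finite and $f(q)=\lim_{\alpha\to0^+}\big(\int_\alpha^\infty e^{-|q|^2t}\,d\mu_f(t)+f^*(\alpha)\big)$, where $\int_\alpha^\infty e^{-|q|^2t}\,d\mu_f(t)<\infty$ for all $\alpha>0$; and (W2) if $w_0$ is an element of $\mathcal V^*\setminus\{0\}$ of minimal length, then $\int_0^1 t^{-d/2}e^{-\pi^2|w_0|^2/t}\,d\mu_f(t)<\infty$. The periodic kernel is $$K_f^{\mathrm p}(x,y)=\sum_{v\in\mathcal V}\int_1^\infty e^{-|x-y+v|^2t}\,d\mu_f(t)+\sum_{w\in\mathcal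 V^*\setminus\{0\}}e^{2\pi i w\cdot(x-y)}\int_0^1\frac{\pi^{d/2}}{t^{d/2}}e^{-\pi^2|w|^2/t}\,d\mu_f(t),$$ the periodic energy is $E_f^{\mathrm p}(\omega_N)=\sum_{j\neq k}K_f^{\mathrm p}(x_j,x_k)$ for $\omega_N=(x_j)_{j=1}^N$, and $\mathcal E_f^{\mathrm p}(\mathcal A,N)=\inf_{\omega_N\in\mathcal A^N}E_f^{\mathrm p}(\omega_N)$. *)

theory Defs
  imports "HOL-Probability.Probability"
begin

section \<open>The lattice and the torus\<close>

definition lattice :: "real^'d^'d \<Rightarrow> (real^'d) set" where
  "lattice V = {V *v k | k. \<forall>j. k $ j \<in> \<int>}"

definition dual_lattice :: "real^'d^'d \<Rightarrow> (real^'d) set" where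
  "dual_lattice V = {w. \<forall>v\<in>lattice V. w \<bullet> v \<in> \<int>}"

definition fundamental_cell :: "real^'d^'d \<Rightarrow> (real^'d) set" where
  "fundamental_cell V = {(\<Sum>j\<in>UNIV. \<alpha> j *\<^sub>R column j V) | \<alpha>. \<forall>j. 0 \<le> \<alpha> j \<and> \<alpha> j < 1}"

text \<open>
  The quotient of the ambient space by the lattice is identified with the fundamental cell:
  a coset is represented by its unique member in the cell.
\<close>

definition torus_proj :: "real^'d^'d \<Rightarrow> real^'d \<Rightarrow> real^'d" where
  "torus_proj V x = (THE y. y \<in> fundamental_cell V \<and> x - y \<in> lattice V)"

definition torus_topology :: "real^'d^'d \<Rightarrow> (real^'d) topology" where
  "torus_topology V = topology (\<lambda>U. U \<subseteq> fundamental_cell V \<and> open (torus_proj V -` U))"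

lemma openin_torus_topology:
  "openin (torus_topology V) U \<longleftrightarrow> U \<subseteq> fundamental_cell V \<and> open (torus_proj V -` U)"
proof -
  have "istopology (\<lambda>U. U \<subseteq> fundamental_cell V \<and> open (torus_proj V -` U))"
    by (auto simp: istopology_def vimage_Union)
  then show ?thesis
    by (simp add: torus_topology_def topology_inverse')
qed

definition torus_borel :: "real^'d^'d \<Rightarrow> (real^'d) measure" where
  "torus_borel V = sigma (fundamental_cell V) {U. openin (torus_topology V) U}"

definition measure_support :: "'a topology \<Rightarrow> 'a measure \<Rightarrow> 'a set" where
  "measure_support T M = {x \<in> topspace T. \<forall>U. openin T U \<longrightarrow> x \<in> U \<longrightarrow> emeasure M U > 0}"

definition prob_measures_on :: "real^'d^'d \<Rightarrow> (real^'d) set \<Rightarrow> (real^'d) measure set" where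
  "prob_measures_on V A =
     {M. sets M = sets (torus_borel V) \<and> prob_space M \<and> measure_support (torus_topology V) M \<subseteq> A}"

section \<open>Signed measures and extended-real integrals\<close>

definition signed_measure :: "'a measure \<Rightarrow> ('a set \<Rightarrow> ereal) \<Rightarrow> bool" where
  "signed_measure M \<mu> \<longleftrightarrow>
     \<mu> {} = 0 \<and>
     ((\<forall>A\<in>sets M. \<mu> A \<noteq> \<infinity>) \<or> (\<forall>A\<in>sets M. \<mu> A \<noteq> -\<infinity>)) \<and>
     (\<forall>A :: nat \<Rightarrow> 'a set. range A \<subseteq> sets M \<longrightarrow> disjoint_family A \<longrightarrow>
        (\<lambda>i. \<mu> (A i)) sums \<mu> (\<Union>i. A i))"

text \<open>
  The positive and negative part of the Jordan decomposition, given by the usual formulas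
  \<open>\<mu>\<^sup>+ A = sup {\<mu> B | B \<subseteq> A}\<close> and \<open>\<mu>\<^sup>- A = sup {- \<mu> B | B \<subseteq> A}\<close>. The function \<open>e2ennreal\<close>
  cuts off negative values, which is immaterial here because of the competitor \<open>B = {}\<close>.
\<close>

definition positive_part :: "'a measure \<Rightarrow> ('a set \<Rightarrow> ereal) \<Rightarrow> 'a measure" where
  "positive_part M \<mu> = measure_of (space M) (sets M)
     (\<lambda>A. SUP B\<in>{B \<in> sets M. B \<subseteq> A}. e2ennreal (\<mu> B))"

definition negative_part :: "'a measure \<Rightarrow> ('a set \<Rightarrow> ereal) \<Rightarrow> 'a measure" where
  "negative_part M \<mu> = measure_of (space M) (sets M)
     (\<lambda>A. SUP B\<in>{B \<in> sets M. B \<subseteq> A}. e2ennreal (- \<mu> B))"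

text \<open>
  The integral over \<open>A\<close> of an extended-real function. It is meaningful when one of the two terms
  is finite; all functions integrated below satisfy this, with the second term finite.
\<close>

definition ereal_set_integral :: "'a measure \<Rightarrow> 'a set \<Rightarrow> ('a \<Rightarrow> ereal) \<Rightarrow> ereal" where
  "ereal_set_integral M A h =
     enn2ereal (\<integral>\<^sup>+x\<in>A. e2ennreal (h x) \<partial>M) - enn2ereal (\<integral>\<^sup>+x\<in>A. e2ennreal (- h x) \<partial>M)"

definition pos_reals :: "real measure" where
  "pos_reals = restrict_space borel {0<..}"

text \<open>
  Integration with respect to a signed measure on the positive half-line. The integrands below are
  nonnegative and bounded and the negative part is finite, so the value lies in \<open>(-\<infinity>, \<infinity>]\<close>.
\<close>

definition signed_integral :: "(real set \<Rightarrow> ereal) \<Rightarrow> real set \<Rightarrow> (real \<Rightarrow> real) \<Rightarrow> ereal" where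
  "signed_integral \<mu> S h =
     ereal_set_integral (positive_part pos_reals \<mu>) S (\<lambda>t. ereal (h t)) -
     ereal_set_integral (negative_part pos_reals \<mu>) S (\<lambda>t. ereal (h t))"

section \<open>Weak G-type potentials, periodic kernel and energy\<close>

text \<open>
  The witnesses \<open>f\<^sup>*\<close> and \<open>\<mu>\<^sub>f\<close> are parameters, since the periodic kernel is built from \<open>\<mu>\<^sub>f\<close>.
\<close>

definition weak_G_type ::
    "real^'d^'d \<Rightarrow> (real^'d \<Rightarrow> ereal) \<Rightarrow> (real \<Rightarrow> real) \<Rightarrow> (real set \<Rightarrow> ereal) \<Rightarrow> bool" where
  "weak_G_type V f fstar \<mu> \<longleftrightarrow>
     (\<forall>q. f q \<noteq> -\<infinity>) \<and>
     (\<forall>a. open {q. a < f q}) \<and>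
     signed_measure pos_reals \<mu> \<and>
     emeasure (negative_part pos_reals \<mu>) (space pos_reals) < \<infinity> \<and>
     (\<forall>q. q \<noteq> 0 \<longrightarrow>
        \<bar>f q\<bar> \<noteq> \<infinity> \<and>
        (\<forall>\<alpha>>0. signed_integral \<mu> {\<alpha>..} (\<lambda>t. exp (- (norm q)\<^sup>2 * t)) < \<infinity>) \<and>
        ((\<lambda>\<alpha>. signed_integral \<mu> {\<alpha>..} (\<lambda>t. exp (- (norm q)\<^sup>2 * t)) + ereal (fstar \<alpha>))
           \<longlongrightarrow> f q) (at_right 0)) \<and>
     (\<forall>w. is_arg_min norm (\<lambda>w. w \<in> dual_lattice V - {0}) w \<longrightarrow>
        signed_integral \<mu> {0<..<1}
          (\<lambda>t. t powr (- real CARD('d) / 2) * exp (- pi\<^sup>2 * (norm w)\<^sup>2 / t)) < \<infinity>)"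

definition dual_weight :: "real^'d \<Rightarrow> real \<Rightarrow> real" where
  "dual_weight w t =
     pi powr (real CARD('d) / 2) / t powr (real CARD('d) / 2) * exp (- pi\<^sup>2 * (norm w)\<^sup>2 / t)"

text \<open>
  The first sum is unconditional summation in the extended reals: its negative terms are summable,
  and it has an infinite term only if \<open>x - y\<close> is a lattice vector. For a weak G-type potential the
  integrals in the second sum are finite, so \<open>real_of_ereal\<close> loses nothing, and the sum is
  absolutely convergent and real, because \<open>w\<close> and \<open>-w\<close> contribute conjugate terms.
\<close>

definition periodic_kernel ::
    "real^'d^'d \<Rightarrow> (real set \<Rightarrow> ereal) \<Rightarrow> real^'d \<Rightarrow> real^'d \<Rightarrow> ereal" where
  "periodic_kernel V \<mu> x y =
     (\<Sum>\<^sub>\<infinity>v\<in>lattice V. signed_integral \<mu> {1..} (\<lambda>t. exp (- (norm (x - y + v))\<^sup>2 * t))) +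
     ereal (Re (\<Sum>\<^sub>\<infinity>w\<in>dual_lattice V - {0}.
       exp (2 * complex_of_real pi * \<i> * complex_of_real (w \<bullet> (x - y))) *
       complex_of_real (real_of_ereal (signed_integral \<mu> {0<..<1} (dual_weight w)))))"

definition periodic_energy ::
    "real^'d^'d \<Rightarrow> (real set \<Rightarrow> ereal) \<Rightarrow> nat \<Rightarrow> (nat \<Rightarrow> real^'d) \<Rightarrow> ereal" where
  "periodic_energy V \<mu> N \<omega> =
     (\<Sum>(j, k)\<in>{(j, k). j < N \<and> k < N \<and> j \<noteq> k}. periodic_kernel V \<mu> (\<omega> j) (\<omega> k))"

definition min_periodic_energy ::
    "real^'d^'d \<Rightarrow> (real set \<Rightarrow> ereal) \<Rightarrow> (real^'d) set \<Rightarrow> nat \<Rightarrow> ereal" where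
  "min_periodic_energy V \<mu> A N = (INF \<omega>\<in>{..<N} \<rightarrow>\<^sub>E A. periodic_energy V \<mu> N \<omega>)"

definition continuous_energy ::
    "real^'d^'d \<Rightarrow> (real set \<Rightarrow> ereal) \<Rightarrow> (real^'d) measure \<Rightarrow> ereal" where
  "continuous_energy V \<mu> M =
     ereal_set_integral M (fundamental_cell V)
       (\<lambda>y. ereal_set_integral M (fundamental_cell V) (\<lambda>x. periodic_kernel V \<mu> x y))"

end

theory Submission
  imports Defs
begin

text \<open>
  By Poisson summation for Gaussians, the periodic kernel is the supremum of an increasing sequence of
  continuous kernels, obtained by cutting the integral over \<open>[1, \<infinity>)\<close> off at time \<open>n\<close>. Each of them is
  an absolutely convergent Fourier series in \<open>x - y\<close>, and its coefficient at a frequency \<open>w \<noteq> 0\<close>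
  increases in \<open>n\<close> to \<open>\<integral>\<^sub>0\<^sup>\<infinity> \<pi>\<^bsup>d/2\<^esup> t\<^bsup>-d/2\<^esup> exp (- \<pi>\<^sup>2 |w|\<^sup>2 / t) d\<mu>(t) > 0\<close>. So the
  energy of a probability measure is the increasing limit of weighted sums of the squared moduli of its
  Fourier coefficients. Weak limits of empirical measures of near-optimal configurations therefore have
  energy at most the lower limit of the discrete energies divided by \<open>N\<^sup>2\<close>; in the other direction,
  averaging over configurations bounds the discrete energy by \<open>N (N - 1)\<close> times the energy of any
  measure. The minimizer is unique by the parallelogram identity, because a measure on the torus is
  determined by its Fourier coefficients.
\<close>

section \<open>Weak compactness of empirical measures\<close>

text \<open>The obstacle is sign. The measure is signed, so a truncated kernel need not be positive
  definite; only the limits of its coefficients are positive. Therefore only the positive part of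
  the measure is cut off, while the whole finite negative part is kept. Kernels and coefficients
  then increase, and the absolute values of the coefficients at stage 0, which are summable, control
  the negative contributions at all later stages. Frequency 0 carries no sign condition, but every
  probability measure has the coefficient 1 there, so it cancels when two measures are compared.
  Poisson summation is applied only at times at least 1; for smaller times the kernel is already
  given as a Fourier series. The full kernel may be infinite on the diagonal, which the discrete
  energy leaves out. A truncated kernel is bounded there, so adding its diagonal costs only a
  multiple of \<open>1 / N\<close> after division by \<open>N\<^sup>2\<close>, and the truncation is
  removed after the limit in \<open>N\<close>. Topology and Borel sets of the torus are handled
  through its embedding in complex space as a product of circles.\<close>

lemma ternary_code_separates:
  fixes B :: "nat \<Rightarrow> 'a set"
  defines "c \<equiv> \<lambda>x. (\<Sum>k. if x \<in> B k then 2 / 3 ^ (k + 1) else (0::real))"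
  assumes diff: "\<bar>c x - c y\<bar> < 1 / 3 ^ n" and k: "k < n"
  shows "x \<in> B k \<longleftrightarrow> y \<in> B k"
proof (rule ccontr)
  assume neq: "\<not> (x \<in> B k \<longleftrightarrow> y \<in> B k)"
  \<comment> \<open>The code is a Cantor number with ternary digits 2 and 0. At the first differing
    digit \<open>K\<close> the codes differ by 2 / 3 ^ (K + 1), and all later digits together can
    make up for at most half of this.\<close>
  define K where "K = (LEAST k. \<not> (x \<in> B k \<longleftrightarrow> y \<in> B k))"
  have K: "\<not> (x \<in> B K \<longleftrightarrow> y \<in> B K)" and less: "\<And>j. j < K \<Longrightarrow> x \<in> B j \<longleftrightarrow> y \<in> B j" and "K \<le> k"
    using LeastI[of "\<lambda>k. \<not> (x \<in> B k \<longleftrightarrow> y \<in> B k)", OF neq] not_less_Least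
      Least_le[of "\<lambda>k. \<not> (x \<in> B k \<longleftrightarrow> y \<in> B k)", OF neq] unfolding K_def by blast+
  define a where "a x k = (if x \<in> B k then 2 / 3 ^ (k + 1) else (0::real))" for x k
  have geo: "(\<lambda>k. 2 / 3 ^ (k + 1 + m) :: real) sums (1 / 3 ^ m)" for m
    using sums_mult[OF geometric_sums[of "1/3::real"], of "2 / 3 ^ (m+1)"]
    by (simp add: field_simps power_add power_divide)
  have sm: "summable (a x)" for x
    by (rule summable_comparison_test'[OF sums_summable[OF geo[of 0]], of 0]) (auto simp: a_def)
  define e where "e k = a x k - a y k" for k
  have se: "summable e" unfolding e_def by (intro summable_diff sm)
  have cxy: "c x - c y = suminf e"
    unfolding c_def e_def a_def[symmetric] by (intro suminf_diff sm)
  have e0: "e j = 0" if "j < K" for j using less[OF that] by (auto simp: e_def a_def)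
  have "suminf e = (\<Sum>j. e (j + Suc K)) + (\<Sum>j<Suc K. e j)"
    by (rule suminf_split_initial_segment[OF se])
  also have "(\<Sum>j<Suc K. e j) = e K" using e0 by simp
  finally have s: "suminf e = (\<Sum>j. e (j + Suc K)) + e K" .
  have ab: "\<bar>e (j + Suc K)\<bar> \<le> 2 / 3 ^ (j + 1 + Suc K)" for j by (auto simp: e_def a_def)
  have "\<bar>\<Sum>j. e (j + Suc K)\<bar> \<le> (\<Sum>j. \<bar>e (j + Suc K)\<bar>)"
    by (intro summable_rabs summable_comparison_test'[OF sums_summable[OF geo[of "Suc K"]], of 0]) (use ab in auto)
  also have "\<dots> \<le> (\<Sum>j. 2 / 3 ^ (j + 1 + Suc K))"
    by (intro suminf_le ab sums_summable[OF geo[of "Suc K"]]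
      summable_comparison_test'[OF sums_summable[OF geo[of "Suc K"]], of 0]) (use ab in auto)
  also have "\<dots> = 1 / 3 ^ Suc K" by (rule sums_unique[OF geo[of "Suc K"], symmetric])
  finally have "\<bar>\<Sum>j. e (j + Suc K)\<bar> \<le> 1 / 3 ^ Suc K" .
  moreover have "\<bar>e K\<bar> = 2 / 3 ^ Suc K" using K by (auto simp: e_def a_def)
  moreover have "2 / 3 ^ Suc K = 1 / 3 ^ Suc K + (1 / 3 ^ Suc K :: real)" by simp
  ultimately have "1 / 3 ^ Suc K \<le> \<bar>c x - c y\<bar>" unfolding cxy s by linarith
  moreover have "(1::real) / 3 ^ n \<le> 1 / 3 ^ Suc K"
    using \<open>K \<le> k\<close> k by (intro divide_left_mono power_increasing) auto
  ultimately show False using diff by linarith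
qed

text \<open>
  A compact set is coded by a subset of \<open>[0, 1]\<close> with a continuous decoding, so that Helly's selection
  theorem on the line applies.
\<close>

lemma compact_coding:
  fixes S :: "'a::euclidean_space set"
  assumes "compact S"
  obtains c :: "'a \<Rightarrow> real" and g :: "real \<Rightarrow> 'a"
  where "\<And>x. 0 \<le> c x \<and> c x \<le> 1" "\<And>x. x \<in> S \<Longrightarrow> g (c x) = x"
    "continuous_on UNIV g" "bounded (range g)"
proof -
  obtain B :: "nat \<Rightarrow> 'a set" where "inj B" and B: "\<And>n. open (B n)" "\<And>U. open U \<Longrightarrow> \<exists>k. U = \<Union>{B n |n. n \<in> k}"
    using univ_second_countable_sequence[where 'a='a] by blast
  define c where "c x = (\<Sum>k. if x \<in> B k then 2 / 3 ^ (k + 1) else (0::real))" for x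
  have geo: "(\<lambda>k. 2 / 3 ^ (k + 1) :: real) sums 1"
    using sums_mult[OF geometric_sums[of "1/3::real"], of "2 / 3"] by (simp add: field_simps power_divide)
  have sm: "summable (\<lambda>k. if x \<in> B k then 2 / 3 ^ (k + 1) else (0::real))" for x
    by (rule summable_comparison_test'[OF sums_summable[OF geo], of 0]) auto
  have c01: "0 \<le> c x \<and> c x \<le> 1" for x
  proof
    show "0 \<le> c x" unfolding c_def by (intro suminf_nonneg sm) auto
    have "c x \<le> (\<Sum>k. 2 / 3 ^ (k + 1))" unfolding c_def
      by (intro suminf_le sm sums_summable[OF geo]) auto
    then show "c x \<le> 1" using sums_unique[OF geo] by simp
  qed
  \<comment> \<open>The code \<open>c\<close> itself may be discontinuous; it is the inverse that is
    uniformly continuous. Finitely many basic sets of small diameter cover \<open>S\<close>. If all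
    their indices are below \<open>n\<close>, points of \<open>S\<close> with codes closer than 1 /
    3 ^ n lie in the same ones.\<close>
  have uc: "\<exists>d>0. \<forall>x\<in>S. \<forall>y\<in>S. \<bar>c x - c y\<bar> < d \<longrightarrow> dist x y < e" if "e > 0" for e
  proof -
    let ?I = "{k. \<forall>x\<in>B k. \<forall>y\<in>B k. dist x y < e}"
    have "S \<subseteq> (\<Union>k\<in>?I. B k)"
    proof
      fix x assume "x \<in> S"
      obtain K where K: "ball x (e/2) = \<Union>{B n |n. n \<in> K}" using B(2)[OF open_ball] by blast
      then obtain n where n: "n \<in> K" "x \<in> B n" using \<open>e > 0\<close> centre_in_ball[of x "e/2"] by auto
      then have sub: "B n \<subseteq> ball x (e/2)" using K by blast
      have "dist u v < e" if "u \<in> B n" "v \<in> B n" for u v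
      proof -
        have "dist x u < e/2" "dist x v < e/2" using sub that by auto
        then show ?thesis using dist_triangle_half_r[of x u e v] by simp
      qed
      then show "x \<in> (\<Union>k\<in>?I. B k)" using n by blast
    qed
    then obtain J where J: "J \<subseteq> ?I" "finite J" "S \<subseteq> (\<Union>k\<in>J. B k)"
      by (rule compactE_image[OF assms B(1)])
    obtain n where n: "\<forall>k\<in>J. k < n" using J(2) finite_nat_set_iff_bounded by blast
    show ?thesis
    proof (intro exI conjI ballI impI)
      show "0 < (1::real) / 3 ^ n" by simp
      fix x y assume xy: "x \<in> S" "y \<in> S" "\<bar>c x - c y\<bar> < 1 / 3 ^ n"
      obtain k where k: "k \<in> J" "x \<in> B k" using J(3) xy by blast
      then have "k < n" using n by blast
      then have "y \<in> B k" using ternary_code_separates[of x B y n k] xy(3) k(2) unfolding c_def by blast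
      then show "dist x y < e" using k J(1) by blast
    qed
  qed
  define f where "f = inv_into S c"
  have inj: "inj_on c S"
  proof (rule inj_onI)
    fix x y assume xy: "x \<in> S" "y \<in> S" "c x = c y"
    show "x = y"
    proof (rule ccontr)
      assume "x \<noteq> y"
      then obtain d where "d > 0" "\<forall>x'\<in>S. \<forall>y'\<in>S. \<bar>c x' - c y'\<bar> < d \<longrightarrow> dist x' y' < dist x y"
        using uc[of "dist x y"] by (meson zero_less_dist_iff)
      then show False using xy by (metis abs_zero diff_self less_irrefl)
    qed
  qed
  have fc: "f (c x) = x" if "x \<in> S" for x unfolding f_def using inj that by simp
  have "uniformly_continuous_on (c ` S) f"
    unfolding uniformly_continuous_on_def
  proof (intro allI impI)
    fix e :: real assume "e > 0"
    then obtain d where d: "d > 0" "\<forall>x\<in>S. \<forall>y\<in>S. \<bar>c x - c y\<bar> < d \<longrightarrow> dist x y < e" using uc by blast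
    show "\<exists>d>0. \<forall>x\<in>c ` S. \<forall>x'\<in>c ` S. dist x' x < d \<longrightarrow> dist (f x') (f x) < e"
      using d fc by (intro exI[of _ d]) (auto simp: dist_real_def)
  qed
  \<comment> \<open>The decoding is extended in two stages: to the closure of the code set, where it
    still takes values in \<open>S\<close>, and then to the whole line by Tietze with the same
    bound.\<close>
  then obtain h where h: "uniformly_continuous_on (closure (c ` S)) h" "\<And>x. x \<in> c ` S \<Longrightarrow> f x = h x"
    by (rule uniformly_continuous_on_extension_on_closure) blast
  have hc: "continuous_on (closure (c ` S)) h" using h(1) by (rule uniformly_continuous_imp_continuous)
  have "h ` closure (c ` S) \<subseteq> S"
    by (rule image_closure_subset[OF hc compact_imp_closed[OF assms]]) (use h fc in auto)
  moreover obtain b where b: "b > 0" "\<And>x. x \<in> S \<Longrightarrow> norm x \<le> b"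
    using compact_imp_bounded[OF assms] bounded_pos by blast
  ultimately have "norm (h t) \<le> b" if "t \<in> closure (c ` S)" for t using that by blast
  then obtain g where g: "continuous_on UNIV g" "\<And>t. t \<in> closure (c ` S) \<Longrightarrow> g t = h t" "\<And>t. t \<in> UNIV \<Longrightarrow> norm (g t) \<le> b"
    using Tietze[OF hc, of UNIV b] b(1) by auto
  show thesis
  proof
    show "g (c x) = x" if "x \<in> S" for x
      using g(2)[of "c x"] h(2)[of "c x"] fc[OF that] that closure_subset[of "c ` S"] by (metis image_eqI subsetD)
    show "bounded (range g)" using g(3) by (auto simp: bounded_iff)
  qed (use c01 g in auto)
qed

text \<open>The points are coded on the line, where tightness is clear because codes lie in [0, 1].
  A weak limit \<open>N\<close> of the code distributions is carried back by the decoding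
  \<open>g\<close>: a continuous test function composed with \<open>g\<close> is continuous and
  bounded, and \<open>g\<close> returns the original points. Only the decoding has to be
  continuous.\<close>

lemma empirical_measures_weakly_compact:
  fixes S :: "'a::euclidean_space set" and y :: "nat \<Rightarrow> nat \<Rightarrow> 'a" and m :: "nat \<Rightarrow> nat"
  assumes S: "compact S" and y: "\<And>n j. j < m n \<Longrightarrow> y n j \<in> S" and m: "\<And>n. 0 < m n"
  obtains r M where "strict_mono (r::nat \<Rightarrow> nat)" "prob_space M" "sets M = sets (borel :: 'a measure)" "emeasure M S = 1"
    "\<And>h :: 'a \<Rightarrow> 'b::{banach,second_countable_topology}. continuous_on UNIV h \<Longrightarrow>
      (\<lambda>n. (\<Sum>j<m (r n). h (y (r n) j)) /\<^sub>R real (m (r n))) \<longlonglongrightarrow> (\<integral>x. h x \<partial>M)"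
proof -
  obtain c :: "'a \<Rightarrow> real" and g where c: "\<And>x. 0 \<le> c x \<and> c x \<le> 1" "\<And>x. x \<in> S \<Longrightarrow> g (c x) = x"
    and g: "continuous_on UNIV g" "bounded (range g)" using compact_coding[OF S] by blast
  define R where "R n = distr (measure_pmf (map_pmf (\<lambda>j. c (y n j)) (pmf_of_set {..<m n}))) borel (\<lambda>x. x)" for n
  have Rd: "real_distribution (R n)" for n
    unfolding R_def real_distribution_def real_distribution_axioms_def
    by (simp add: measure_pmf.prob_space_distr)
  have Rint: "integral\<^sup>L (R n) k = (\<Sum>j<m n. k (c (y n j))) /\<^sub>R real (m n)"
    if "k \<in> borel_measurable borel" for k :: "real \<Rightarrow> 'c::{banach,second_countable_topology}" and n
  proof -
    have ne: "{..<m n} \<noteq> {}" using m[of n] by auto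
    have "integral\<^sup>L (R n) k = (\<integral>j. k (c (y n j)) \<partial>measure_pmf (pmf_of_set {..<m n}))"
      unfolding R_def using that by (subst integral_distr) auto
    also have "\<dots> = (\<Sum>j<m n. k (c (y n j))) /\<^sub>R real (m n)"
      by (subst integral_measure_pmf[of "{..<m n}"])
         (use ne m[of n] in \<open>auto simp: scaleR_sum_right divide_simps\<close>)
    finally show ?thesis .
  qed
  have "tight R"
    unfolding tight_def
  proof (intro conjI allI impI)
    fix e :: real assume e: "0 < e"
    \<comment> \<open>The interval is open on the left, so it starts below 0 to catch the code
      0.\<close>
    have "1 - e < measure (R n) {-1<..1}" for n
    proof -
      have "measure (R n) {-1<..1} = 1"
      proof -
        have "measure (R n) {-1<..1} = integral\<^sup>L (R n) (indicator {-1<..1} :: real \<Rightarrow> real)"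
          unfolding R_def by simp
        also have "\<dots> = (\<Sum>j<m n. indicator {-1<..1} (c (y n j))) /\<^sub>R real (m n)"
          by (rule Rint) simp
        also have "(\<Sum>j<m n. indicator {-1<..1} (c (y n j)) :: real) = (\<Sum>j<m n. 1)"
          using c(1) by (intro sum.cong) (auto simp: indicator_def intro: less_le_trans[of _ 0])
        finally show ?thesis using m[of n] by simp
      qed
      then show ?thesis using e by simp
    qed
    then show "\<exists>a b. a < b \<and> (\<forall>n. 1 - e < measure (R n) {a<..b})" by (intro exI[of _ "-1"] exI[of _ 1]) auto
  qed (rule Rd)
  then obtain r N where r: "strict_mono r" "real_distribution N" "weak_conv_m (R \<circ> id \<circ> r) N"
    using tight_imp_convergent_subsubsequence[of R id] by (auto simp: strict_mono_id)
  interpret N: real_distribution N by fact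
  have gm[measurable]: "g \<in> borel_measurable borel" by (intro borel_measurable_continuous_onI g)
  define M where "M = distr N borel g"
  interpret M: prob_space M unfolding M_def by (rule N.prob_space_distr) simp
  have lim: "(\<lambda>n. (\<Sum>j<m (r n). h (y (r n) j)) /\<^sub>R real (m (r n))) \<longlonglongrightarrow> (\<integral>x. h x \<partial>M)"
    if h: "continuous_on UNIV h" for h :: "'a \<Rightarrow> 'c::{banach,second_countable_topology}"
  proof -
    have hm[measurable]: "h \<in> borel_measurable borel" by (intro borel_measurable_continuous_onI h)
    have ch: "continuous_on UNIV (\<lambda>x. h (g x))"
      using continuous_on_compose2[OF h g(1)] by simp
    have "compact (closure (range g))" using g(2) by simp
    then have "bounded (h ` closure (range g))"
      by (meson compact_continuous_image compact_imp_bounded continuous_on_subset h subset_UNIV)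
    then obtain b where b: "\<And>x. norm (h (g x)) \<le> b"
      by (meson bounded_iff closure_subset image_eqI rangeI subsetD)
    have "(\<lambda>n. integral\<^sup>L ((R \<circ> id \<circ> r) n) (\<lambda>x. h (g x))) \<longlonglongrightarrow> integral\<^sup>L N (\<lambda>x. h (g x))"
      by (rule weak_conv_imp_integral_bdd_continuous_conv[OF _ r(2,3) _ b])
        (use ch Rd in \<open>auto simp: continuous_on_eq_continuous_at\<close>)
    moreover have "integral\<^sup>L ((R \<circ> id \<circ> r) n) (\<lambda>x. h (g x)) = (\<Sum>j<m (r n). h (y (r n) j)) /\<^sub>R real (m (r n))" for n
      by (simp add: Rint c(2) y)
    moreover have "integral\<^sup>L N (\<lambda>x. h (g x)) = (\<integral>x. h x \<partial>M)" unfolding M_def by (subst integral_distr) auto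
    ultimately show ?thesis by simp
  qed
  have SM: "emeasure M S = 1"
  proof -
    have ne: "S \<noteq> {}" using y[of 0 0] m[of 0] by auto
    \<comment> \<open>This test function vanishes exactly on the closed set \<open>S\<close>. Its
      empirical means are 0, hence so is its integral in the limit.\<close>
    define h where "h x = min 1 (infdist x S)" for x
    have hc: "continuous_on UNIV h" unfolding h_def by (intro continuous_intros)
    have hm[measurable]: "h \<in> borel_measurable M" unfolding M_def using hc by (simp add: borel_measurable_continuous_onI)
    have "(\<lambda>n. (\<Sum>j<m (r n). h (y (r n) j)) /\<^sub>R real (m (r n))) = (\<lambda>n. 0)"
      by (intro ext) (use y in \<open>auto simp: h_def intro!: sum.neutral\<close>)
    then have "(\<integral>x. h x \<partial>M) = 0" using lim[OF hc] by (simp add: LIMSEQ_const_iff)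
    moreover have "integrable M h" by (rule M.integrable_const_bound[of _ 1]) (auto simp: h_def infdist_nonneg)
    moreover have "\<And>x. 0 \<le> h x" by (auto simp: h_def infdist_nonneg)
    ultimately have "AE x in M. h x = 0" by (subst (asm) integral_nonneg_eq_0_iff_AE) auto
    then have "AE x in M. x \<in> S"
      by eventually_elim (use in_closed_iff_infdist_zero[OF compact_imp_closed[OF S] ne] in \<open>auto simp: h_def min_def split: if_splits\<close>)
    moreover have "S \<in> sets M" unfolding M_def using compact_imp_closed[OF S] by simp
    ultimately show ?thesis by (simp add: M.emeasure_eq_1_AE)
  qed
  show thesis by (rule that[of r M]) (use r M.prob_space_axioms SM lim in \<open>auto simp: M_def\<close>)
qed

section \<open>Energies in the extended reals\<close>

lemma ereal_set_integral_cong: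
  assumes "\<And>x. x \<in> S \<Longrightarrow> f x = g x"
  shows "ereal_set_integral M S f = ereal_set_integral M S g"
proof -
  have "(\<integral>\<^sup>+x\<in>S. e2ennreal (f x) \<partial>M) = (\<integral>\<^sup>+x\<in>S. e2ennreal (g x) \<partial>M)"
    "(\<integral>\<^sup>+x\<in>S. e2ennreal (- f x) \<partial>M) = (\<integral>\<^sup>+x\<in>S. e2ennreal (- g x) \<partial>M)"
    using assms by (auto intro!: nn_integral_cong simp: indicator_def)
  then show ?thesis by (simp add: ereal_set_integral_def)
qed

text \<open>This is "positive part plus \<open>b\<close> equals \<open>x + b\<close> plus negative
  part", arranged so that all terms are nonnegative. It can therefore be integrated even if the
  integral of the positive part is infinite.\<close>

lemma e2ennreal_shift:
  assumes "ereal (- b) \<le> x" "0 \<le> b"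
  shows "e2ennreal x + ennreal b = e2ennreal (x + ereal b) + e2ennreal (- x)"
proof (cases x)
  case (real r)
  then show ?thesis using assms
    by (cases "r \<ge> 0") (auto simp: ennreal_neg simp flip: ennreal_plus)
qed (use assms in auto)

lemma nn_set_integral_full:
  assumes "prob_space M" "S \<in> sets M" "emeasure M S = 1"
  shows "(\<integral>\<^sup>+x\<in>S. f x \<partial>M) = (\<integral>\<^sup>+x. f x \<partial>M)"
proof -
  interpret prob_space M by fact
  have "AE x in M. x \<in> S" using assms(3) prob_space.emeasure_eq_1_AE[OF assms(1,2)]
    by (subst (asm) emeasure_eq_measure) (use AE_in_set_eq_1[OF assms(2)] in \<open>auto simp: emeasure_eq_measure\<close>)
  then show ?thesis by (intro nn_integral_cong_AE) auto
qed

text \<open>On a probability space a constant integrates to itself, so a function bounded below can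
  be shifted to a nonnegative one and the shift undone afterwards. This gives access to monotone
  convergence and to averaging in \<open>ennreal\<close>.\<close>

lemma ereal_set_integral_bounded_below:
  assumes M: "prob_space M" and S: "S \<in> sets M" "emeasure M S = 1"
    and G[measurable]: "G \<in> borel_measurable M" and b: "0 \<le> b" "\<And>x. x \<in> space M \<Longrightarrow> ereal (- b) \<le> G x"
  shows "ereal_set_integral M S G = enn2ereal (\<integral>\<^sup>+x. e2ennreal (G x + ereal b) \<partial>M) - ereal b"
proof -
  interpret prob_space M by fact
  let ?P = "\<integral>\<^sup>+x. e2ennreal (G x) \<partial>M" and ?N = "\<integral>\<^sup>+x. e2ennreal (- G x) \<partial>M"
    and ?T = "\<integral>\<^sup>+x. e2ennreal (G x + ereal b) \<partial>M"
  have "?P + ennreal b = (\<integral>\<^sup>+x. e2ennreal (G x) + ennreal b \<partial>M)"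
    by (subst nn_integral_add) (auto simp: emeasure_space_1)
  also have "\<dots> = (\<integral>\<^sup>+x. e2ennreal (G x + ereal b) + e2ennreal (- G x) \<partial>M)"
    by (intro nn_integral_cong e2ennreal_shift b)
  also have "\<dots> = ?T + ?N" by (rule nn_integral_add) auto
  finally have eq: "?P + ennreal b = ?T + ?N" .
  have "?N \<le> (\<integral>\<^sup>+x. ennreal b \<partial>M)"
  proof (rule nn_integral_mono)
    fix x assume "x \<in> space M"
    then have "- G x \<le> ereal b" using b(2)[of x] by (simp add: ereal_uminus_le_reorder)
    then show "e2ennreal (- G x) \<le> ennreal b" using e2ennreal_mono by fastforce
  qed
  then have "?N \<le> ennreal b" by (simp add: emeasure_space_1)
  then obtain n where n: "?N = ennreal n" "0 \<le> n"
    by (cases ?N) (auto simp: top_unique)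
  have "enn2ereal ?P - enn2ereal ?N = enn2ereal ?T - ereal b"
  proof (cases ?P)
    case (real p)
    then have "?T \<noteq> top" using eq n by (metis ennreal_add_eq_top ennreal_neq_top)
    then obtain t where t: "?T = ennreal t" "0 \<le> t" by (cases ?T) auto
    have "ennreal (p + b) = ennreal (t + n)" using eq real n t b(1) by (simp add: ennreal_plus)
    then have "p + b = t + n" using real n t b by (subst (asm) ennreal_inj) auto
    then show ?thesis using real n t by simp
  next
    case top
    then have "?T = top" using eq n by (metis ennreal_add_eq_top ennreal_neq_top)
    then show ?thesis using n top by simp
  qed
  then show ?thesis unfolding ereal_set_integral_def by (simp add: nn_set_integral_full[OF M S])
qed

lemma e2ennreal_SUP_incseq:
  fixes h :: "nat \<Rightarrow> real"
  assumes "incseq h"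
  shows "e2ennreal (SUP n. ereal (h n)) = (SUP n. ennreal (h n))"
proof -
  have "incseq (\<lambda>n. ereal (h n))" using assms by (simp add: incseq_def)
  from sup_continuousD[OF sup_continuous_e2ennreal[OF sup_continuous_id] this]
  show ?thesis by simp
qed

text \<open>Monotone convergence, where the bound of \<open>g 0\<close> serves as a common lower
  bound. The bounds \<open>B n\<close> may grow with \<open>n\<close>, so the limit may be
  infinite.\<close>

lemma ereal_set_integral_SUP:
  fixes g :: "nat \<Rightarrow> 'a \<Rightarrow> real"
  assumes M: "prob_space M" and S: "S \<in> sets M" "emeasure M S = 1"
    and g[measurable]: "\<And>n. g n \<in> borel_measurable M" and B: "\<And>n x. x \<in> space M \<Longrightarrow> \<bar>g n x\<bar> \<le> B n"
    and inc: "\<And>x. x \<in> space M \<Longrightarrow> incseq (\<lambda>n. g n x)"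
  shows "ereal_set_integral M S (\<lambda>x. SUP n. ereal (g n x)) = (SUP n. ereal (\<integral>x. g n x \<partial>M))"
proof -
  interpret prob_space M by fact
  define b where "b = \<bar>B 0\<bar>"
  have gb: "- b \<le> g n x" if "x \<in> space M" for n x
  proof -
    have "g 0 x \<le> g n x" using incseqD[OF inc[OF that], of 0 n] by simp
    moreover have "\<bar>g 0 x\<bar> \<le> b" using B[OF that, of 0] unfolding b_def by linarith
    ultimately show ?thesis by linarith
  qed
  have b0: "0 \<le> b" by (simp add: b_def)
  have ig: "integrable M (g n)" for n
    by (rule integrable_const_bound[of _ "B n"]) (auto intro!: AE_I2 simp: B)
  have T: "(\<integral>\<^sup>+x. e2ennreal ((SUP n. ereal (g n x)) + ereal b) \<partial>M) = (SUP n. ennreal ((\<integral>x. g n x \<partial>M) + b))"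
  proof -
    have "(\<integral>\<^sup>+x. e2ennreal ((SUP n. ereal (g n x)) + ereal b) \<partial>M) = (\<integral>\<^sup>+x. (SUP n. ennreal (g n x + b)) \<partial>M)"
    proof (rule nn_integral_cong)
      fix x assume "x \<in> space M"
      have "(SUP n. ereal (g n x)) + ereal b = (SUP n. ereal (g n x) + ereal b)"
        by (rule SUP_ereal_add_left[symmetric]) auto
      then show "e2ennreal ((SUP n. ereal (g n x)) + ereal b) = (SUP n. ennreal (g n x + b))"
        using e2ennreal_SUP_incseq[of "\<lambda>n. g n x + b"] inc[OF \<open>x \<in> space M\<close>] by (simp add: incseq_def)
    qed
    also have "\<dots> = (SUP n. \<integral>\<^sup>+x. ennreal (g n x + b) \<partial>M)"
      by (rule nn_integral_monotone_convergence_SUP_AE)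
        (auto intro!: AE_I2 ennreal_leI incseqD[OF inc])
    also have "\<dots> = (SUP n. ennreal ((\<integral>x. g n x \<partial>M) + b))"
    proof (rule SUP_cong)
      fix n
      have "(\<integral>\<^sup>+x. ennreal (g n x + b) \<partial>M) = ennreal (\<integral>x. g n x + b \<partial>M)"
        using ig[of n] gb by (intro nn_integral_eq_integral AE_I2) (auto simp: le_diff_eq[symmetric] minus_le_iff dest: gb[of _ n])
      then show "(\<integral>\<^sup>+x. ennreal (g n x + b) \<partial>M) = ennreal ((\<integral>x. g n x \<partial>M) + b)"
        using ig[of n] by (simp add: prob_space)
    qed simp
    finally show ?thesis .
  qed
  have ib: "0 \<le> (\<integral>x. g n x \<partial>M) + b" for n
    using integral_mono[OF _ ig[of n], of "\<lambda>_. - b"] gb by (simp add: prob_space)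
  have "ereal_set_integral M S (\<lambda>x. SUP n. ereal (g n x)) = enn2ereal (SUP n. ennreal ((\<integral>x. g n x \<partial>M) + b)) - ereal b"
    unfolding T[symmetric]
  proof (rule ereal_set_integral_bounded_below[OF M S _ b0])
    fix x assume "x \<in> space M"
    then show "ereal (- b) \<le> (SUP n. ereal (g n x))"
      by (intro order_trans[OF _ SUP_upper[of 0]]) (auto simp: gb)
  qed measurable
  also have "enn2ereal (SUP n. ennreal ((\<integral>x. g n x \<partial>M) + b)) = (SUP n. ereal ((\<integral>x. g n x \<partial>M) + b))"
  proof -
    have "(SUP n. ereal ((\<integral>x. g n x \<partial>M) + b)) \<ge> 0"
      by (rule order_trans[OF _ SUP_upper[of 0]]) (use ib in auto)
    moreover have "(SUP n. ennreal ((\<integral>x. g n x \<partial>M) + b)) = e2ennreal (SUP n. ereal ((\<integral>x. g n x \<partial>M) + b))"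
      using e2ennreal_SUP_incseq[of "\<lambda>n. (\<integral>x. g n x \<partial>M) + b"] integral_mono[OF ig ig] incseqD[OF inc]
      by (simp add: incseq_def)
    ultimately show ?thesis by (simp add: enn2ereal_e2ennreal)
  qed
  also have "\<dots> = (SUP n. ereal (\<integral>x. g n x \<partial>M) + ereal b)" by simp
  also have "\<dots> = (SUP n. ereal (\<integral>x. g n x \<partial>M)) + ereal b"
    by (rule SUP_ereal_add_left) auto
  also have "\<dots> - ereal b = (SUP n. ereal (\<integral>x. g n x \<partial>M))"
    by (cases "SUP n. ereal (\<integral>x. g n x \<partial>M)") auto
  finally show ?thesis .
qed

text \<open>If \<open>g\<close> exceeded its mean \<open>v\<close> everywhere on \<open>A\<close>,
  then \<open>g - v\<close> would be positive almost everywhere and yet have integral 0. An infinite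
  mean is no exception, since no value exceeds it.\<close>

lemma exists_le_average:
  assumes M: "prob_space M" and A: "A \<in> sets M" "emeasure M A = 1" and g[measurable]: "g \<in> borel_measurable M"
  shows "\<exists>x\<in>A. g x \<le> (\<integral>\<^sup>+x. g x \<partial>M)"
proof (rule ccontr)
  interpret prob_space M by fact
  define v where "v = (\<integral>\<^sup>+x. g x \<partial>M)"
  assume "\<not> ?thesis"
  then have gt: "v < g x" if "x \<in> A" for x using that unfolding v_def by (auto simp: not_le)
  have "A \<noteq> {}" using A by auto
  then have "v < top" using gt by (metis ex_in_conv less_top order_less_le_trans top_greatest)
  have AE: "AE x in M. x \<in> A" using A AE_in_set_eq_1[OF A(1)] by (simp add: emeasure_eq_measure)
  have "(\<integral>\<^sup>+x. (g x - v) \<partial>M) = (\<integral>\<^sup>+x. g x \<partial>M) - (\<integral>\<^sup>+x. v \<partial>M)"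
    using AE \<open>v < top\<close> by (intro nn_integral_diff) (auto elim!: eventually_mono dest!: gt simp: emeasure_space_1)
  also have "\<dots> = 0" using \<open>v < top\<close> by (simp add: emeasure_space_1 v_def[symmetric])
  finally have "AE x in M. g x - v = 0" by (subst (asm) nn_integral_0_iff_AE) auto
  with AE have "AE x in M. False"
    by eventually_elim (use gt \<open>v < top\<close> in \<open>auto simp: diff_eq_0_iff_ennreal less_top[symmetric] not_le[symmetric]\<close>)
  then show False by (simp add: AE_False)
qed

section \<open>Configurations with energy at most the average\<close>

abbreviation pairs :: "nat \<Rightarrow> (nat \<times> nat) set" where
  "pairs N \<equiv> {(j, k). j < N \<and> k < N \<and> j \<noteq> k}"

lemma sum_pairs_Suc:
  fixes f :: "nat \<Rightarrow> nat \<Rightarrow> 'a::comm_monoid_add"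
  shows "(\<Sum>(j, k)\<in>pairs (Suc m). f j k) =
    (\<Sum>(j, k)\<in>pairs m. f j k) + (\<Sum>j<m. f j m) + (\<Sum>j<m. f m j)"
proof -
  have fin: "finite (pairs m)"
    by (rule finite_subset[of _ "{..<m} \<times> {..<m}"]) auto
  have eq: "pairs (Suc m) =
    (pairs m \<union> (\<lambda>j. (j, m)) ` {..<m}) \<union> (\<lambda>j. (m, j)) ` {..<m}"
    by (auto simp: less_Suc_eq)
  show ?thesis unfolding eq
    by (subst sum.union_disjoint, use fin in \<open>auto simp: sum.reindex inj_on_def\<close>,
        subst sum.union_disjoint, use fin in \<open>auto simp: sum.reindex inj_on_def\<close>)
qed

text \<open>
  The points are chosen one at a time: given the first ones, the next one is chosen at or below the
  mean of the energy in which all later points are distributed according to \<open>M\<close>.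
\<close>

lemma configuration_below_average:
  fixes \<kappa> :: "'a \<Rightarrow> 'a \<Rightarrow> ennreal"
  assumes M: "prob_space M" and A: "A \<in> sets M" "emeasure M A = 1"
    and sym: "\<And>x y. x \<in> A \<Longrightarrow> y \<in> A \<Longrightarrow> \<kappa> x y = \<kappa> y x"
    and meas[measurable]: "\<And>y. y \<in> A \<Longrightarrow> (\<lambda>x. \<kappa> x y) \<in> borel_measurable M"
    and measU[measurable]: "(\<lambda>y. \<integral>\<^sup>+x. \<kappa> x y \<partial>M) \<in> borel_measurable M"
  shows "\<exists>\<omega>. (\<forall>j<m. \<omega> j \<in> A) \<and>
    (\<Sum>(j, k)\<in>pairs m. \<kappa> (\<omega> j) (\<omega> k)) + of_nat (2 * p) * (\<Sum>j<m. \<integral>\<^sup>+x. \<kappa> x (\<omega> j) \<partial>M)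
      + of_nat (p * (p - 1)) * (\<integral>\<^sup>+y. \<integral>\<^sup>+x. \<kappa> x y \<partial>M \<partial>M)
    \<le> of_nat ((p + m) * (p + m - 1)) * (\<integral>\<^sup>+y. \<integral>\<^sup>+x. \<kappa> x y \<partial>M \<partial>M)"
proof (induction m arbitrary: p)
  case 0
  then show ?case by auto
next
  case (Suc m)
  interpret prob_space M by fact
  define U where "U y = (\<integral>\<^sup>+x. \<kappa> x y \<partial>M)" for y
  define \<Lambda> where "\<Lambda> = (\<integral>\<^sup>+y. U y \<partial>M)"
  have Um[measurable]: "U \<in> borel_measurable M" using measU unfolding U_def .
  \<comment> \<open>The bounded quantity is the mean energy with \<open>m\<close> points fixed and
    \<open>p\<close> points still random: a random point meets a fixed one in two ordered pairs, and
    the random ones form \<open>p * (p - 1)\<close> pairs among themselves. The induction hypothesis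
    is used with one more random point, which is now going to be fixed.\<close>
  obtain \<omega> where \<omega>: "\<And>j. j < m \<Longrightarrow> \<omega> j \<in> A" and le:
    "(\<Sum>(j, k)\<in>pairs m. \<kappa> (\<omega> j) (\<omega> k)) + of_nat (2 * Suc p) * (\<Sum>j<m. U (\<omega> j))
      + of_nat (Suc p * (Suc p - 1)) * \<Lambda> \<le> of_nat ((Suc p + m) * (Suc p + m - 1)) * \<Lambda>"
    using Suc.IH[of "Suc p"] unfolding \<Lambda>_def U_def by blast
  define E0 where "E0 = (\<Sum>(j, k)\<in>pairs m. \<kappa> (\<omega> j) (\<omega> k))"
  \<comment> \<open>The mean energy once the next point is placed at \<open>x\<close>. Its mean over
    \<open>x\<close> is the quantity bounded by the induction hypothesis.\<close>
  define g where "g x = E0 + 2 * (\<Sum>j<m. \<kappa> x (\<omega> j)) + of_nat (2 * p) * ((\<Sum>j<m. U (\<omega> j)) + U x)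
    + of_nat (p * (p - 1)) * \<Lambda>" for x
  have [measurable]: "(\<lambda>x. \<kappa> x (\<omega> j)) \<in> borel_measurable M" if "j < m" for j using meas \<omega> that by blast
  have sumU: "(\<integral>\<^sup>+x. (\<Sum>j<m. \<kappa> x (\<omega> j)) \<partial>M) = (\<Sum>j<m. U (\<omega> j))"
    unfolding U_def by (rule nn_integral_sum) auto
  have [measurable]: "(\<lambda>x. \<Sum>j<m. \<kappa> x (\<omega> j)) \<in> borel_measurable M" by (rule borel_measurable_sum) auto
  have gm[measurable]: "g \<in> borel_measurable M" unfolding g_def by measurable
  have "(\<integral>\<^sup>+x. g x \<partial>M) = E0 + 2 * (\<Sum>j<m. U (\<omega> j)) + of_nat (2 * p) * ((\<Sum>j<m. U (\<omega> j)) + \<Lambda>)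
    + of_nat (p * (p - 1)) * \<Lambda>"
    unfolding g_def
    by (simp add: nn_integral_add nn_integral_cmult sumU emeasure_space_1 \<Lambda>_def[symmetric])
  also have "\<dots> = E0 + of_nat (2 * Suc p) * (\<Sum>j<m. U (\<omega> j)) + of_nat (Suc p * (Suc p - 1)) * \<Lambda>"
  proof -
    have "(of_nat (Suc p * (Suc p - 1)) :: ennreal) = of_nat (2 * p) + of_nat (p * (p - 1))"
      by (subst of_nat_add[symmetric], rule arg_cong[of _ _ of_nat]) (cases p; simp add: algebra_simps)
    moreover have "(of_nat (2 * Suc p) :: ennreal) = 2 + of_nat (2 * p)" by simp
    ultimately show ?thesis by (simp only: distrib_left distrib_right ac_simps)
  qed
  finally have ig: "(\<integral>\<^sup>+x. g x \<partial>M) \<le> of_nat ((Suc p + m) * (Suc p + m - 1)) * \<Lambda>"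
    using le unfolding E0_def by simp
  obtain x where x: "x \<in> A" "g x \<le> (\<integral>\<^sup>+x. g x \<partial>M)" using exists_le_average[OF M A gm] by blast
  define \<omega>' where "\<omega>' = (\<lambda>j. if j = m then x else \<omega> j)"
  have sums: "(\<Sum>(j, k)\<in>pairs m. \<kappa> (\<omega>' j) (\<omega>' k)) = E0"
    "(\<Sum>j<m. \<kappa> (\<omega>' j) (\<omega>' m)) = (\<Sum>j<m. \<kappa> x (\<omega> j))" "(\<Sum>j<m. \<kappa> (\<omega>' m) (\<omega>' j)) = (\<Sum>j<m. \<kappa> x (\<omega> j))"
    "(\<Sum>j<m. U (\<omega>' j)) = (\<Sum>j<m. U (\<omega> j))"
    unfolding E0_def \<omega>'_def using \<omega> x by (auto intro!: sum.cong sym)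
  have "(\<Sum>(j, k)\<in>pairs (Suc m). \<kappa> (\<omega>' j) (\<omega>' k)) + of_nat (2 * p) * (\<Sum>j<Suc m. U (\<omega>' j))
      + of_nat (p * (p - 1)) * \<Lambda> = g x"
    unfolding sum_pairs_Suc sums g_def by (simp add: sums(4) mult_2 \<omega>'_def distrib_left distrib_right ac_simps)
  then show ?case using x(2) ig \<omega> x(1)
    by (intro exI[of _ \<omega>']) (auto simp: U_def[symmetric] \<Lambda>_def[symmetric] \<omega>'_def less_Suc_eq simp del: of_nat_mult of_nat_add mult_Suc sum.lessThan_Suc)
qed

section \<open>Potential theory of kernels with Fourier expansions\<close>

text \<open>One expression in three roles. With the values of the functions \<open>E i\<close> at
  two points it is a truncated kernel, with Fourier coefficients of a measure on one side the
  potential of that measure, and with them on both sides its energy.\<close>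

definition weighted_form :: "(nat \<Rightarrow> real) \<Rightarrow> (nat \<Rightarrow> complex) \<Rightarrow> (nat \<Rightarrow> complex) \<Rightarrow> real" where
  "weighted_form a u v = (\<Sum>i. a i * Re (u i * cnj (v i)))"

definition fourier_coeff :: "(nat \<Rightarrow> 'a \<Rightarrow> complex) \<Rightarrow> 'a measure \<Rightarrow> nat \<Rightarrow> complex" where
  "fourier_coeff E M i = (\<integral>x. E i x \<partial>M)"

lemma abs_Re_mult_cnj_le_1:
  assumes "norm z \<le> 1" "norm w \<le> 1"
  shows "\<bar>Re (z * cnj w)\<bar> \<le> 1"
  by (rule order_trans[OF abs_Re_le_cmod]) (use mult_mono[OF assms] in \<open>simp add: norm_mult\<close>)

lemma weighted_form_term_bound:
  assumes "\<And>i. norm (u i) \<le> 1" "\<And>i. norm (v i) \<le> 1"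
  shows "\<bar>a i * Re (u i * cnj (v i))\<bar> \<le> \<bar>a i\<bar>"
  using mult_left_mono[OF abs_Re_mult_cnj_le_1[OF assms(1)[of i] assms(2)[of i]], of "\<bar>a i\<bar>"] by (simp add: abs_mult)

lemma summable_weighted_form:
  assumes "summable (\<lambda>i. \<bar>a i\<bar>)" "\<And>i. norm (u i) \<le> 1" "\<And>i. norm (v i) \<le> 1"
  shows "summable (\<lambda>i. a i * Re (u i * cnj (v i)))"
  by (rule summable_comparison_test'[OF assms(1), of 0]) (use weighted_form_term_bound[OF assms(2,3), of a] in simp)

lemma abs_weighted_form_le:
  assumes "summable (\<lambda>i. \<bar>a i\<bar>)" "\<And>i. norm (u i) \<le> 1" "\<And>i. norm (v i) \<le> 1"
  shows "\<bar>weighted_form a u v\<bar> \<le> (\<Sum>i. \<bar>a i\<bar>)"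
proof -
  have s: "summable (\<lambda>i. \<bar>a i * Re (u i * cnj (v i))\<bar>)"
    by (rule summable_comparison_test'[OF assms(1), of 0]) (use weighted_form_term_bound[OF assms(2,3), of a] in simp)
  have "\<bar>weighted_form a u v\<bar> \<le> (\<Sum>i. \<bar>a i * Re (u i * cnj (v i))\<bar>)"
    unfolding weighted_form_def by (rule summable_rabs[OF s])
  also have "\<dots> \<le> (\<Sum>i. \<bar>a i\<bar>)"
    by (rule suminf_le[OF _ s assms(1)]) (rule weighted_form_term_bound[OF assms(2,3)])
  finally show ?thesis .
qed

text \<open>Absolute summability of the weights permits termwise integration. The second argument is
  an arbitrary vector bounded by 1, so the lemma can be applied twice, from kernel to potential and
  from potential to energy.\<close>

lemma integral_weighted_form:
  assumes M: "prob_space M" and a: "summable (\<lambda>i. \<bar>a i\<bar>)" and v: "\<And>i. norm (v i) \<le> 1"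
    and E[measurable]: "\<And>i. E i \<in> borel_measurable M" and E1: "\<And>i x. x \<in> space M \<Longrightarrow> norm (E i x) \<le> 1"
  shows "(\<integral>x. weighted_form a (\<lambda>i. E i x) v \<partial>M) = weighted_form a (fourier_coeff E M) v"
    and "norm (fourier_coeff E M i) \<le> 1"
    and "(\<lambda>x. weighted_form a (\<lambda>i. E i x) v) \<in> borel_measurable M"
proof -
  interpret prob_space M by fact
  have iE: "integrable M (E i)" for i by (rule integrable_const_bound[of _ 1]) (auto intro!: AE_I2 E1)
  have bd: "\<bar>a i * Re (E i x * cnj (v i))\<bar> \<le> \<bar>a i\<bar>" if "x \<in> space M" for i x
    using mult_left_mono[OF abs_Re_mult_cnj_le_1[OF E1[OF that, of i] v[of i]], of "\<bar>a i\<bar>"] by (simp add: abs_mult)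
  have coeff: "(\<integral>x. a i * Re (E i x * cnj (v i)) \<partial>M) = a i * Re (fourier_coeff E M i * cnj (v i))" for i
    unfolding fourier_coeff_def
    by (subst integral_mult_left_zero[symmetric], subst integral_Re[symmetric]) (auto simp: iE)
  have it: "integrable M (\<lambda>x. a i * Re (E i x * cnj (v i)))" for i
  proof (rule integrable_const_bound[of _ "\<bar>a i\<bar>"])
    show "AE x in M. norm (a i * Re (E i x * cnj (v i))) \<le> \<bar>a i\<bar>"
      by (rule AE_I2) (simp only: real_norm_def bd)
  qed measurable
  show "(\<integral>x. weighted_form a (\<lambda>i. E i x) v \<partial>M) = weighted_form a (fourier_coeff E M) v"
    unfolding weighted_form_def coeff[symmetric]
  proof (rule integral_suminf[OF it])
    show "AE x in M. summable (\<lambda>i. norm (a i * Re (E i x * cnj (v i))))"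
      by (intro AE_I2 summable_comparison_test'[OF a, of 0]) (use bd in auto)
    have "(\<integral>x. norm (a i * Re (E i x * cnj (v i))) \<partial>M) \<le> (\<integral>x. \<bar>a i\<bar> \<partial>M)" for i
      by (rule integral_mono) (use it bd in auto)
    then show "summable (\<lambda>i. \<integral>x. norm (a i * Re (E i x * cnj (v i))) \<partial>M)"
      by (intro summable_comparison_test'[OF a, of 0]) (simp add: prob_space)
  qed
  show "norm (fourier_coeff E M i) \<le> 1"
    unfolding fourier_coeff_def
    by (rule order_trans[OF integral_norm_bound]) (use integral_mono[of M "\<lambda>x. norm (E i x)" "\<lambda>_. 1"] iE E1 in \<open>simp add: prob_space\<close>)
  show "(\<lambda>x. weighted_form a (\<lambda>i. E i x) v) \<in> borel_measurable M"
    unfolding weighted_form_def by measurable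
qed

lemma weighted_form_commute: "weighted_form a u v = weighted_form a v u"
  unfolding weighted_form_def by (intro suminf_cong) (simp add: algebra_simps)

text \<open>Because the diagonal is included, the double sum factors at every index into a square.
  This is the link between discrete energies and Fourier coefficients of empirical measures.\<close>

lemma weighted_form_sum:
  assumes a: "summable (\<lambda>i. \<bar>a i\<bar>)" and u: "\<And>j i. j \<in> J \<Longrightarrow> norm (u j i) \<le> 1" and "finite J"
  shows "(\<Sum>j\<in>J. \<Sum>k\<in>J. weighted_form a (u j) (u k)) = (\<Sum>i. a i * (norm (\<Sum>j\<in>J. u j i))\<^sup>2)"
proof -
  have s: "summable (\<lambda>i. a i * Re (u j i * cnj (u k i)))" if "j \<in> J" "k \<in> J" for j k
    by (rule summable_weighted_form[OF a]) (use u that in auto)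
  have "(\<Sum>j\<in>J. \<Sum>k\<in>J. weighted_form a (u j) (u k)) = (\<Sum>j\<in>J. \<Sum>i. \<Sum>k\<in>J. a i * Re (u j i * cnj (u k i)))"
    unfolding weighted_form_def by (intro sum.cong refl suminf_sum[symmetric] s)
  also have "\<dots> = (\<Sum>i. \<Sum>j\<in>J. \<Sum>k\<in>J. a i * Re (u j i * cnj (u k i)))"
    by (intro suminf_sum[symmetric] summable_sum s)
  also have "\<dots> = (\<Sum>i. a i * (norm (\<Sum>j\<in>J. u j i))\<^sup>2)"
  proof (rule suminf_cong)
    fix i
    have "(norm (\<Sum>j\<in>J. u j i))\<^sup>2 = Re ((\<Sum>j\<in>J. u j i) * cnj (\<Sum>j\<in>J. u j i))"
      by (simp add: complex_norm_square[symmetric] del: cnj_sum flip: of_real_power)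
    also have "\<dots> = (\<Sum>j\<in>J. \<Sum>k\<in>J. Re (u j i * cnj (u k i)))"
      by (simp only: cnj_sum sum_product Re_sum)
    finally show "(\<Sum>j\<in>J. \<Sum>k\<in>J. a i * Re (u j i * cnj (u k i))) = a i * (norm (\<Sum>j\<in>J. u j i))\<^sup>2"
      by (simp only: sum_distrib_left)
  qed
  finally show ?thesis .
qed

lemma weighted_form_diag: "weighted_form a u u = (\<Sum>i. a i * (norm (u i))\<^sup>2)"
  unfolding weighted_form_def by (intro suminf_cong) (simp add: complex_norm_square[symmetric] flip: of_real_power)

text \<open>The average of two measures, realized as the mixture governed by a fair coin. It is the
  competitor in the uniqueness proof.\<close>

lemma exists_midpoint_measure:
  assumes M1: "prob_space M1" "sets M1 = sets X" and M2: "prob_space M2" "sets M2 = sets X"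
  obtains M where "prob_space M" "sets M = sets X"
    "\<And>B. B \<in> sets X \<Longrightarrow> emeasure M1 B = 1 \<Longrightarrow> emeasure M2 B = 1 \<Longrightarrow> emeasure M B = 1"
    "\<And>f :: 'a \<Rightarrow> complex. f \<in> borel_measurable X \<Longrightarrow> (\<And>x. x \<in> space X \<Longrightarrow> norm (f x) \<le> 1) \<Longrightarrow>
      (\<integral>x. f x \<partial>M) = ((\<integral>x. f x \<partial>M1) + (\<integral>x. f x \<partial>M2)) / 2"
proof -
  interpret M1: prob_space M1 by fact
  interpret M2: prob_space M2 by fact
  define N where "N b = (if b then M1 else M2)" for b
  define M where "M = measure_pmf (bernoulli_pmf (1/2)) \<bind> N"
  have N: "N \<in> measurable (measure_pmf (bernoulli_pmf (1/2))) (subprob_algebra X)"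
    unfolding measurable_pmf_measure1
    by (auto simp: N_def space_subprob_algebra M1 M2 M1.subprob_space_axioms M2.subprob_space_axioms)
  have sN: "sets (N b) = sets X" for b by (simp add: N_def M1 M2)
  have pN: "prob_space (N b)" for b by (simp add: N_def M1 M2)
  have sM: "sets M = sets X" unfolding M_def by (rule sets_bind) (auto simp: sN)
  have pM: "prob_space M" unfolding M_def by (rule measure_pmf.prob_space_bind[OF _ N]) (simp add: pN)
  have avg: "(\<integral>b. h b \<partial>measure_pmf (bernoulli_pmf (1/2))) = (h True + h False) / 2" for h :: "bool \<Rightarrow> real"
    by (subst integral_measure_pmf[of UNIV]) (auto simp: UNIV_bool field_simps)
  have real: "(\<integral>x. f x \<partial>M) = ((\<integral>x. f x \<partial>M1) + (\<integral>x. f x \<partial>M2)) / 2"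
    if "f \<in> borel_measurable X" "\<And>x. x \<in> space X \<Longrightarrow> \<bar>f x\<bar> \<le> 1" for f :: "'a \<Rightarrow> real"
  proof -
    have "(\<integral>x. f x \<partial>M) = (\<integral>b. (\<integral>x. f x \<partial>N b) \<partial>measure_pmf (bernoulli_pmf (1/2)))"
      unfolding M_def
      by (rule integral_bind[OF that N measure_pmf.finite_measure, of 1])
        (simp, rule AE_I2, simp add: prob_space.emeasure_space_1[OF pN])
    then show ?thesis by (simp add: avg) (simp add: N_def)
  qed
  show thesis
  proof (rule that[OF pM sM])
    fix B assume "B \<in> sets X" "emeasure M1 B = 1" "emeasure M2 B = 1"
    then show "emeasure M B = 1" unfolding M_def
      by (subst emeasure_bind[OF _ N], simp, simp, subst nn_integral_cong[of _ _ "\<lambda>_. 1"])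
        (auto simp: N_def measure_pmf.emeasure_space_1[simplified])
  next
    fix f :: "'a \<Rightarrow> complex" assume f[measurable]: "f \<in> borel_measurable X" and f1: "\<And>x. x \<in> space X \<Longrightarrow> norm (f x) \<le> 1"
    have sp: "space M = space X" "space M1 = space X" "space M2 = space X"
      using sM M1(2) M2(2) by (auto dest: sets_eq_imp_space_eq)
    interpret M: prob_space M by (rule pM)
    have [measurable]: "f \<in> borel_measurable M" "f \<in> borel_measurable M1" "f \<in> borel_measurable M2"
      using f measurable_cong_sets[OF sM refl] measurable_cong_sets[OF M1(2) refl] measurable_cong_sets[OF M2(2) refl] by blast+
    have i: "integrable M f" "integrable M1 f" "integrable M2 f"
      by (rule M.integrable_const_bound[of _ 1] M1.integrable_const_bound[of _ 1] M2.integrable_const_bound[of _ 1],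
          rule AE_I2, rule f1, simp add: sp, measurable)+
    have "\<bar>Re (f x)\<bar> \<le> 1" "\<bar>Im (f x)\<bar> \<le> 1" if "x \<in> space X" for x
      using abs_Re_le_cmod[of "f x"] abs_Im_le_cmod[of "f x"] f1[OF that] by linarith+
    then have "(\<integral>x. Re (f x) \<partial>M) = ((\<integral>x. Re (f x) \<partial>M1) + (\<integral>x. Re (f x) \<partial>M2)) / 2"
      "(\<integral>x. Im (f x) \<partial>M) = ((\<integral>x. Im (f x) \<partial>M1) + (\<integral>x. Im (f x) \<partial>M2)) / 2"
      by - (rule real; simp)+
    then show "(\<integral>x. f x \<partial>M) = ((\<integral>x. f x \<partial>M1) + (\<integral>x. f x \<partial>M2)) / 2"
      using i by (auto simp: complex_eq_iff)
  qed
qed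

text \<open>What the energy argument needs to know about the torus. Convergence of Fourier
  coefficients is a sufficient notion of limit, because truncated energies depend on nothing else.
  Positivity in \<open>c_pos\<close> is asked for at some stage only, and index 0, the constant
  function, is exempt. The assumption \<open>kernel_mono\<close> does not follow from
  \<open>c_mono\<close>, since the terms of a kernel may have either sign.\<close>

locale fourier_kernel =
  fixes X :: "'a measure" and A :: "'a set" and PM :: "'a measure set"
    and E :: "nat \<Rightarrow> 'a \<Rightarrow> complex" and c :: "nat \<Rightarrow> nat \<Rightarrow> real" and K :: "'a \<Rightarrow> 'a \<Rightarrow> ereal"
  assumes A_sets: "A \<in> sets X" and A_ne: "A \<noteq> {}"
    and PM_eq: "PM = {M. sets M = sets X \<and> prob_space M \<and> emeasure M A = 1}"
    and E_measurable: "\<And>i. E i \<in> borel_measurable X" and E_le_1: "\<And>i x. x \<in> space X \<Longrightarrow> norm (E i x) \<le> 1"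
    and E_0: "\<And>x. x \<in> space X \<Longrightarrow> E 0 x = 1"
    and c_summable: "\<And>n. summable (\<lambda>i. \<bar>c n i\<bar>)" and c_mono: "\<And>n i. c n i \<le> c (Suc n) i"
    and c_pos: "\<And>i. i \<noteq> 0 \<Longrightarrow> \<exists>n. 0 < c n i"
    and kernel_mono: "\<And>n x y. x \<in> space X \<Longrightarrow> y \<in> space X \<Longrightarrow>
      weighted_form (c n) (\<lambda>i. E i x) (\<lambda>i. E i y) \<le> weighted_form (c (Suc n)) (\<lambda>i. E i x) (\<lambda>i. E i y)"
    and kernel_eq: "\<And>x y. x \<in> space X \<Longrightarrow> y \<in> space X \<Longrightarrow>
      K x y = (SUP n. ereal (weighted_form (c n) (\<lambda>i. E i x) (\<lambda>i. E i y)))"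
    and PM_compact: "\<And>\<omega> s. (\<And>n j. \<omega> n j \<in> A) \<Longrightarrow> (\<And>n. 0 < s n) \<Longrightarrow>
      \<exists>r M. strict_mono (r :: nat \<Rightarrow> nat) \<and> M \<in> PM \<and>
        (\<forall>i. (\<lambda>n. (\<Sum>j<s (r n). E i (\<omega> (r n) j)) / of_nat (s (r n))) \<longlonglongrightarrow> fourier_coeff E M i)"
    and PM_unique: "\<And>M M'. M \<in> PM \<Longrightarrow> M' \<in> PM \<Longrightarrow> fourier_coeff E M = fourier_coeff E M' \<Longrightarrow> M = M'"
begin

abbreviation "truncated n x y \<equiv> weighted_form (c n) (\<lambda>i. E i x) (\<lambda>i. E i y)"

definition truncated_energy :: "nat \<Rightarrow> 'a measure \<Rightarrow> real" where
  "truncated_energy n M = weighted_form (c n) (fourier_coeff E M) (fourier_coeff E M)"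

text \<open>As a supremum of functions continuous in the Fourier coefficients, this is lower
  semicontinuous by construction. The lemma \<open>energy_eq\<close> identifies it with the double
  integral.\<close>

definition energy :: "'a measure \<Rightarrow> ereal" where
  "energy M = (SUP n. ereal (truncated_energy n M))"

definition min_energy :: "nat \<Rightarrow> ereal" where
  "min_energy N = (INF \<omega>\<in>{..<N} \<rightarrow>\<^sub>E A. \<Sum>(j, k)\<in>pairs N. K (\<omega> j) (\<omega> k))"

definition c_sum :: "nat \<Rightarrow> real" where "c_sum n = (\<Sum>i. \<bar>c n i\<bar>)"

lemma c_sum_nonneg: "0 \<le> c_sum n" unfolding c_sum_def by (rule suminf_nonneg[OF c_summable]) simp

lemma PM_D:
  assumes "M \<in> PM"
  shows "prob_space M" "sets M = sets X" "space M = space X" "emeasure M A = 1" "A \<in> sets M"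
  using assms A_sets by (auto simp: PM_eq dest: sets_eq_imp_space_eq)

lemma A_subset: "A \<subseteq> space X" using A_sets sets.sets_into_space by blast

lemma E_measurable_PM: "M \<in> PM \<Longrightarrow> E i \<in> borel_measurable M"
  using E_measurable[of i] PM_D(2) measurable_cong_sets by blast

lemma truncated_le: "x \<in> space X \<Longrightarrow> y \<in> space X \<Longrightarrow> \<bar>truncated n x y\<bar> \<le> c_sum n"
  unfolding c_sum_def by (rule abs_weighted_form_le[OF c_summable]) (auto simp: E_le_1)

lemma truncated_incseq: "x \<in> space X \<Longrightarrow> y \<in> space X \<Longrightarrow> incseq (\<lambda>n. truncated n x y)"
  by (rule incseq_SucI) (rule kernel_mono)

lemma truncated_le_kernel: "x \<in> space X \<Longrightarrow> y \<in> space X \<Longrightarrow> ereal (truncated n x y) \<le> K x y"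
  unfolding kernel_eq by (rule SUP_upper) simp

lemma kernel_lower: "x \<in> space X \<Longrightarrow> y \<in> space X \<Longrightarrow> ereal (- c_sum 0) \<le> K x y"
  by (rule order_trans[OF _ truncated_le_kernel[of x y 0]]) (use truncated_le[of x y 0] in auto)

lemma kernel_sym: "x \<in> space X \<Longrightarrow> y \<in> space X \<Longrightarrow> K x y = K y x"
  by (simp add: kernel_eq weighted_form_commute)

context
  fixes M assumes M: "M \<in> PM"
begin

interpretation prob_space M by (rule PM_D(1)[OF M])

lemma coeff_le_1: "norm (fourier_coeff E M i) \<le> 1"
  by (rule integral_weighted_form(2)[OF PM_D(1)[OF M] c_summable _ E_measurable_PM[OF M], of "\<lambda>_. 1"])
    (simp_all add: PM_D(3)[OF M] E_le_1)

lemma potential_eq: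
  assumes "S \<in> sets M" "emeasure M S = 1" "y \<in> space X"
  shows "ereal_set_integral M S (\<lambda>x. K x y) = (SUP n. ereal (weighted_form (c n) (fourier_coeff E M) (\<lambda>i. E i y)))"
proof -
  note W = integral_weighted_form[OF PM_D(1)[OF M] c_summable _ E_measurable_PM[OF M]]
  have "ereal_set_integral M S (\<lambda>x. K x y) = ereal_set_integral M S (\<lambda>x. SUP n. ereal (truncated n x y))"
    using sets.sets_into_space[OF assms(1)] assms(3) PM_D(3)[OF M]
    by (intro ereal_set_integral_cong kernel_eq) auto
  also have "\<dots> = (SUP n. ereal (\<integral>x. truncated n x y \<partial>M))"
    using assms PM_D(3)[OF M]
    by (intro ereal_set_integral_SUP[OF prob_space_axioms, of _ _ c_sum] W(3) truncated_le truncated_incseq)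
      (auto simp: E_le_1)
  also have "\<dots> = (SUP n. ereal (weighted_form (c n) (fourier_coeff E M) (\<lambda>i. E i y)))"
    by (subst W(1)) (use PM_D(3)[OF M] assms(3) in \<open>auto simp: E_le_1\<close>)
  finally show ?thesis .
qed

text \<open>Increasing weights do not suffice, as the factors may be negative. The pointwise
  inequality between consecutive truncated kernels is integrated instead.\<close>

lemma potential_mono:
  assumes "y \<in> space X"
  shows "incseq (\<lambda>n. weighted_form (c n) (fourier_coeff E M) (\<lambda>i. E i y))"
proof (rule incseq_SucI)
  fix n
  note W = integral_weighted_form[OF PM_D(1)[OF M] c_summable _ E_measurable_PM[OF M]]
  have i: "integrable M (\<lambda>x. truncated n x y)" for n
    by (rule integrable_const_bound[of _ "c_sum n"])
      (use PM_D(3)[OF M] assms in \<open>auto intro!: AE_I2 W(3) truncated_le simp: E_le_1\<close>)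
  have "(\<integral>x. truncated n x y \<partial>M) \<le> (\<integral>x. truncated (Suc n) x y \<partial>M)"
    using assms PM_D(3)[OF M] by (intro integral_mono i kernel_mono) auto
  then show "weighted_form (c n) (fourier_coeff E M) (\<lambda>i. E i y) \<le> weighted_form (c (Suc n)) (fourier_coeff E M) (\<lambda>i. E i y)"
    by (subst (asm) (1 2) W(1)) (use PM_D(3)[OF M] assms in \<open>auto simp: E_le_1\<close>)
qed

lemma potential_measurable: "(\<lambda>y. weighted_form (c n) (fourier_coeff E M) (\<lambda>i. E i y)) \<in> borel_measurable M"
  unfolding weighted_form_commute[of _ "fourier_coeff E M"]
  by (rule integral_weighted_form(3)[OF PM_D(1)[OF M] c_summable coeff_le_1 E_measurable_PM[OF M]])
    (simp add: PM_D(3)[OF M] E_le_1)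

lemma potential_integral: "(\<integral>y. weighted_form (c n) (fourier_coeff E M) (\<lambda>i. E i y) \<partial>M) = truncated_energy n M"
  unfolding weighted_form_commute[of _ "fourier_coeff E M"] unfolding truncated_energy_def
  by (rule integral_weighted_form(1)[OF PM_D(1)[OF M] c_summable coeff_le_1 E_measurable_PM[OF M]])
    (simp add: PM_D(3)[OF M] E_le_1)

lemma potential_le: "y \<in> space X \<Longrightarrow> \<bar>weighted_form (c n) (fourier_coeff E M) (\<lambda>i. E i y)\<bar> \<le> c_sum n"
  unfolding c_sum_def by (rule abs_weighted_form_le[OF c_summable coeff_le_1]) (auto simp: E_le_1)

lemma truncated_energy_incseq: "incseq (\<lambda>n. truncated_energy n M)"
proof (rule incseq_SucI)
  fix n
  have i: "integrable M (\<lambda>y. weighted_form (c n) (fourier_coeff E M) (\<lambda>i. E i y))" for n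
    by (rule integrable_const_bound[of _ "c_sum n"])
      (use PM_D(3)[OF M] in \<open>auto intro!: AE_I2 potential_measurable potential_le\<close>)
  show "truncated_energy n M \<le> truncated_energy (Suc n) M"
    unfolding potential_integral[symmetric]
    by (rule integral_mono[OF i i]) (use potential_mono PM_D(3)[OF M] in \<open>auto simp: incseq_Suc_iff\<close>)
qed

text \<open>Monotone convergence, once for the potential and once for its mean. The set
  \<open>S\<close> of full measure is left open because the infimum is formed with integrals over
  the cell and the limit is expressed with integrals over \<open>A\<close>.\<close>

lemma energy_eq:
  assumes "S \<in> sets M" "emeasure M S = 1"
  shows "ereal_set_integral M S (\<lambda>y. ereal_set_integral M S (\<lambda>x. K x y)) = energy M"
proof -
  have "ereal_set_integral M S (\<lambda>y. ereal_set_integral M S (\<lambda>x. K x y)) =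
    ereal_set_integral M S (\<lambda>y. SUP n. ereal (weighted_form (c n) (fourier_coeff E M) (\<lambda>i. E i y)))"
    using sets.sets_into_space[OF assms(1)] PM_D(3)[OF M]
    by (intro ereal_set_integral_cong potential_eq assms) auto
  also have "\<dots> = (SUP n. ereal (\<integral>y. weighted_form (c n) (fourier_coeff E M) (\<lambda>i. E i y) \<partial>M))"
    using PM_D(3)[OF M]
    by (intro ereal_set_integral_SUP[OF prob_space_axioms assms, of _ c_sum] potential_measurable potential_le potential_mono) auto
  finally show ?thesis by (simp add: potential_integral energy_def)
qed

end

end

lemma sum_pairs_const: "(\<Sum>(j, k)\<in>pairs N. C) = real N * (real N - 1) * C"
proof (induction N)
  case (Suc N)
  then show ?case using sum_pairs_Suc[of "\<lambda>_ _. C" N] by (simp add: algebra_simps)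
qed simp

lemma sum_square_eq_pairs_diag:
  fixes f :: "nat \<Rightarrow> nat \<Rightarrow> real"
  shows "(\<Sum>j<N. \<Sum>k<N. f j k) = (\<Sum>(j, k)\<in>pairs N. f j k) + (\<Sum>j<N. f j j)"
proof (induction N)
  case (Suc N)
  then show ?case using sum_pairs_Suc[of f N] by (simp add: sum.distrib)
qed simp

lemma not_eventually_imp_infinite: "\<not> eventually P sequentially \<Longrightarrow> infinite {N. \<not> P N}"
  by (simp add: cofinite_eq_sequentially[symmetric] eventually_cofinite)

lemma summable_weighted_form_diag:
  fixes u :: "nat \<Rightarrow> complex"
  assumes "summable (\<lambda>i. \<bar>a i\<bar>)" "\<And>i. norm (u i) \<le> 1"
  shows "summable (\<lambda>i. a i * (norm (u i))\<^sup>2)"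
  using summable_weighted_form[OF assms assms(2), of "\<lambda>i. i" "\<lambda>i. i"]
  unfolding cmod_power2 by (simp add: power2_eq_square)

text \<open>Tannery's theorem with the absolute weights as dominating sequence.\<close>

lemma weighted_form_tendsto:
  assumes a: "summable (\<lambda>i. \<bar>a i\<bar>)" and u: "\<And>n i. norm (u n i) \<le> 1" and lim: "\<And>i. (\<lambda>n. u n i) \<longlonglongrightarrow> v i"
  shows "(\<lambda>n. weighted_form a (u n) (u n)) \<longlonglongrightarrow> weighted_form a v v"
proof -
  have bd: "norm (a i * Re (u n i * cnj (u n i))) \<le> \<bar>a i\<bar>" for i n
    using weighted_form_term_bound[of "u n" "u n" a i] u by simp
  have 1: "(\<lambda>n. a i * Re (u n i * cnj (u n i))) \<longlonglongrightarrow> a i * Re (v i * cnj (v i))" for i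
    by (intro tendsto_intros lim)
  have 2: "\<forall>\<^sub>F (i, n) in at_top \<times>\<^sub>F sequentially. norm (a i * Re (u n i * cnj (u n i))) \<le> \<bar>a i\<bar>"
    by (rule always_eventually) (simp only: split_paired_all prod.case bd split_beta, simp)
  show ?thesis unfolding weighted_form_def using tannerys_theorem[OF 1 2 a] by simp
qed

section \<open>Discrete minimal energies and their limit in the abstract setting\<close>

context fourier_kernel
begin

lemma energy_lower: "M \<in> PM \<Longrightarrow> ereal (- c_sum 0) \<le> energy M"
proof -
  assume M: "M \<in> PM"
  have "\<bar>truncated_energy 0 M\<bar> \<le> c_sum 0" unfolding truncated_energy_def c_sum_def
    by (rule abs_weighted_form_le[OF c_summable coeff_le_1[OF M] coeff_le_1[OF M]])
  then show ?thesis unfolding energy_def by (intro SUP_upper2[of 0]) auto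
qed

lemma min_energy_le:
  assumes M: "M \<in> PM" and l: "energy M = ereal l"
  shows "min_energy N \<le> ereal (real N * (real N - 1) * l)"
proof -
  \<comment> \<open>The kernel is bounded below by \<open>- C\<close>. Shifting by \<open>C\<close>
    makes it nonnegative, as averaging requires, and adds \<open>N * (N - 1) * C\<close> to both
    sides of the final inequality.\<close>
  define C where "C = c_sum 0"
  have C: "0 \<le> C" unfolding C_def by (rule c_sum_nonneg)
  define \<kappa> where "\<kappa> x y = e2ennreal (K x y + ereal C)" for x y
  define J where "J y = (SUP n. ereal (weighted_form (c n) (fourier_coeff E M) (\<lambda>i. E i y)))" for y
  note MD = PM_D[OF M]
  have KC: "0 \<le> K x y + ereal C" if "x \<in> space X" "y \<in> space X" for x y
    using kernel_lower[OF that] by (cases "K x y") (auto simp: C_def)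
  have Km[measurable]: "(\<lambda>x. K x y) \<in> borel_measurable M" if y: "y \<in> space X" for y
  proof -
    have [measurable]: "(\<lambda>x. truncated n x y) \<in> borel_measurable M" for n
      by (rule integral_weighted_form(3)[OF MD(1) c_summable _ E_measurable_PM[OF M]])
        (use MD(3) y in \<open>auto simp: E_le_1\<close>)
    have "(\<lambda>x. SUP n. ereal (truncated n x y)) \<in> borel_measurable M" by measurable
    then show ?thesis by (subst measurable_cong[of M _ "\<lambda>x. SUP n. ereal (truncated n x y)"]) (use kernel_eq y MD(3) in auto)
  qed
  have U: "J y = enn2ereal (\<integral>\<^sup>+x. \<kappa> x y \<partial>M) - ereal C" if "y \<in> space X" for y
    unfolding J_def \<kappa>_def potential_eq[OF M MD(5,4) that, symmetric]
    by (rule ereal_set_integral_bounded_below[OF MD(1,5,4) Km[OF that] C]) (use MD(3) kernel_lower that C_def in auto)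
  then have U': "(\<integral>\<^sup>+x. \<kappa> x y \<partial>M) = e2ennreal (J y + ereal C)" "ereal (- C) \<le> J y" if "y \<in> space X" for y
    using that by (cases "\<integral>\<^sup>+x. \<kappa> x y \<partial>M"; simp)+
  have [measurable]: "(\<lambda>y. weighted_form (c n) (fourier_coeff E M) (\<lambda>i. E i y)) \<in> borel_measurable M" for n
    by (rule potential_measurable[OF M])
  have Jm[measurable]: "J \<in> borel_measurable M" unfolding J_def by measurable
  have Um: "(\<lambda>y. \<integral>\<^sup>+x. \<kappa> x y \<partial>M) \<in> borel_measurable M"
    by (subst measurable_cong[of M _ "\<lambda>y. e2ennreal (J y + ereal C)"]) (use U' MD(3) in auto)
  define \<Lambda> where "\<Lambda> = (\<integral>\<^sup>+y. \<integral>\<^sup>+x. \<kappa> x y \<partial>M \<partial>M)"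
  have "energy M = ereal_set_integral M A J"
    unfolding energy_eq[OF M MD(5,4), symmetric] J_def using A_subset
    by (intro ereal_set_integral_cong potential_eq[OF M MD(5,4)]) auto
  also have "\<dots> = enn2ereal (\<integral>\<^sup>+y. e2ennreal (J y + ereal C) \<partial>M) - ereal C"
    by (rule ereal_set_integral_bounded_below[OF MD(1,5,4) Jm C]) (use U' MD(3) in auto)
  also have "(\<integral>\<^sup>+y. e2ennreal (J y + ereal C) \<partial>M) = \<Lambda>"
    unfolding \<Lambda>_def by (intro nn_integral_cong) (use U' MD(3) in auto)
  finally have "enn2ereal \<Lambda> - ereal C = ereal l" using l by simp
  then have \<Lambda>: "\<Lambda> = ennreal (l + C)" "0 \<le> l + C" by (cases \<Lambda>; auto)+
  \<comment> \<open>With \<open>p = 0\<close> no random point is left, so the two additional terms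
    vanish.\<close>
  have "\<exists>\<omega>. (\<forall>j<N. \<omega> j \<in> A) \<and>
    (\<Sum>(j, k)\<in>pairs N. \<kappa> (\<omega> j) (\<omega> k)) + of_nat (2 * 0) * (\<Sum>j<N. \<integral>\<^sup>+x. \<kappa> x (\<omega> j) \<partial>M)
      + of_nat (0 * (0 - 1)) * (\<integral>\<^sup>+y. \<integral>\<^sup>+x. \<kappa> x y \<partial>M \<partial>M)
    \<le> of_nat ((0 + N) * (0 + N - 1)) * (\<integral>\<^sup>+y. \<integral>\<^sup>+x. \<kappa> x y \<partial>M \<partial>M)"
    by (rule configuration_below_average[OF MD(1,5,4) _ _ Um]) (use A_subset Km in \<open>auto simp: \<kappa>_def kernel_sym subsetD\<close>)
  then obtain \<omega> where \<omega>: "\<And>j. j < N \<Longrightarrow> \<omega> j \<in> A"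
    and le: "(\<Sum>(j, k)\<in>pairs N. \<kappa> (\<omega> j) (\<omega> k)) \<le> of_nat (N * (N - 1)) * \<Lambda>"
    unfolding \<Lambda>_def by auto
  note le
  also have "of_nat (N * (N - 1)) * \<Lambda> = ennreal (real (N * (N - 1)) * (l + C))"
    unfolding \<Lambda>(1) ennreal_of_nat_eq_real_of_nat using \<Lambda>(2) by (intro ennreal_mult[symmetric]) auto
  also have "real (N * (N - 1)) = real N * (real N - 1)" by (cases N) (auto simp: algebra_simps)
  finally have "enn2ereal (\<Sum>(j, k)\<in>pairs N. \<kappa> (\<omega> j) (\<omega> k)) \<le>
      enn2ereal (ennreal (real N * (real N - 1) * (l + C)))" by (simp add: less_eq_ennreal.rep_eq)
  also have "\<dots> = ereal (real N * (real N - 1) * (l + C))" using \<Lambda>(2) by (cases N) (auto simp: zero_ennreal.rep_eq zero_ereal_def[symmetric])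
  also have "enn2ereal (\<Sum>(j, k)\<in>pairs N. \<kappa> (\<omega> j) (\<omega> k)) =
      (\<Sum>(j, k)\<in>pairs N. K (\<omega> j) (\<omega> k) + ereal C)"
  proof -
    have "enn2ereal (\<kappa> (\<omega> j) (\<omega> k)) = K (\<omega> j) (\<omega> k) + ereal C" if "j < N" "k < N" for j k
      unfolding \<kappa>_def by (rule enn2ereal_e2ennreal) (use KC \<omega> that A_subset in blast)
    then have "(\<Sum>(j, k)\<in>pairs N. K (\<omega> j) (\<omega> k) + ereal C) =
      (\<Sum>p\<in>pairs N. enn2ereal (case p of (j, k) \<Rightarrow> \<kappa> (\<omega> j) (\<omega> k)))"
      by (intro sum.cong) auto
    then show ?thesis by simp
  qed
  also have "\<dots> = (\<Sum>(j, k)\<in>pairs N. K (\<omega> j) (\<omega> k)) + ereal (real N * (real N - 1) * C)"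
    unfolding sum_pairs_const[symmetric] by (simp add: sum.distrib case_prod_unfold)
  finally have "(\<Sum>(j, k)\<in>pairs N. K (\<omega> j) (\<omega> k)) \<le> ereal (real N * (real N - 1) * l)"
    by (cases "\<Sum>(j, k)\<in>pairs N. K (\<omega> j) (\<omega> k)") (auto simp: algebra_simps)
  also have "(\<Sum>(j, k)\<in>pairs N. K (\<omega> j) (\<omega> k)) =
    (\<Sum>(j, k)\<in>pairs N. K (restrict \<omega> {..<N} j) (restrict \<omega> {..<N} k))"
    by (intro sum.cong) auto
  finally show ?thesis unfolding min_energy_def
    by (intro INF_lower2[of "restrict \<omega> {..<N}"]) (use \<omega> in auto)
qed

text \<open>The measure is a weak limit of empirical measures of almost minimal configurations. The
  bound may vary with \<open>N\<close>: a constant sequence yields the lower estimate of the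
  discrete energies, and the sequence (1 - 1 / N) * l yields a minimizer.\<close>

lemma exists_energy_le:
  assumes inf: "infinite {N. min_energy N / ereal ((real N)\<^sup>2) \<le> ereal (b N)}" and b: "b \<longlonglongrightarrow> l"
  shows "\<exists>M\<in>PM. energy M \<le> ereal l"
proof -
  \<comment> \<open>Without 0 the division by \<open>N\<^sup>2\<close> can be undone.\<close>
  define S where "S = {N. min_energy N / ereal ((real N)\<^sup>2) \<le> ereal (b N)} - {0}"
  have "infinite S" unfolding S_def using inf by simp
  then obtain s :: "nat \<Rightarrow> nat" where s: "strict_mono s" "\<And>n. s n \<in> S" using infinite_enumerate by blast
  have s0: "0 < s n" for n using s(2)[of n] by (auto simp: S_def)
  obtain a where a: "a \<in> A" using A_ne by blast
  \<comment> \<open>The infimum need not be attained. The slack 1 turns into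
    \<open>1 / N\<^sup>2\<close> and disappears in the limit.\<close>
  have "\<exists>\<omega>\<in>{..<N} \<rightarrow>\<^sub>E A. (\<Sum>(j, k)\<in>pairs N. K (\<omega> j) (\<omega> k)) < ereal (b N * (real N)\<^sup>2 + 1)"
    if "N \<in> S" for N
  proof -
    have "min_energy N \<le> ereal (b N * (real N)\<^sup>2)"
      using that by (cases "min_energy N") (auto simp: S_def field_simps)
    then have "min_energy N < ereal (b N * (real N)\<^sup>2 + 1)" by (rule le_less_trans) simp
    then show ?thesis unfolding min_energy_def INF_less_iff .
  qed
  then have "\<exists>\<omega>. \<forall>n. \<omega> n \<in> {..<s n} \<rightarrow>\<^sub>E A \<and>
    (\<Sum>(j, k)\<in>pairs (s n). K (\<omega> n j) (\<omega> n k)) < ereal (b (s n) * (real (s n))\<^sup>2 + 1)"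
    using s(2) by (intro choice) blast
  then obtain \<omega> where \<omega>: "\<And>n. \<omega> n \<in> {..<s n} \<rightarrow>\<^sub>E A"
    and lt: "\<And>n. (\<Sum>(j, k)\<in>pairs (s n). K (\<omega> n j) (\<omega> n k)) < ereal (b (s n) * (real (s n))\<^sup>2 + 1)"
    by blast
  \<comment> \<open>Indices beyond the configuration are filled with a point of \<open>A\<close>,
    because \<open>PM_compact\<close> speaks of all indices.\<close>
  define x where "x n j = (if j < s n then \<omega> n j else a)" for n j
  have xA: "x n j \<in> A" for n j using \<omega>[of n] a by (auto simp: x_def PiE_iff)
  have xX: "x n j \<in> space X" for n j using xA A_subset by blast
  obtain r M where r: "strict_mono (r :: nat \<Rightarrow> nat)" and M: "M \<in> PM"
    and lim: "\<And>i. (\<lambda>n. (\<Sum>j<s (r n). E i (x (r n) j)) / of_nat (s (r n))) \<longlonglongrightarrow> fourier_coeff E M i"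
    using PM_compact[of x s, OF xA s0] by blast
  define m where "m n i = (\<Sum>j<s n. E i (x n j)) / of_nat (s n)" for n i
  have m1: "norm (m n i) \<le> 1" for n i
  proof -
    have "norm (\<Sum>j<s n. E i (x n j)) \<le> (\<Sum>j<s n. 1)" by (rule sum_norm_le) (simp add: E_le_1 xX)
    then show ?thesis using s0[of n] by (simp add: m_def norm_divide)
  qed
  \<comment> \<open>The quadratic form includes the diagonal, which the discrete energy does not.
    Each of the \<open>s n\<close> diagonal values of the truncated kernel is at most
    \<open>c_sum q\<close>; this accounts for the last term.\<close>
  have le: "weighted_form (c q) (m n) (m n) \<le> b (s n) + 1 / (real (s n))\<^sup>2 + c_sum q / real (s n)" for q n
  proof -
    have "ereal (\<Sum>(j, k)\<in>pairs (s n). truncated q (x n j) (x n k)) =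
      (\<Sum>(j, k)\<in>pairs (s n). ereal (truncated q (x n j) (x n k)))"
      by (simp add: case_prod_unfold)
    also have "\<dots> \<le> (\<Sum>(j, k)\<in>pairs (s n). K (\<omega> n j) (\<omega> n k))"
    proof (intro sum_mono, clarify)
      fix j k assume "j < s n" "k < s n"
      then show "ereal (truncated q (x n j) (x n k)) \<le> K (\<omega> n j) (\<omega> n k)"
        using truncated_le_kernel[OF xX[of n j] xX[of n k], of q] by (simp add: x_def)
    qed
    also have "\<dots> < ereal (b (s n) * (real (s n))\<^sup>2 + 1)" by (rule lt)
    finally have 1: "(\<Sum>(j, k)\<in>pairs (s n). truncated q (x n j) (x n k)) < b (s n) * (real (s n))\<^sup>2 + 1"
      by simp
    have "(\<Sum>j<s n. truncated q (x n j) (x n j)) \<le> (\<Sum>j<s n. c_sum q)"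
      using truncated_le[OF xX xX] by (intro sum_mono) (auto simp: abs_le_iff)
    then have 2: "(\<Sum>j<s n. truncated q (x n j) (x n j)) \<le> real (s n) * c_sum q" by simp
    have "(real (s n))\<^sup>2 * weighted_form (c q) (m n) (m n) = (\<Sum>i. (real (s n))\<^sup>2 * (c q i * (norm (m n i))\<^sup>2))"
      unfolding weighted_form_diag
      by (rule suminf_mult[symmetric]) (rule summable_weighted_form_diag[OF c_summable m1])
    also have "\<dots> = (\<Sum>i. c q i * (norm (\<Sum>j<s n. E i (x n j)))\<^sup>2)"
      using s0[of n] by (intro suminf_cong) (simp add: m_def norm_divide power_divide)
    also have "\<dots> = (\<Sum>j<s n. \<Sum>k<s n. truncated q (x n j) (x n k))"
      by (rule weighted_form_sum[OF c_summable, symmetric]) (auto simp: E_le_1 xX)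
    also have "\<dots> \<le> (b (s n) * (real (s n))\<^sup>2 + 1) + real (s n) * c_sum q"
      unfolding sum_square_eq_pairs_diag using 1 2 by linarith
    finally have "(real (s n))\<^sup>2 * weighted_form (c q) (m n) (m n) \<le> (b (s n) * (real (s n))\<^sup>2 + 1) + real (s n) * c_sum q" .
    then have "weighted_form (c q) (m n) (m n) \<le> ((b (s n) * (real (s n))\<^sup>2 + 1) + real (s n) * c_sum q) / (real (s n))\<^sup>2"
      using s0[of n] by (simp add: pos_le_divide_eq mult.commute)
    also have "\<dots> = b (s n) + 1 / (real (s n))\<^sup>2 + c_sum q / real (s n)"
      using s0[of n] by (simp add: add_divide_distrib power2_eq_square)
    finally show ?thesis .
  qed
  have sr: "strict_mono (s \<circ> r)" using s(1) r by (rule strict_mono_o)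
  \<comment> \<open>The level \<open>q\<close> stays fixed while \<open>n\<close> tends to infinity,
    so that \<open>c_sum q / real (s n)\<close> vanishes. The supremum over \<open>q\<close> is
    taken afterwards.\<close>
  have "truncated_energy q M \<le> l" for q
  proof (rule LIMSEQ_le)
    show "(\<lambda>n. weighted_form (c q) (m (r n)) (m (r n))) \<longlonglongrightarrow> truncated_energy q M"
      unfolding truncated_energy_def using lim by (intro weighted_form_tendsto[OF c_summable] m1) (simp add: m_def)
    have inv: "(\<lambda>N. 1 / (real N)\<^sup>2) \<longlonglongrightarrow> 0" "(\<lambda>N. c_sum q / real N) \<longlonglongrightarrow> 0"
      using tendsto_power[OF lim_1_over_n, of 2] lim_const_over_n[of "c_sum q"] by (simp_all add: power_divide)
    have "(\<lambda>N. b N + 1 / (real N)\<^sup>2 + c_sum q / real N) \<longlonglongrightarrow> l + 0 + 0"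
      by (intro tendsto_add b inv)
    from LIMSEQ_subseq_LIMSEQ[OF this sr]
    show "(\<lambda>n. b (s (r n)) + 1 / (real (s (r n)))\<^sup>2 + c_sum q / real (s (r n))) \<longlonglongrightarrow> l" by (simp add: o_def)
  qed (use le in auto)
  then have "energy M \<le> ereal l" unfolding energy_def by (intro SUP_least) simp
  then show ?thesis using M by blast
qed

text \<open>Two minimizers differ at some frequency. Although weights may be negative at every
  single stage, the weighted sum of the squared differences eventually stays above a positive
  constant, and the midpoint then has strictly smaller energy than the minimum.\<close>

lemma energy_minimizer_unique:
  assumes M: "M1 \<in> PM" "M2 \<in> PM" and l: "energy M1 = ereal l" "energy M2 = ereal l" "\<And>M. M \<in> PM \<Longrightarrow> ereal l \<le> energy M"
  shows "M1 = M2"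
proof (rule ccontr)
  assume "M1 \<noteq> M2"
  define d where "d i = fourier_coeff E M1 i - fourier_coeff E M2 i" for i
  obtain i where i: "d i \<noteq> 0" using PM_unique[OF M] \<open>M1 \<noteq> M2\<close> by (auto simp: d_def fun_eq_iff)
  have E0: "fourier_coeff E M 0 = 1" if "M \<in> PM" for M
  proof -
    interpret prob_space M using PM_D(1)[OF that] .
    have "fourier_coeff E M 0 = (\<integral>x. 1 \<partial>M)"
      unfolding fourier_coeff_def by (rule Bochner_Integration.integral_cong) (use PM_D(3)[OF that] E_0 in auto)
    then show ?thesis by (simp add: prob_space)
  qed
  \<comment> \<open>Probability measures agree at index 0, so the differing index \<open>i\<close>
    is one whose weight becomes positive.\<close>
  have d0: "d 0 = 0" by (simp add: d_def E0 M)
  then obtain p where p: "0 < c p i" using c_pos[of i] i by metis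
  have cm: "c n j \<le> c n' j" if "n \<le> n'" for n n' j
    by (rule lift_Suc_mono_le[of "\<lambda>n. c n j", OF c_mono that])
  define h where "h j = (norm (d j))\<^sup>2" for j
  have h4: "h j \<le> 4" for j
  proof -
    have "norm (d j) \<le> 2" unfolding d_def
      using norm_triangle_ineq4[of "fourier_coeff E M1 j" "fourier_coeff E M2 j"] coeff_le_1[OF M(1), of j] coeff_le_1[OF M(2), of j]
      by linarith
    then show ?thesis unfolding h_def using power_mono[of "norm (d j)" 2 2] by simp
  qed
  have h0: "0 \<le> h j" for j by (simp add: h_def)
  have habs: "norm (c n j * h j) \<le> 4 * \<bar>c n j\<bar>" for n j
    using mult_left_mono[OF h4[of j], of "\<bar>c n j\<bar>"] h0[of j] by (simp add: abs_mult mult.commute)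
  have sh: "summable (\<lambda>j. c n j * h j)" for n
    by (rule summable_comparison_test'[OF summable_mult[OF c_summable[of n], of 4] habs])
  have sh0: "summable (\<lambda>j. \<bar>c 0 j\<bar> * h j)"
    by (rule summable_comparison_test'[OF summable_mult[OF c_summable[of 0], of 4]]) (use habs[of 0] h0 in \<open>simp add: abs_mult\<close>)
  \<comment> \<open>The index \<open>i\<close> contributes at least \<open>2 * e\<close> from stage
    \<open>p\<close> on, and the tail beyond \<open>q\<close> will take away less than
    \<open>e\<close>.\<close>
  define e where "e = c p i * h i / 2"
  have "e > 0" using p i by (simp add: e_def h_def)
  obtain q0 where q0: "\<And>n. q0 \<le> n \<Longrightarrow> norm (\<Sum>j. \<bar>c 0 (j + n)\<bar> * h (j + n)) < e"
    using suminf_exist_split[OF \<open>e > 0\<close> sh0] by blast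
  define q where "q = max q0 (Suc i)"
  \<comment> \<open>Only finitely many indices lie below \<open>q\<close>, so one stage makes all
    their weights positive. The exception 0 is harmless, because \<open>h\<close> vanishes
    there.\<close>
  have "\<exists>n0. \<forall>j<q. j \<noteq> 0 \<longrightarrow> 0 < c n0 j"
  proof -
    obtain f where f: "\<And>j. j \<noteq> 0 \<Longrightarrow> 0 < c (f j) j" using c_pos by metis
    have "0 < c (Max (f ` {..<q})) j" if "j < q" "j \<noteq> 0" for j
      using f[OF that(2)] cm[of "f j" "Max (f ` {..<q})" j] that by (auto intro: less_le_trans)
    then show ?thesis by blast
  qed
  then obtain n0 where n0: "\<And>j. j < q \<Longrightarrow> j \<noteq> 0 \<Longrightarrow> 0 < c n0 j" by blast
  have D: "e \<le> (\<Sum>j. c n j * h j)" if n: "n \<ge> n0" "n \<ge> p" for n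
  proof -
    have "2 * e \<le> c n i * h i" unfolding e_def using cm[OF n(2), of i] h0[of i] by (simp add: mult_right_mono)
    also have "\<dots> \<le> (\<Sum>j<q. c n j * h j)"
    proof (rule member_le_sum)
      fix j assume "j \<in> {..<q} - {i}"
      then show "0 \<le> c n j * h j"
        using n0[of j] cm[OF n(1), of j] h0[of j] d0 by (cases "j = 0") (auto simp: h_def intro!: mult_nonneg_nonneg)
    qed (auto simp: q_def)
    finally have 1: "2 * e \<le> (\<Sum>j<q. c n j * h j)" .
    \<comment> \<open>Weights beyond \<open>q\<close> may still be negative at stage
      \<open>n\<close>, but they never fall below \<open>- \<bar>c 0 j\<bar>\<close>. This makes the
      estimate of the tail independent of \<open>n\<close>.\<close>
    have "(\<Sum>j. - (\<bar>c 0 (j + q)\<bar> * h (j + q))) \<le> (\<Sum>j. c n (j + q) * h (j + q))"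
    proof (rule suminf_le)
      fix j
      have "- \<bar>c 0 (j + q)\<bar> \<le> c n (j + q)" using cm[of 0 n "j + q"] by linarith
      from mult_right_mono[OF this h0[of "j + q"]] show "- (\<bar>c 0 (j + q)\<bar> * h (j + q)) \<le> c n (j + q) * h (j + q)" by simp
    qed (use sh sh0 summable_iff_shift[of "\<lambda>j. \<bar>c 0 j\<bar> * h j" q] summable_iff_shift[of "\<lambda>j. c n j * h j" q] in \<open>auto intro!: summable_minus\<close>)
    moreover have "(\<Sum>j. - (\<bar>c 0 (j + q)\<bar> * h (j + q))) = - (\<Sum>j. \<bar>c 0 (j + q)\<bar> * h (j + q))"
      using sh0 summable_iff_shift[of "\<lambda>j. \<bar>c 0 j\<bar> * h j" q] by (intro suminf_minus) simp
    moreover have "\<bar>\<Sum>j. \<bar>c 0 (j + q)\<bar> * h (j + q)\<bar> < e" using q0[of q] by (simp add: q_def)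
    ultimately have "- e \<le> (\<Sum>j. c n (j + q) * h (j + q))" by linarith
    then show ?thesis using 1 suminf_split_initial_segment[OF sh[of n], of q] by linarith
  qed
  obtain M where M': "prob_space M" "sets M = sets X" "emeasure M A = 1"
    and avg: "\<And>j. fourier_coeff E M j = (fourier_coeff E M1 j + fourier_coeff E M2 j) / 2"
    using exists_midpoint_measure[OF PM_D(1,2)[OF M(1)] PM_D(1,2)[OF M(2)]] A_sets PM_D(4)[OF M(1)] PM_D(4)[OF M(2)]
      E_measurable E_le_1 unfolding fourier_coeff_def by metis
  then have MP: "M \<in> PM" by (simp add: PM_eq)
  \<comment> \<open>the midpoint \<open>M\<close> has smaller energy than \<open>M1\<close> and \<open>M2\<close>, by the parallelogram identity\<close>
  have te: "truncated_energy n M \<le> l - e / 4" if n: "n \<ge> n0" "n \<ge> p" for n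
  proof -
    have s: "summable (\<lambda>j. c n j * (norm (fourier_coeff E M' j))\<^sup>2)" if "M' \<in> PM" for M'
      by (rule summable_weighted_form_diag[OF c_summable coeff_le_1[OF that]])
    have par: "c n j * (norm (fourier_coeff E M j))\<^sup>2 = (c n j * (norm (fourier_coeff E M1 j))\<^sup>2 / 2
        + c n j * (norm (fourier_coeff E M2 j))\<^sup>2 / 2) - c n j * h j / 4" for j
      by (simp add: avg h_def d_def cmod_power2 power_divide norm_divide) (simp add: field_simps power2_eq_square)
    have "truncated_energy n M = (truncated_energy n M1 / 2 + truncated_energy n M2 / 2) - (\<Sum>j. c n j * h j) / 4"
      unfolding truncated_energy_def weighted_form_diag par
      by (subst suminf_diff[symmetric] suminf_add[symmetric] suminf_divide[symmetric]; (intro summable_add summable_divide s sh M)?)+ simp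
    moreover have "truncated_energy n M1 \<le> l" "truncated_energy n M2 \<le> l"
      using l(1,2) SUP_upper[of n UNIV "\<lambda>n. ereal (truncated_energy n M1)"] SUP_upper[of n UNIV "\<lambda>n. ereal (truncated_energy n M2)"]
      unfolding energy_def by auto
    ultimately show ?thesis using D[OF n] by linarith
  qed
  have "energy M \<le> ereal (l - e / 4)" unfolding energy_def
  proof (rule SUP_least)
    fix n
    have "truncated_energy n M \<le> truncated_energy (max n (max n0 p)) M"
      using truncated_energy_incseq[OF MP] by (simp add: incseq_def)
    also have "\<dots> \<le> l - e / 4" by (rule te) auto
    finally show "ereal (truncated_energy n M) \<le> ereal (l - e / 4)" by simp
  qed
  with l(3)[OF MP] have "ereal l \<le> ereal (l - e / 4)" by (rule order_trans)
  with \<open>e > 0\<close> show False by simp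
qed

theorem min_energy_asymptotics:
  shows "(\<exists>M\<in>PM. energy M < \<infinity>) \<longrightarrow>
      (\<exists>\<nu>. {M \<in> PM. energy M = (INF M'\<in>PM. energy M')} = {\<nu>} \<and>
        (\<lambda>N. min_energy N / ereal ((real N)\<^sup>2)) \<longlonglongrightarrow> energy \<nu>)"
    and "(\<forall>M\<in>PM. energy M = \<infinity>) \<longrightarrow> (\<lambda>N. min_energy N / ereal ((real N)\<^sup>2)) \<longlonglongrightarrow> \<infinity>"
proof -
  \<comment> \<open>If the estimate failed for infinitely many \<open>N\<close>, a weak limit along
    these \<open>N\<close> would have energy at most \<open>b\<close>.\<close>
  have lower: "\<forall>\<^sub>F N in sequentially. ereal b < min_energy N / ereal ((real N)\<^sup>2)"
    if "\<And>M. M \<in> PM \<Longrightarrow> ereal b < energy M" for b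
  proof (rule ccontr)
    assume "\<not> ?thesis"
    from not_eventually_imp_infinite[OF this]
    have "infinite {N. min_energy N / ereal ((real N)\<^sup>2) \<le> ereal b}" by (simp add: not_less)
    from exists_energy_le[OF this, of b] obtain M where "M \<in> PM" "energy M \<le> ereal b" by auto
    with that[of M] show False by simp
  qed
  show "(\<forall>M\<in>PM. energy M = \<infinity>) \<longrightarrow> (\<lambda>N. min_energy N / ereal ((real N)\<^sup>2)) \<longlonglongrightarrow> \<infinity>"
    unfolding tendsto_PInfty by (intro impI allI lower) simp
  show "(\<exists>M\<in>PM. energy M < \<infinity>) \<longrightarrow>
      (\<exists>\<nu>. {M \<in> PM. energy M = (INF M'\<in>PM. energy M')} = {\<nu>} \<and>
        (\<lambda>N. min_energy N / ereal ((real N)\<^sup>2)) \<longlonglongrightarrow> energy \<nu>)"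
  proof
    assume "\<exists>M\<in>PM. energy M < \<infinity>"
    then obtain M0 where M0: "M0 \<in> PM" "energy M0 < \<infinity>" by blast
    have "ereal (- c_sum 0) \<le> (INF M'\<in>PM. energy M')" by (rule INF_greatest) (rule energy_lower)
    moreover have "(INF M'\<in>PM. energy M') < \<infinity>" using M0 by (meson INF_lower le_less_trans)
    ultimately obtain l where l: "(INF M'\<in>PM. energy M') = ereal l" by (cases "INF M'\<in>PM. energy M'") auto
    have ge: "ereal l \<le> energy M" if "M \<in> PM" for M unfolding l[symmetric] using that by (rule INF_lower)
    \<comment> \<open>It is not known yet that \<open>l\<close> is attained, so the averaging bound
      is applied to measures with energy within \<open>e / N\<^sup>2\<close> of the infimum.\<close>
    have up: "min_energy N / ereal ((real N)\<^sup>2) \<le> ereal ((1 - 1 / real N) * l)" if N: "N > 0" for N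
    proof -
      have "min_energy N \<le> ereal (real N * (real N - 1) * l)"
      proof (rule ereal_le_epsilon2)
        fix e :: real assume "e > 0"
        have "ereal l < ereal (l + e / (real N)\<^sup>2)" using \<open>e > 0\<close> N by simp
        then obtain M where M: "M \<in> PM" "energy M < ereal (l + e / (real N)\<^sup>2)" unfolding l[symmetric] INF_less_iff by blast
        then obtain k where k: "energy M = ereal k" using energy_lower[OF M(1)] by (cases "energy M") auto
        have "real N * (real N - 1) * k \<le> real N * (real N - 1) * l + e"
        proof -
          have "real N * (real N - 1) * (k - l) \<le> real N * (real N - 1) * (e / (real N)\<^sup>2)"
            using M(2) k N by (intro mult_left_mono) auto
          also have "\<dots> \<le> (real N)\<^sup>2 * (e / (real N)\<^sup>2)"
            using \<open>e > 0\<close> by (intro mult_right_mono) (auto simp: power2_eq_square algebra_simps)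
          also have "\<dots> = e" using N by simp
          finally show ?thesis by (simp add: algebra_simps)
        qed
        then show "min_energy N \<le> ereal (real N * (real N - 1) * l) + ereal e"
          using min_energy_le[OF M(1) k, of N] by (auto elim: order_trans)
      qed
      then show ?thesis using N
        by (cases "min_energy N") (auto simp: divide_simps power2_eq_square algebra_simps)
    qed
    have lim: "(\<lambda>N. (1 - 1 / real N) * l) \<longlonglongrightarrow> l"
      by (rule tendsto_eq_intros lim_1_over_n refl)+ simp
    \<comment> \<open>The discrete minima themselves produce a minimizer: their upper bounds hold
      for every positive \<open>N\<close> and tend to \<open>l\<close>.\<close>
    have "{0<..} \<subseteq> {N. min_energy N / ereal ((real N)\<^sup>2) \<le> ereal ((1 - 1 / real N) * l)}" using up by auto
    then have "infinite {N. min_energy N / ereal ((real N)\<^sup>2) \<le> ereal ((1 - 1 / real N) * l)}"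
      using infinite_Ioi[of "0::nat"] finite_subset by blast
    from exists_energy_le[OF this lim] obtain \<nu> where \<nu>: "\<nu> \<in> PM" "energy \<nu> \<le> ereal l" by blast
    then have en: "energy \<nu> = ereal l" using ge[of \<nu>] by simp
    have "(\<lambda>N. min_energy N / ereal ((real N)\<^sup>2)) \<longlonglongrightarrow> ereal l"
    proof (rule order_tendstoI)
      fix a assume "a < ereal l"
      then obtain b where "a < ereal b" "b < l" using ereal_dense2[of a "ereal l"] by auto
      then have "\<forall>\<^sub>F N in sequentially. ereal b < min_energy N / ereal ((real N)\<^sup>2)"
        using ge by (intro lower) (meson less_ereal.simps(1) less_le_trans)
      then show "\<forall>\<^sub>F N in sequentially. a < min_energy N / ereal ((real N)\<^sup>2)"
        by eventually_elim (use \<open>a < ereal b\<close> in order)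
    next
      fix a assume "ereal l < a"
      then have "\<forall>\<^sub>F N in sequentially. ereal ((1 - 1 / real N) * l) < a"
        using lim by (intro order_tendstoD(2)) auto
      then show "\<forall>\<^sub>F N in sequentially. min_energy N / ereal ((real N)\<^sup>2) < a"
        using eventually_gt_at_top[of 0] by eventually_elim (use up in \<open>blast intro: le_less_trans\<close>)
    qed
    moreover have "{M \<in> PM. energy M = (INF M'\<in>PM. energy M')} = {\<nu>}"
      unfolding l using \<nu>(1) en ge energy_minimizer_unique[of _ \<nu> l] by blast
    ultimately show "\<exists>\<nu>. {M \<in> PM. energy M = (INF M'\<in>PM. energy M')} = {\<nu>} \<and>
        (\<lambda>N. min_energy N / ereal ((real N)\<^sup>2)) \<longlonglongrightarrow> energy \<nu>"
      unfolding en[symmetric] by blast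
  qed
qed

end

section \<open>Linear change of variables and Gaussian integrals\<close>

text \<open>Fubini with the coordinate along \<open>b1\<close> innermost. While the other
  coordinates are fixed, the shear is a translation of the line by the coordinate along
  \<open>b2\<close>.\<close>

lemma nn_integral_lborel_shear:
  fixes f :: "'a::euclidean_space \<Rightarrow> ennreal"
  assumes [measurable]: "f \<in> borel_measurable borel" and b: "b1 \<in> Basis" "b2 \<in> Basis" "b1 \<noteq> b2"
  shows "(\<integral>\<^sup>+x. f (x + (x \<bullet> b2) *\<^sub>R b1) \<partial>lborel) = (\<integral>\<^sup>+x. f x \<partial>lborel)"
proof -
  interpret product_sigma_finite "\<lambda>_::'a. lborel :: real measure" by standard
  define B where "B = Basis - {b1}"
  have B: "Basis = insert b1 B" "finite B" "b1 \<notin> B" "b2 \<in> B" using b by (auto simp: B_def)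
  have lb: "lborel = distr (Pi\<^sub>M Basis (\<lambda>_. lborel)) borel (\<lambda>g. \<Sum>b\<in>Basis. g b *\<^sub>R b :: 'a)"
    unfolding lborel_def[where 'a='a] by (simp add: lborel_eq_real)
  have S: "(\<Sum>b\<in>Basis. (x(b1 := y)) b *\<^sub>R b) = y *\<^sub>R b1 + (\<Sum>b\<in>B. x b *\<^sub>R b)" for x :: "'a \<Rightarrow> real" and y
    unfolding B(1) using B by (subst sum.insert) (auto intro!: sum.cong)
  have i2: "(\<Sum>b\<in>B. x b *\<^sub>R b) \<bullet> b2 = x b2" for x
  proof -
    have "(\<Sum>b\<in>B. x b *\<^sub>R b) \<bullet> b2 = (\<Sum>b\<in>B. x b * (b \<bullet> b2))" by (simp add: inner_sum_left)
    also have "\<dots> = (\<Sum>b\<in>B. if b = b2 then x b else 0)"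
      using B b by (intro sum.cong) (auto simp: inner_Basis)
    finally show ?thesis using B by simp
  qed
  have "(\<integral>\<^sup>+x. f (x + (x \<bullet> b2) *\<^sub>R b1) \<partial>lborel) =
    (\<integral>\<^sup>+g. f ((\<Sum>b\<in>Basis. g b *\<^sub>R b) + ((\<Sum>b\<in>Basis. g b *\<^sub>R b) \<bullet> b2) *\<^sub>R b1) \<partial>Pi\<^sub>M Basis (\<lambda>_. lborel))"
    by (subst lb, subst nn_integral_distr) auto
  also have "\<dots> = (\<integral>\<^sup>+x. \<integral>\<^sup>+y. f ((y *\<^sub>R b1 + (\<Sum>b\<in>B. x b *\<^sub>R b)) + ((y *\<^sub>R b1 + (\<Sum>b\<in>B. x b *\<^sub>R b)) \<bullet> b2) *\<^sub>R b1)
      \<partial>lborel \<partial>Pi\<^sub>M B (\<lambda>_. lborel))"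
    unfolding S[symmetric] B(1) by (rule product_nn_integral_insert[OF B(2,3)]) (simp flip: B(1))
  also have "\<dots> = (\<integral>\<^sup>+x. \<integral>\<^sup>+y. f (y *\<^sub>R b1 + (\<Sum>b\<in>B. x b *\<^sub>R b)) \<partial>lborel \<partial>Pi\<^sub>M B (\<lambda>_. lborel))"
  proof (rule nn_integral_cong)
    fix x :: "'a \<Rightarrow> real"
    let ?s = "\<Sum>b\<in>B. x b *\<^sub>R b"
    have "(\<integral>\<^sup>+y. f (y *\<^sub>R b1 + ?s) \<partial>lborel) = (\<integral>\<^sup>+y. f ((x b2 + 1 * y) *\<^sub>R b1 + ?s) \<partial>lborel)"
      by (subst nn_integral_real_affine[of _ 1 "x b2"]) auto
    also have "\<dots> = (\<integral>\<^sup>+y. f ((y *\<^sub>R b1 + ?s) + ((y *\<^sub>R b1 + ?s) \<bullet> b2) *\<^sub>R b1) \<partial>lborel)"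
      using b by (intro nn_integral_cong arg_cong[of _ _ f]) (simp add: inner_add_left i2 inner_not_same_Basis algebra_simps)
    finally show "(\<integral>\<^sup>+y. f ((y *\<^sub>R b1 + ?s) + ((y *\<^sub>R b1 + ?s) \<bullet> b2) *\<^sub>R b1) \<partial>lborel) = (\<integral>\<^sup>+y. f (y *\<^sub>R b1 + ?s) \<partial>lborel)" by simp
  qed
  also have "\<dots> = (\<integral>\<^sup>+g. f (\<Sum>b\<in>Basis. g b *\<^sub>R b) \<partial>Pi\<^sub>M Basis (\<lambda>_. lborel))"
    unfolding S[symmetric] B(1) by (rule product_nn_integral_insert[OF B(2,3), symmetric]) (simp flip: B(1))
  also have "\<dots> = (\<integral>\<^sup>+x. f x \<partial>lborel)" by (subst lb, subst nn_integral_distr) auto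
  finally show ?thesis .
qed

lemma borel_measurable_matrix_vector[measurable]: "(\<lambda>x::real^'n. A *v x) \<in> borel_measurable borel"
  by (intro borel_measurable_continuous_onI linear_continuous_on matrix_vector_mul_bounded_linear)

text \<open>The formula is stable under products, so elementary matrices suffice. A zero row
  contradicts the determinant, a diagonal matrix rescales coordinates, a swap permutes the sides of
  boxes, and the last type is the shear above.\<close>

lemma nn_integral_lborel_linear:
  fixes A :: "real^'n^'n"
  assumes "det A \<noteq> 0" "f \<in> borel_measurable borel"
  shows "(\<integral>\<^sup>+x. f x \<partial>lborel) = ennreal \<bar>det A\<bar> * (\<integral>\<^sup>+x. f (A *v x) \<partial>lborel)"
proof -
  have "det A \<noteq> 0 \<longrightarrow> (\<forall>f\<in>borel_measurable borel. (\<integral>\<^sup>+x. f x \<partial>lborel) = ennreal \<bar>det A\<bar> * (\<integral>\<^sup>+x. f (A *v x) \<partial>lborel))"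
  proof (induction A rule: induct_matrix_elementary_alt)
    case mult: (1 A B)
    show ?case
    proof (intro impI ballI)
      fix f :: "real^'n \<Rightarrow> ennreal" assume d: "det (A ** B) \<noteq> 0" and [measurable]: "f \<in> borel_measurable borel"
      then have dd: "det A \<noteq> 0" "det B \<noteq> 0" by (auto simp: det_mul)
      have "(\<integral>\<^sup>+x. f x \<partial>lborel) = ennreal \<bar>det A\<bar> * (\<integral>\<^sup>+x. f (A *v x) \<partial>lborel)"
        by (rule mult(1)[rule_format, OF dd(1)]) measurable
      also have "(\<integral>\<^sup>+x. f (A *v x) \<partial>lborel) = ennreal \<bar>det B\<bar> * (\<integral>\<^sup>+x. f (A *v (B *v x)) \<partial>lborel)"
        by (rule mult(2)[rule_format, OF dd(2)]) measurable
      finally show "(\<integral>\<^sup>+x. f x \<partial>lborel) = ennreal \<bar>det (A ** B)\<bar> * (\<integral>\<^sup>+x. f ((A ** B) *v x) \<partial>lborel)"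
        by (simp add: matrix_vector_mul_assoc det_mul abs_mult ennreal_mult mult.assoc)
    qed
  next
    case zero_row: (2 A i)
    then show ?case by (simp add: det_zero_row row_def vec_eq_iff)
  next
    case diagonal: (3 A)
    show ?case
    proof (intro impI ballI)
      fix f :: "real^'n \<Rightarrow> ennreal" assume d: "det A \<noteq> 0" and f[measurable]: "f \<in> borel_measurable borel"
      have det: "det A = (\<Prod>i\<in>UNIV. A $ i $ i)" using diagonal by (rule det_diagonal)
      \<comment> \<open>The scaling theorem wants one factor per basis vector; on
        \<open>axis i 1\<close> this is the diagonal entry at \<open>i\<close>.\<close>
      define c where "c b = (\<Sum>i\<in>UNIV. A $ i $ i * (b \<bullet> axis i 1))" for b :: "real^'n"
      have c: "c (axis i 1) = A $ i $ i" for i by (simp add: c_def inner_axis_axis if_distrib cong: if_cong)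
      have T: "0 + (\<Sum>j\<in>Basis. (c j * (x \<bullet> j)) *\<^sub>R j) = A *v x" for x
      proof -
        have "(\<Sum>j\<in>Basis. (c j * (x \<bullet> j)) *\<^sub>R j) = (\<Sum>i\<in>UNIV. (c (axis i 1) * (x \<bullet> axis i 1)) *\<^sub>R axis i 1)"
          by (simp add: Basis_vec_def UNION_singleton_eq_range) (subst sum.reindex, auto simp: inj_on_def axis_eq_axis)
        also have "\<dots> = A *v x"
        proof (simp add: vec_eq_iff matrix_vector_mult_def c inner_axis, intro allI)
          fix i
          have "(\<Sum>j\<in>UNIV. A $ j $ j * x $ j * axis j 1 $ i) = (\<Sum>j\<in>UNIV. if j = i then A $ i $ i * x $ i else 0)"
            by (intro sum.cong) (auto simp: axis_def)
          also have "\<dots> = (\<Sum>j\<in>UNIV. A $ i $ j * x $ j)"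
            using diagonal by (subst sum.mono_neutral_left[of UNIV "{i}" "\<lambda>j. A $ i $ j * x $ j", symmetric]) auto
          finally show "(\<Sum>j\<in>UNIV. A $ j $ j * x $ j * axis j 1 $ i) = (\<Sum>j\<in>UNIV. A $ i $ j * x $ j)" .
        qed
        finally show ?thesis by simp
      qed
      have P: "(\<Prod>j\<in>Basis. \<bar>c j\<bar>) = \<bar>det A\<bar>"
        unfolding det abs_prod
        by (simp add: Basis_vec_def UNION_singleton_eq_range) (subst prod.reindex, auto simp: inj_on_def axis_eq_axis c)
      have "c j \<noteq> 0" if "j \<in> Basis" for j
        using that d unfolding det by (auto simp: Basis_vec_def c)
      from lborel_affine_euclidean[of c 0, OF this]
      have "lborel = density (distr lborel borel (\<lambda>x. A *v x)) (\<lambda>_. ennreal \<bar>det A\<bar>)" unfolding T P by simp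
      then have "(\<integral>\<^sup>+x. f x \<partial>lborel) = (\<integral>\<^sup>+x. f x \<partial>density (distr lborel borel (\<lambda>x. A *v x)) (\<lambda>_. ennreal \<bar>det A\<bar>))" by simp
      also have "\<dots> = ennreal \<bar>det A\<bar> * (\<integral>\<^sup>+x. f (A *v x) \<partial>lborel)"
        by (subst nn_integral_density, simp, simp, subst nn_integral_distr) (auto simp: nn_integral_cmult)
      finally show "(\<integral>\<^sup>+x. f x \<partial>lborel) = ennreal \<bar>det A\<bar> * (\<integral>\<^sup>+x. f (A *v x) \<partial>lborel)" .
    qed
  next
    case swap1: (4 m n)
    define A :: "real^'n^'n" where "A = (\<chi> i j. mat 1 $ i $ Transposition.transpose m n j)"
    define p where "p = Transposition.transpose m n"
    have pp: "p (p i) = i" for i by (simp add: p_def)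
    have Av: "A *v x = (\<chi> i. x $ p i)" for x
      unfolding vec_eq_iff matrix_vector_mult_def A_def mat_def p_def[symmetric]
    proof (intro allI, simp)
      fix i
      have "(i = p j) = (j = p i)" for j using pp by metis
      then show "(\<Sum>j\<in>UNIV. (if i = p j then 1 else 0) * x $ j) = x $ p i"
        by (subst sum.cong[of UNIV UNIV _ "\<lambda>j. if j = p i then x $ j else 0"]) auto
    qed
    have "A ** A = mat 1"
      by (simp add: matrix_eq matrix_vector_mul_assoc[symmetric] Av pp)
    then have "det A * det A = 1" by (metis det_I det_mul)
    then have dA: "\<bar>det A\<bar> = 1" by (metis abs_mult_self_eq abs_of_nonneg abs_1 abs_square_eq_1 power2_eq_square)
    have "distr lborel borel (\<lambda>x. A *v x) = lborel"
    proof (rule lborel_eqI[symmetric])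
      fix l u :: "real^'n" assume lu: "\<And>b. b \<in> Basis \<Longrightarrow> l \<bullet> b \<le> u \<bullet> b"
      have lui: "l $ i \<le> u $ i" for i using lu[of "axis i 1"] by (auto simp: Basis_vec_def inner_axis)
      have "(\<lambda>x. A *v x) -` box l u = box (A *v l) (A *v u)"
        unfolding box_def Basis_vec_def using pp by (auto simp: Av inner_axis) metis+
      then have "emeasure (distr lborel borel (\<lambda>x. A *v x)) (box l u) = emeasure lborel (box (A *v l) (A *v u))"
        by (subst emeasure_distr) auto
      also have "\<dots> = (\<Prod>b\<in>Basis. (A *v u - A *v l) \<bullet> b)"
        using lui by (subst emeasure_lborel_box) (auto simp: Basis_vec_def Av inner_axis)
      also have "(\<Prod>b\<in>Basis. (A *v u - A *v l) \<bullet> b) = (\<Prod>i\<in>UNIV. (u - l) $ p i)"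
        by (simp add: Basis_vec_def UNION_singleton_eq_range) (subst prod.reindex, auto simp: inj_on_def axis_eq_axis Av inner_axis)
      also have "\<dots> = (\<Prod>i\<in>UNIV. (u - l) $ i)"
        by (rule prod.reindex_bij_betw) (metis bij_betw_byWitness[of UNIV p p UNIV] pp subset_UNIV)
      also have "\<dots> = (\<Prod>b\<in>Basis. (u - l) \<bullet> b)"
        by (simp add: Basis_vec_def UNION_singleton_eq_range) (subst prod.reindex, auto simp: inj_on_def axis_eq_axis inner_axis)
      finally show "emeasure (distr lborel borel (\<lambda>x. A *v x)) (box l u) = ennreal (\<Prod>b\<in>Basis. (u - l) \<bullet> b)" .
    qed simp
    then have inv: "ennreal 1 * (\<integral>\<^sup>+x. f (A *v x) \<partial>lborel) = (\<integral>\<^sup>+x. f x \<partial>lborel)" if "f \<in> borel_measurable borel" for f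
      using that nn_integral_distr[of "\<lambda>x. A *v x" lborel borel f] by simp
    show ?case unfolding A_def[symmetric] dA by (intro impI ballI inv[symmetric])
  next
    case idplus: (5 m n)
    define A :: "real^'n^'n" where "A = (\<chi> i j. of_bool (i = m \<and> j = n \<or> i = j))"
    have Av: "A *v x = x + (x \<bullet> axis n 1) *\<^sub>R axis m 1" for x
    proof (rule vec_eq_iff[THEN iffD2], rule allI)
      fix i
      have "(\<Sum>j\<in>UNIV. of_bool (i = m \<and> j = n \<or> i = j) * x $ j) = (\<Sum>j\<in>UNIV. (if j = i then x $ j else 0) + (if j = n then (if i = m then x $ j else 0) else 0))"
        using idplus by (intro sum.cong) auto
      also have "\<dots> = x $ i + (x \<bullet> axis n 1) * axis m 1 $ i" 
        by (simp add: sum.distrib inner_axis) (simp add: axis_def)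
      finally show "(A *v x) $ i = (x + (x \<bullet> axis n 1) *\<^sub>R axis m 1) $ i"
        by (simp add: matrix_vector_mult_def A_def)
    qed
    have "det A = 1"
    proof -
      have "A = (\<chi> i. if i = m then row m (mat 1) + 1 *s row n (mat 1) else row i (mat 1))"
        using idplus by (auto simp: A_def vec_eq_iff row_def mat_def)
      then show ?thesis using det_row_operation[OF idplus, of "mat 1" 1] by simp
    qed
    moreover have inv: "(\<integral>\<^sup>+x. f (A *v x) \<partial>lborel) = (\<integral>\<^sup>+x. f x \<partial>lborel)" if "f \<in> borel_measurable borel" for f
      unfolding Av using idplus that by (intro nn_integral_lborel_shear) (auto simp: Basis_vec_def axis_eq_axis)
    ultimately show ?case unfolding A_def[symmetric] by simp
  qed
  then show ?thesis using assms by blast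
qed

lemma distr_lborel_matrix:
  fixes A :: "real^'n^'n"
  assumes "det A = 1"
  shows "distr lborel borel (\<lambda>x. A *v x) = lborel"
proof (rule measure_eqI)
  fix B assume "B \<in> sets (distr lborel borel (\<lambda>x. A *v x))"
  then have [measurable]: "B \<in> sets borel" by simp
  have "emeasure (distr lborel borel (\<lambda>x. A *v x)) B = (\<integral>\<^sup>+x. indicator B x \<partial>distr lborel borel (\<lambda>x. A *v x))" by simp
  also have "\<dots> = (\<integral>\<^sup>+x. indicator B (A *v x) \<partial>lborel)" by (rule nn_integral_distr) auto
  also have "\<dots> = (\<integral>\<^sup>+x. indicator B x \<partial>lborel)" using nn_integral_lborel_linear[of A "indicator B"] assms by simp
  finally show "emeasure (distr lborel borel (\<lambda>x. A *v x)) B = emeasure lborel B" by simp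
qed simp

section \<open>Fourier transform of Gaussians\<close>

lemma gaussian_fourier_real:
  fixes t s :: real
  assumes t: "t > 0"
  shows "(\<integral>x. complex_of_real (exp (- t * x\<^sup>2)) * cis (s * x) \<partial>lborel) = complex_of_real (sqrt (pi / t) * exp (- s\<^sup>2 / (4 * t)))"
    and "integrable lborel (\<lambda>x. complex_of_real (exp (- t * x\<^sup>2)) * cis (s * x))"
proof -
  \<comment> \<open>Scaling by \<open>r\<close> turns the Gaussian into the standard normal density
    up to a constant, and the characteristic function of that is known.\<close>
  define r where "r = sqrt (2 * t)"
  have r: "r > 0" "r\<^sup>2 = 2 * t" using t by (auto simp: r_def)
  define g where "g x = complex_of_real (std_normal_density x) * cis (s / r * x)" for x
  have [measurable]: "(\<lambda>x. cis (a * x)) \<in> borel_measurable borel" for a :: real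
    by (intro borel_measurable_continuous_onI continuous_intros)
  have gm: "g \<in> borel_measurable lborel" unfolding g_def by measurable
  have ig: "integrable lborel g"
    by (rule Bochner_Integration.integrable_bound[of lborel std_normal_density, OF _ gm])
      (auto simp: g_def norm_mult)
  have "integral\<^sup>L lborel g = char std_normal_distribution (s / r)"
    unfolding char_def g_def
    by (subst integral_density) (auto simp: scaleR_conv_of_real cis_conv_exp mult_ac)
  also have "\<dots> = complex_of_real (exp (- s\<^sup>2 / (4 * t)))"
    unfolding char_std_normal_distribution by (simp add: power_divide r)
  finally have Ig: "integral\<^sup>L lborel g = complex_of_real (exp (- s\<^sup>2 / (4 * t)))" .
  have eq: "complex_of_real (exp (- t * x\<^sup>2)) * cis (s * x) = complex_of_real (sqrt (2 * pi)) * g (0 + r * x)" for x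
    using r by (simp add: g_def std_normal_density_def power_mult_distrib)
  have "(\<integral>x. g (0 + r * x) \<partial>lborel) = integral\<^sup>L lborel g /\<^sub>R r"
    using lborel_integral_real_affine[of r g 0] r by (simp add: field_simps)
  then show "(\<integral>x. complex_of_real (exp (- t * x\<^sup>2)) * cis (s * x) \<partial>lborel) = complex_of_real (sqrt (pi / t) * exp (- s\<^sup>2 / (4 * t)))"
    unfolding eq Ig using t by (simp add: r_def real_sqrt_divide real_sqrt_mult scaleR_conv_of_real field_simps)
  show "integrable lborel (\<lambda>x. complex_of_real (exp (- t * x\<^sup>2)) * cis (s * x))"
    unfolding eq using lborel_integrable_real_affine[OF ig, of r 0] r by simp
qed

text \<open>Gaussian and character both factor over coordinates, so Fubini reduces the claim to the
  line. It explains the weights of the periodic kernel: \<open>dual_weight w t\<close> is the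
  Fourier transform at \<open>w\<close> of the Gaussian with parameter \<open>t\<close>.\<close>

lemma gaussian_fourier:
  fixes w :: "real^'n"
  assumes t: "t > 0"
  shows "(\<integral>x. complex_of_real (exp (- t * (norm x)\<^sup>2)) * cis (2 * pi * (w \<bullet> x)) \<partial>lborel) =
      complex_of_real (dual_weight w t)"
    and "integrable lborel (\<lambda>x. complex_of_real (exp (- t * (norm x)\<^sup>2)) * cis (2 * pi * (w \<bullet> x)))"
proof -
  interpret product_sigma_finite "\<lambda>_::real^'n. lborel :: real measure" by standard
  define G where "G b x = complex_of_real (exp (- t * x\<^sup>2)) * cis ((2 * pi * (w \<bullet> b)) * x)" for b :: "real^'n" and x :: real
  have G: "integrable lborel (G b)" "integral\<^sup>L lborel (G b) = complex_of_real (sqrt (pi / t) * exp (- (2 * pi * (w \<bullet> b))\<^sup>2 / (4 * t)))" for b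
    unfolding G_def using gaussian_fourier_real[OF t] by auto
  have lb: "lborel = distr (Pi\<^sub>M Basis (\<lambda>_. lborel)) borel (\<lambda>g. \<Sum>b\<in>Basis. g b *\<^sub>R b :: real^'n)"
    unfolding lborel_def[where 'a="real^'n"] by (simp add: lborel_eq_real)
  define F where "F x = complex_of_real (exp (- t * (norm x)\<^sup>2)) * cis (2 * pi * (w \<bullet> x))" for x :: "real^'n"
  have Fm[measurable]: "F \<in> borel_measurable borel" unfolding F_def
    by (intro borel_measurable_continuous_onI continuous_intros)
  have F: "F (\<Sum>b\<in>Basis. g b *\<^sub>R b) = (\<Prod>b\<in>Basis. G b (g b))" for g :: "real^'n \<Rightarrow> real"
  proof -
    define x where "x = (\<Sum>b\<in>Basis. g b *\<^sub>R b :: real^'n)"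
    have xb: "x \<bullet> b = g b" if "b \<in> Basis" for b unfolding x_def using that by simp
    have nx: "(norm x)\<^sup>2 = (\<Sum>b\<in>Basis. (g b)\<^sup>2)"
      unfolding power2_norm_eq_inner by (subst euclidean_inner) (simp add: xb power2_eq_square)
    have wx: "w \<bullet> x = (\<Sum>b\<in>Basis. (w \<bullet> b) * g b)"
      by (subst euclidean_inner) (simp add: xb)
    have cs: "cis (sum h S) = (\<Prod>b\<in>S. cis (h b))" if "finite S" for h and S :: "(real^'n) set"
      using that by (induction S) (auto simp: cis_mult[symmetric])
    show ?thesis
      unfolding F_def x_def[symmetric] nx wx G_def prod.distrib
      by (simp add: sum_distrib_left exp_sum[symmetric] cs[symmetric] sum_negf mult.assoc flip: of_real_prod)
  qed
  have "integrable (Pi\<^sub>M Basis (\<lambda>_. lborel)) (\<lambda>g. \<Prod>b\<in>Basis. G b (g b))"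
    by (rule product_integrable_prod) (auto simp: G)
  then have "integrable lborel F" by (subst lb) (subst integrable_distr_eq, auto simp: F)
  then show "integrable lborel (\<lambda>x. complex_of_real (exp (- t * (norm x)\<^sup>2)) * cis (2 * pi * (w \<bullet> x)))"
    by (simp add: F_def[abs_def])
  have "integral\<^sup>L lborel F = (\<integral>g. (\<Prod>b\<in>Basis. G b (g b)) \<partial>Pi\<^sub>M Basis (\<lambda>_. lborel))"
    by (subst lb) (subst integral_distr, auto simp: F)
  also have "\<dots> = (\<Prod>b\<in>Basis. integral\<^sup>L lborel (G b))" by (rule product_integral_prod) (auto simp: G)
  also have "\<dots> = complex_of_real (\<Prod>b\<in>Basis. sqrt (pi / t) * exp (- (2 * pi * (w \<bullet> b))\<^sup>2 / (4 * t)))" by (simp add: G)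
  also have "(\<Prod>b\<in>Basis. sqrt (pi / t) * exp (- (2 * pi * (w \<bullet> b))\<^sup>2 / (4 * t))) = dual_weight w t"
  proof -
    have "(\<Prod>b\<in>(Basis :: (real^'n) set). exp (- (2 * pi * (w \<bullet> b))\<^sup>2 / (4 * t))) = exp (\<Sum>b\<in>Basis. - (2 * pi * (w \<bullet> b))\<^sup>2 / (4 * t))"
      by (simp add: exp_sum)
    also have "(\<Sum>b\<in>Basis. - (2 * pi * (w \<bullet> b))\<^sup>2 / (4 * t)) = - pi\<^sup>2 * (\<Sum>b\<in>Basis. (w \<bullet> b) * (w \<bullet> b)) / t"
      by (simp add: sum_distrib_left sum_divide_distrib sum_negf[symmetric] power_mult_distrib power2_eq_square ac_simps)
    also have "(\<Sum>b\<in>Basis. (w \<bullet> b) * (w \<bullet> b)) = (norm w)\<^sup>2" unfolding power2_norm_eq_inner by (rule euclidean_inner[symmetric])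
    finally have e: "(\<Prod>b\<in>(Basis :: (real^'n) set). exp (- (2 * pi * (w \<bullet> b))\<^sup>2 / (4 * t))) = exp (- pi\<^sup>2 * (norm w)\<^sup>2 / t)" .
    have "(\<Prod>b\<in>(Basis :: (real^'n) set). sqrt (pi / t)) = sqrt (pi / t) ^ CARD('n)" by simp
    also have "\<dots> = (pi / t) powr (real CARD('n) / 2)"
      using t by (simp add: powr_half_sqrt[symmetric] powr_powr flip: powr_realpow)
    also have "\<dots> = pi powr (real CARD('n) / 2) / t powr (real CARD('n) / 2)" using t by (simp add: powr_divide)
    finally show ?thesis unfolding dual_weight_def prod.distrib e by simp
  qed
  finally show "(\<integral>x. complex_of_real (exp (- t * (norm x)\<^sup>2)) * cis (2 * pi * (w \<bullet> x)) \<partial>lborel) =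
      complex_of_real (dual_weight w t)" by (simp add: F_def[abs_def])
qed

section \<open>Unimodular lattices\<close>

lemma norm_add_sq_le:
  fixes a b :: "'a::real_normed_vector"
  shows "(norm (a + b))\<^sup>2 \<le> 2 * (norm a)\<^sup>2 + 2 * (norm b)\<^sup>2"
proof -
  have "(norm (a + b))\<^sup>2 \<le> (norm a + norm b)\<^sup>2" by (rule power_mono[OF norm_triangle_ineq]) simp
  also have "\<dots> \<le> 2 * (norm a)\<^sup>2 + 2 * (norm b)\<^sup>2"
    using sum_squares_bound[of "norm a" "norm b"] by (simp add: power2_sum)
  finally show ?thesis .
qed

lemma frac_eq_iff_diff_Ints: "frac (x :: real) = frac y \<longleftrightarrow> x - y \<in> \<int>"
proof
  assume "frac x = frac y"
  then have "x - y = of_int (\<lfloor>x\<rfloor> - \<lfloor>y\<rfloor>)" by (simp add: frac_def)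
  then show "x - y \<in> \<int>" by (metis Ints_of_int)
next
  assume "x - y \<in> \<int>"
  then obtain n where "x - y = of_int n" by (rule Ints_cases)
  then have "x = y + of_int n" by simp
  then show "frac x = frac y" by (simp add: frac_def)
qed

locale unimodular_lattice =
  fixes V :: "real^'d^'d"
  assumes det_V: "det V = 1"
begin

definition coord :: "real^'d \<Rightarrow> real^'d" where "coord x = matrix_inv V *v x"

lemma V_inv: "V ** matrix_inv V = mat 1" "matrix_inv V ** V = mat 1"
proof -
  have "invertible V" using det_V by (simp add: invertible_det_nz)
  then have "\<exists>A'. V ** A' = mat 1 \<and> A' ** V = mat 1" by (simp add: invertible_def)
  then show "V ** matrix_inv V = mat 1" "matrix_inv V ** V = mat 1"
    unfolding matrix_inv_def by (rule someI2_ex, simp)+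
qed

lemma V_coord [simp]: "V *v coord x = x" and coord_V [simp]: "coord (V *v x) = x"
  by (simp_all add: coord_def matrix_vector_mul_assoc V_inv)

lemma coord_add: "coord (x + y) = coord x + coord y" and coord_diff: "coord (x - y) = coord x - coord y"
  and coord_minus: "coord (- x) = - coord x" and coord_0 [simp]: "coord 0 = 0"
  using matrix_vector_mult_diff_distrib[of "matrix_inv V" 0 x]
  by (simp_all add: coord_def matrix_vector_right_distrib matrix_vector_mult_diff_distrib)

lemma coord_measurable [measurable]: "coord \<in> borel_measurable borel"
  unfolding coord_def by measurable

lemma continuous_on_coord [continuous_intros]: "continuous_on S f \<Longrightarrow> continuous_on S (\<lambda>x. coord (f x))"
  unfolding coord_def
  by (rule continuous_on_compose2[OF linear_continuous_on[OF matrix_vector_mul_bounded_linear, of UNIV]]) auto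

lemma in_lattice_iff: "v \<in> lattice V \<longleftrightarrow> (\<forall>j. coord v $ j \<in> \<int>)"
proof
  assume "\<forall>j. coord v $ j \<in> \<int>"
  then show "v \<in> lattice V" unfolding lattice_def by (intro CollectI exI[of _ "coord v"]) simp
qed (auto simp: lattice_def)

lemma in_cell_iff: "x \<in> fundamental_cell V \<longleftrightarrow> (\<forall>j. 0 \<le> coord x $ j \<and> coord x $ j < 1)"
proof
  assume *: "\<forall>j. 0 \<le> coord x $ j \<and> coord x $ j < 1"
  have "x = (\<Sum>j\<in>UNIV. coord x $ j *\<^sub>R column j V)"
    by (subst V_coord[symmetric]) (simp add: matrix_mult_sum scalar_mult_eq_scaleR)
  then show "x \<in> fundamental_cell V" unfolding fundamental_cell_def using * by blast
next
  assume "x \<in> fundamental_cell V"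
  then obtain \<alpha> where \<alpha>: "x = (\<Sum>j\<in>UNIV. \<alpha> j *\<^sub>R column j V)" "\<And>j. 0 \<le> \<alpha> j \<and> \<alpha> j < 1"
    unfolding fundamental_cell_def by blast
  have "x = V *v (\<chi> j. \<alpha> j)" unfolding \<alpha>(1) by (simp add: matrix_mult_sum scalar_mult_eq_scaleR)
  then show "\<forall>j. 0 \<le> coord x $ j \<and> coord x $ j < 1" using \<alpha>(2) by simp
qed

lemma lattice_0 [simp]: "0 \<in> lattice V" by (simp add: in_lattice_iff)

lemma lattice_add: "v \<in> lattice V \<Longrightarrow> w \<in> lattice V \<Longrightarrow> v + w \<in> lattice V"
  and lattice_diff: "v \<in> lattice V \<Longrightarrow> w \<in> lattice V \<Longrightarrow> v - w \<in> lattice V"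
  and lattice_minus: "v \<in> lattice V \<Longrightarrow> - v \<in> lattice V"
  by (simp_all add: in_lattice_iff coord_add coord_diff coord_minus)

text \<open>In the coordinates of the lattice basis the lattice is the integer grid, so reduction
  means taking fractional parts.\<close>

lemma torus_proj_eq: "torus_proj V x = V *v (\<chi> j. frac (coord x $ j))"
  unfolding torus_proj_def
proof (rule the_equality)
  show "V *v (\<chi> j. frac (coord x $ j)) \<in> fundamental_cell V \<and> x - V *v (\<chi> j. frac (coord x $ j)) \<in> lattice V"
    by (simp add: in_cell_iff in_lattice_iff coord_diff frac_ge_0 frac_lt_1) (simp add: frac_def)
next
  fix y assume y: "y \<in> fundamental_cell V \<and> x - y \<in> lattice V"
  have "coord y $ j = frac (coord x $ j)" for j
  proof -
    have "0 \<le> coord y $ j" "coord y $ j < 1" "coord x $ j - coord y $ j \<in> \<int>"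
      using y by (auto simp: in_cell_iff in_lattice_iff coord_diff)
    then show ?thesis using frac_unique_iff[of "coord x $ j" "coord y $ j"] by simp
  qed
  then have "coord y = (\<chi> j. frac (coord x $ j))" by (simp add: vec_eq_iff)
  then show "y = V *v (\<chi> j. frac (coord x $ j))" by (metis V_coord)
qed

lemma torus_proj_in_cell: "torus_proj V x \<in> fundamental_cell V"
  by (simp add: torus_proj_eq in_cell_iff frac_ge_0 frac_lt_1)

lemma torus_proj_cong: "torus_proj V x = torus_proj V y \<longleftrightarrow> x - y \<in> lattice V"
proof -
  have "torus_proj V x = torus_proj V y \<longleftrightarrow> (\<chi> j. frac (coord x $ j)) = (\<chi> j. frac (coord y $ j))"
    unfolding torus_proj_eq by (metis coord_V)
  also have "\<dots> \<longleftrightarrow> x - y \<in> lattice V"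
    by (simp add: vec_eq_iff in_lattice_iff coord_diff frac_eq_iff_diff_Ints)
  finally show ?thesis .
qed

lemma torus_proj_cell: "x \<in> fundamental_cell V \<Longrightarrow> torus_proj V x = x"
proof -
  assume x: "x \<in> fundamental_cell V"
  have "(\<chi> j. frac (coord x $ j)) = coord x" using x by (simp add: vec_eq_iff in_cell_iff frac_eq)
  then show ?thesis by (simp add: torus_proj_eq)
qed

lemma diff_torus_proj: "x - torus_proj V x \<in> lattice V"
  by (metis torus_proj_cong torus_proj_cell torus_proj_in_cell)

section \<open>Enumeration of the lattice, tiling by cells and Gaussian sums\<close>

lemma countable_lattice: "countable (lattice V)"
proof (rule countable_subset)
  show "lattice V \<subseteq> range (\<lambda>f :: 'd \<Rightarrow> int. V *v (\<chi> j. of_int (f j)))"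
  proof
    fix v assume "v \<in> lattice V"
    then have "\<forall>j. \<exists>n. coord v $ j = of_int n" by (auto simp: in_lattice_iff elim: Ints_cases)
    then obtain f where f: "\<And>j. coord v $ j = of_int (f j)" by metis
    have "v = V *v (\<chi> j. of_int (f j))" by (subst V_coord[symmetric], rule arg_cong[of _ _ "(*v) V"]) (simp add: vec_eq_iff f)
    then show "v \<in> range (\<lambda>f :: 'd \<Rightarrow> int. V *v (\<chi> j. of_int (f j)))" by blast
  qed
  show "countable (range (\<lambda>f :: 'd \<Rightarrow> int. V *v (\<chi> j. of_int (f j))))" by simp
qed

lemma infinite_lattice: "infinite (lattice V)"
proof
  assume fin: "finite (lattice V)"
  have "inj (\<lambda>n::nat. V *v (\<chi> j::'d. of_nat n))"
    by (rule injI) (metis coord_V of_nat_eq_iff vec_lambda_beta)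
  moreover have "range (\<lambda>n::nat. V *v (\<chi> j. of_nat n)) \<subseteq> lattice V" by (auto simp: in_lattice_iff)
  ultimately show False using fin by (meson finite_imageD finite_subset infinite_UNIV_nat)
qed

text \<open>Index 0 is reserved for the zero vector. The same enumeration of the dual lattice then
  puts frequency 0 at index 0, as \<open>fourier_kernel\<close> expects.\<close>

definition lv :: "nat \<Rightarrow> real^'d" where
  "lv n = (case n of 0 \<Rightarrow> 0 | Suc m \<Rightarrow> from_nat_into (lattice V - {0}) m)"

lemma lv_0 [simp]: "lv 0 = 0" by (simp add: lv_def)

lemma bij_lv_Suc: "bij_betw (\<lambda>n. lv (Suc n)) UNIV (lattice V - {0})"
  using bij_betw_from_nat_into[of "lattice V - {0}"] countable_lattice infinite_lattice
  by (simp add: lv_def countable_Diff)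

lemma bij_lv: "bij_betw lv UNIV (lattice V)"
proof -
  have inj: "inj (\<lambda>n. lv (Suc n))" and im: "(\<lambda>n. lv (Suc n)) ` UNIV = lattice V - {0}" using bij_lv_Suc by (auto simp: bij_betw_def)
  have ne: "lv (Suc n) \<noteq> 0" for n using im by blast
  have "inj lv"
  proof (rule injI)
    fix m n assume eq: "lv m = lv n"
    show "m = n"
    proof (cases m)
      case 0
      then show ?thesis using eq ne[of "n - 1"] by (cases n) auto
    next
      case (Suc m')
      then obtain n' where "n = Suc n'" using eq ne[of m'] by (cases n) auto
      then show ?thesis using Suc eq injD[OF inj, of m' n'] by simp
    qed
  qed
  moreover have "range lv = lattice V"
  proof -
    have "range lv = insert (lv 0) (range (\<lambda>n. lv (Suc n)))" by (subst UNIV_nat_eq) (auto simp: image_image)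
    then show ?thesis using im by auto
  qed
  ultimately show ?thesis by (simp add: bij_betw_def)
qed

lemma lv_in [simp]: "lv n \<in> lattice V" using bij_lv by (auto simp: bij_betw_def)

lemma bij_neg_lv: "bij_betw (\<lambda>n. - lv n) UNIV (lattice V)"
proof -
  have "bij_betw uminus (lattice V) (lattice V)"
    by (rule bij_betw_byWitness[where f'=uminus]) (auto simp: lattice_minus)
  from bij_betw_trans[OF bij_lv this] show ?thesis by (simp add: o_def)
qed

lemma cell_measurable [measurable]: "fundamental_cell V \<in> sets borel"
proof -
  have "fundamental_cell V = {x. \<forall>j\<in>UNIV. 0 \<le> coord x $ j \<and> coord x $ j < 1}" by (auto simp: in_cell_iff)
  also have "\<dots> \<in> sets borel" by measurable
  finally show ?thesis .
qed

text \<open>The cell is the image of the half-open unit cube under a map of determinant 1, and the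
  cube lies between the open and the closed unit box.\<close>

lemma emeasure_cell: "emeasure lborel (fundamental_cell V) = 1"
proof -
  let ?H = "{u :: real^'d. \<forall>j. 0 \<le> u $ j \<and> u $ j < 1}"
  have H[measurable]: "?H \<in> sets borel"
  proof -
    have "?H = {u. \<forall>j\<in>UNIV. 0 \<le> u $ j \<and> u $ j < 1}" by auto
    also have "\<dots> \<in> sets borel" by measurable
    finally show ?thesis .
  qed
  have "emeasure lborel (fundamental_cell V) = emeasure (distr lborel borel (\<lambda>x. V *v x)) (fundamental_cell V)"
    by (simp add: distr_lborel_matrix det_V)
  also have "\<dots> = emeasure lborel ?H"
    by (subst emeasure_distr) (auto intro!: arg_cong[of _ _ "emeasure lborel"] simp: in_cell_iff)
  also have "\<dots> = 1"
  proof (rule antisym)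
    define e1 where "e1 = (\<chi> i::'d. (1 :: real))"
    have e1: "e1 \<bullet> b = 1" if "b \<in> Basis" for b using that by (auto simp: e1_def Basis_vec_def inner_axis)
    have "emeasure lborel ?H \<le> emeasure lborel (cbox 0 e1)"
      by (rule emeasure_mono) (auto simp: mem_box_cart less_imp_le e1_def)
    then show "emeasure lborel ?H \<le> 1" by (simp add: emeasure_lborel_cbox_eq e1)
    have "emeasure lborel (box 0 e1) \<le> emeasure lborel ?H"
      by (rule emeasure_mono) (auto simp: mem_box_cart less_imp_le e1_def)
    then show "1 \<le> emeasure lborel ?H" by (simp add: emeasure_lborel_box_eq e1)
  qed
  finally show ?thesis .
qed

text \<open>Reduction modulo the lattice singles out the one translate that contains
  \<open>x\<close>. The enumeration is left open because \<open>lv\<close> and its negative are both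
  needed.\<close>

lemma sum_indicator_translates:
  assumes u: "bij_betw u UNIV (lattice V)"
  shows "(\<Sum>n::nat. indicator (fundamental_cell V) (x - u n) :: ennreal) = 1"
proof -
  have u_in: "u n \<in> lattice V" for n using u by (auto simp: bij_betw_def)
  have "x - torus_proj V x \<in> range u" using diff_torus_proj[of x] u by (simp add: bij_betw_def)
  then obtain m where m: "u m = x - torus_proj V x" by force
  have "x - u n \<in> fundamental_cell V \<longleftrightarrow> n = m" for n
  proof
    assume "x - u n \<in> fundamental_cell V"
    then have "torus_proj V (x - u n) = x - u n" by (rule torus_proj_cell)
    moreover have "torus_proj V (x - u n) = torus_proj V x" unfolding torus_proj_cong by (simp add: lattice_minus u_in)
    ultimately have "u n = u m" using m by simp
    then show "n = m" using u by (auto simp: bij_betw_def dest: injD)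
  qed (use m torus_proj_in_cell in auto)
  then have "(\<Sum>n. indicator (fundamental_cell V) (x - u n) :: ennreal) = (\<Sum>n\<in>{m}. indicator (fundamental_cell V) (x - u n))"
    by (intro suminf_finite) (auto simp: indicator_def)
  then show ?thesis using m torus_proj_in_cell by simp
qed

text \<open>Unfolding: the partition of unity by translated cells is inserted, and each piece is
  moved back to the cell by translation invariance.\<close>

lemma tiling_nn_integral:
  fixes f :: "real^'d \<Rightarrow> ennreal"
  assumes [measurable]: "f \<in> borel_measurable borel"
  shows "(\<integral>\<^sup>+x. f x \<partial>lborel) = (\<Sum>n. \<integral>\<^sup>+x. f (x + lv n) * indicator (fundamental_cell V) x \<partial>lborel)"
proof -
  have "(\<integral>\<^sup>+x. f x \<partial>lborel) = (\<integral>\<^sup>+x. (\<Sum>n. f x * indicator (fundamental_cell V) (x - lv n)) \<partial>lborel)"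
    by (simp add: ennreal_suminf_cmult sum_indicator_translates[OF bij_lv])
  also have "\<dots> = (\<Sum>n. \<integral>\<^sup>+x. f x * indicator (fundamental_cell V) (x - lv n) \<partial>lborel)"
    by (rule nn_integral_suminf) measurable
  also have "\<dots> = (\<Sum>n. \<integral>\<^sup>+x. f (x + lv n) * indicator (fundamental_cell V) x \<partial>lborel)"
  proof (rule suminf_cong)
    fix n
    have "(\<integral>\<^sup>+x. f x * indicator (fundamental_cell V) (x - lv n) \<partial>lborel) =
      (\<integral>\<^sup>+x. f x * indicator (fundamental_cell V) (x - lv n) \<partial>distr lborel borel ((+) (lv n)))"
      by (simp add: lborel_distr_plus)
    also have "\<dots> = (\<integral>\<^sup>+x. f (x + lv n) * indicator (fundamental_cell V) x \<partial>lborel)"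
      by (subst nn_integral_distr) (auto simp: add.commute)
    finally show "(\<integral>\<^sup>+x. f x * indicator (fundamental_cell V) (x - lv n) \<partial>lborel) =
      (\<integral>\<^sup>+x. f (x + lv n) * indicator (fundamental_cell V) x \<partial>lborel)" .
  qed
  finally show ?thesis .
qed

lemma bounded_cell: obtains R where "R > 0" "\<And>x. x \<in> fundamental_cell V \<Longrightarrow> norm x \<le> R"
proof -
  have "bounded ((\<lambda>u. V *v u) ` cbox 0 (\<chi> i. 1))"
    by (intro bounded_linear_image[OF bounded_cbox] matrix_vector_mul_bounded_linear)
  moreover have "fundamental_cell V \<subseteq> (\<lambda>u. V *v u) ` cbox 0 (\<chi> i. 1)"
  proof
    fix x assume "x \<in> fundamental_cell V"
    then have "coord x \<in> cbox 0 (\<chi> i. 1)" by (auto simp: in_cell_iff mem_box_cart less_imp_le)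
    then show "x \<in> (\<lambda>u. V *v u) ` cbox 0 (\<chi> i. 1)" by (metis V_coord imageI)
  qed
  ultimately show thesis using that by (metis bounded_pos bounded_subset)
qed

text \<open>
  A term is compared with the integral of a wider Gaussian over the translated cell, so that the sum is
  bounded by a Gaussian integral over the whole space, uniformly in \<open>x\<close>.
\<close>

lemma gaussian_lattice_sum:
  assumes t: "t > 0"
  obtains C where "\<And>x. summable (\<lambda>n. exp (- t * (norm (x + lv n))\<^sup>2))" "\<And>x. (\<Sum>n. exp (- t * (norm (x + lv n))\<^sup>2)) \<le> C"
proof -
  obtain R where R: "R > 0" "\<And>x. x \<in> fundamental_cell V \<Longrightarrow> norm x \<le> R" by (rule bounded_cell) blast
  define G where "G = (\<integral>\<^sup>+z. ennreal (exp (- (t/2) * (norm (z :: real^'d))\<^sup>2)) \<partial>lborel)"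
  have "G < \<infinity>"
    using gaussian_fourier(2)[of "t/2" "0 :: real^'d"] t unfolding G_def integrable_iff_bounded by simp
  define C where "C = exp (t * R\<^sup>2) * enn2real G"
  have bound: "(\<Sum>n. ennreal (exp (- t * (norm (x + lv n))\<^sup>2))) \<le> ennreal C" for x
  proof -
    have "(\<Sum>n. ennreal (exp (- t * (norm (x + lv n))\<^sup>2)))
      \<le> (\<Sum>n. \<integral>\<^sup>+y. (ennreal (exp (t * R\<^sup>2)) * ennreal (exp (- (t/2) * (norm (x + (y + lv n)))\<^sup>2))) * indicator (fundamental_cell V) y \<partial>lborel)"
    proof (rule suminf_le)
      fix n
      have "ennreal (exp (- t * (norm (x + lv n))\<^sup>2)) = (\<integral>\<^sup>+y. ennreal (exp (- t * (norm (x + lv n))\<^sup>2)) * indicator (fundamental_cell V) y \<partial>lborel)"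
        by (simp add: nn_integral_cmult_indicator emeasure_cell)
      also have "\<dots> \<le> (\<integral>\<^sup>+y. (ennreal (exp (t * R\<^sup>2)) * ennreal (exp (- (t/2) * (norm (x + (y + lv n)))\<^sup>2))) * indicator (fundamental_cell V) y \<partial>lborel)"
      proof (rule nn_integral_mono)
        fix y
        show "ennreal (exp (- t * (norm (x + lv n))\<^sup>2)) * indicator (fundamental_cell V) y
          \<le> (ennreal (exp (t * R\<^sup>2)) * ennreal (exp (- (t/2) * (norm (x + (y + lv n)))\<^sup>2))) * indicator (fundamental_cell V) y"
        proof (cases "y \<in> fundamental_cell V")
          case True
          \<comment> \<open>Moving the center by a point of the cell costs half of the exponent and
            the factor \<open>exp (t * R\<^sup>2)\<close>.\<close>
          have "(norm (x + (y + lv n)))\<^sup>2 \<le> 2 * (norm (x + lv n))\<^sup>2 + 2 * (norm y)\<^sup>2"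
            using norm_add_sq_le[of "x + lv n" y] by (simp add: ac_simps)
          also have "(norm y)\<^sup>2 \<le> R\<^sup>2" using R(2)[OF True] by (intro power_mono) auto
          finally have "t/2 * (norm (x + (y + lv n)))\<^sup>2 \<le> t/2 * (2 * (norm (x + lv n))\<^sup>2 + 2 * R\<^sup>2)" using t by (intro mult_left_mono) auto
          then have "exp (- t * (norm (x + lv n))\<^sup>2) \<le> exp (t * R\<^sup>2) * exp (- (t/2) * (norm (x + (y + lv n)))\<^sup>2)"
            by (simp add: exp_add[symmetric] algebra_simps)
          then show ?thesis using True by (simp add: ennreal_mult[symmetric])
        qed simp
      qed
      finally show "ennreal (exp (- t * (norm (x + lv n))\<^sup>2)) \<le> (\<integral>\<^sup>+y. (ennreal (exp (t * R\<^sup>2)) * ennreal (exp (- (t/2) * (norm (x + (y + lv n)))\<^sup>2))) * indicator (fundamental_cell V) y \<partial>lborel)" .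
    qed auto
    also have "\<dots> = (\<integral>\<^sup>+y. ennreal (exp (t * R\<^sup>2)) * ennreal (exp (- (t/2) * (norm (x + y))\<^sup>2)) \<partial>lborel)"
      by (rule tiling_nn_integral[symmetric]) measurable
    also have "\<dots> = ennreal (exp (t * R\<^sup>2)) * (\<integral>\<^sup>+y. ennreal (exp (- (t/2) * (norm (x + y))\<^sup>2)) \<partial>lborel)"
      by (rule nn_integral_cmult) measurable
    also have "(\<integral>\<^sup>+y. ennreal (exp (- (t/2) * (norm (x + y))\<^sup>2)) \<partial>lborel) = (\<integral>\<^sup>+y. ennreal (exp (- (t/2) * (norm y)\<^sup>2)) \<partial>distr lborel borel ((+) x))"
      by (subst nn_integral_distr) auto
    also have "\<dots> = G" by (simp add: lborel_distr_plus G_def)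
    also have "ennreal (exp (t * R\<^sup>2)) * G = ennreal C"
      using \<open>G < \<infinity>\<close> by (cases G) (auto simp: C_def ennreal_mult)
    finally show ?thesis .
  qed
  have s: "summable (\<lambda>n. exp (- t * (norm (x + lv n))\<^sup>2))" for x
    by (rule summable_suminf_not_top) (use bound[of x] in \<open>auto simp: top_unique\<close>)
  show thesis
  proof (rule that[OF s])
    fix x
    have C0: "0 \<le> C" by (simp add: C_def)
    have "ennreal (\<Sum>n. exp (- t * (norm (x + lv n))\<^sup>2)) \<le> ennreal C"
      using bound[of x] by (subst suminf_ennreal2[symmetric, OF _ s]) auto
    then show "(\<Sum>n. exp (- t * (norm (x + lv n))\<^sup>2)) \<le> C" using C0 by (simp add: ennreal_le_iff)
  qed
qed

lemma summable_gaussian: "t > 0 \<Longrightarrow> summable (\<lambda>n. exp (- t * (norm (x + lv n))\<^sup>2))"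
  by (rule gaussian_lattice_sum) auto

text \<open>Terms of the convergent Gaussian sum tend to 0, so only finitely many are as large as
  \<open>exp (- (R\<^sup>2))\<close>.\<close>

lemma finite_lattice_ball: "finite {v \<in> lattice V. norm (x + v) \<le> R}"
proof -
  have "(\<lambda>n. exp (- 1 * (norm (x + lv n))\<^sup>2)) \<longlonglongrightarrow> 0"
    by (rule summable_LIMSEQ_zero[OF summable_gaussian]) simp
  then have "\<forall>\<^sub>F n in sequentially. exp (- 1 * (norm (x + lv n))\<^sup>2) < exp (- (R\<^sup>2))"
    by (rule order_tendstoD(2)) simp
  then obtain N where N: "\<And>n. n \<ge> N \<Longrightarrow> R\<^sup>2 < (norm (x + lv n))\<^sup>2" unfolding eventually_sequentially by auto
  have "{v \<in> lattice V. norm (x + v) \<le> R} \<subseteq> lv ` {..<N}"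
  proof
    fix v assume v: "v \<in> {v \<in> lattice V. norm (x + v) \<le> R}"
    then obtain n where n: "v = lv n" using bij_lv by (auto simp: bij_betw_def image_iff)
    have "(norm (x + v))\<^sup>2 \<le> R\<^sup>2" using v by (intro power_mono) auto
    then have "n < N" using N[of n] n by (meson not_less)
    then show "v \<in> lv ` {..<N}" using n by blast
  qed
  then show ?thesis by (rule finite_subset) simp
qed


section \<open>Dual lattice and trigonometric polynomials\<close>

text \<open>Its columns are the dual basis. Thus the dual lattice is again unimodular, and
  enumeration and Gaussian sums carry over to it.\<close>

definition dualV :: "real^'d^'d" where "dualV = transpose (matrix_inv V)"

lemma dualV: "unimodular_lattice dualV"
proof
  have "det (V ** matrix_inv V) = 1" by (simp add: V_inv)
  then show "det dualV = 1" by (simp add: dualV_def det_mul det_V)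
qed

lemma inner_V: "w \<bullet> (V *v k) = (transpose V *v w) \<bullet> k"
  by (simp add: dot_lmul_matrix transpose_matrix_vector)

lemma dual_lattice_eq: "dual_lattice V = lattice dualV"
proof -
  have inv: "transpose V *v (dualV *v k) = k" "dualV *v (transpose V *v k) = k" for k
    by (simp_all add: dualV_def matrix_vector_mul_assoc matrix_transpose_mul[symmetric] V_inv transpose_mat del: transpose_matrix_vector)
  show ?thesis
  proof (intro set_eqI iffI)
    fix w assume w: "w \<in> dual_lattice V"
    have "(transpose V *v w) $ j \<in> \<int>" for j
    proof -
      have "V *v axis j 1 \<in> lattice V" unfolding lattice_def by (intro CollectI exI[of _ "axis j 1"]) (simp add: axis_def)
      then have "w \<bullet> (V *v axis j 1) \<in> \<int>" using w by (simp add: dual_lattice_def)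
      then show ?thesis by (simp add: inner_V inner_axis)
    qed
    then show "w \<in> lattice dualV" unfolding lattice_def using inv(2)[of w] by (intro CollectI exI[of _ "transpose V *v w"]) simp
  next
    fix w assume "w \<in> lattice dualV"
    then obtain k where k: "w = dualV *v k" "\<And>j. k $ j \<in> \<int>" unfolding lattice_def by blast
    have "w \<bullet> v \<in> \<int>" if v: "v \<in> lattice V" for v
    proof -
      obtain l where l: "v = V *v l" "\<And>j. l $ j \<in> \<int>" using v unfolding lattice_def by blast
      have "w \<bullet> v = k \<bullet> l" unfolding l(1) inner_V k(1) inv ..
      also have "\<dots> \<in> \<int>" unfolding inner_vec_def using k(2) l(2) by (intro Ints_sum) simp
      finally show ?thesis .
    qed
    then show "w \<in> dual_lattice V" by (simp add: dual_lattice_def)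
  qed
qed

definition dw :: "nat \<Rightarrow> real^'d" where "dw = unimodular_lattice.lv dualV"

lemma dw_0 [simp]: "dw 0 = 0" unfolding dw_def by (rule unimodular_lattice.lv_0[OF dualV])

lemma bij_dw: "bij_betw dw UNIV (dual_lattice V)"
  unfolding dw_def dual_lattice_eq by (rule unimodular_lattice.bij_lv[OF dualV])

lemma bij_dw_Suc: "bij_betw (\<lambda>n. dw (Suc n)) UNIV (dual_lattice V - {0})"
  unfolding dw_def dual_lattice_eq by (rule unimodular_lattice.bij_lv_Suc[OF dualV])

lemma dw_in [simp]: "dw n \<in> dual_lattice V" using bij_dw by (auto simp: bij_betw_def)

lemma dual_0 [simp]: "0 \<in> dual_lattice V" by (simp add: dual_lattice_def)

lemma dual_add: "v \<in> dual_lattice V \<Longrightarrow> w \<in> dual_lattice V \<Longrightarrow> v + w \<in> dual_lattice V"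
  and dual_diff: "v \<in> dual_lattice V \<Longrightarrow> w \<in> dual_lattice V \<Longrightarrow> v - w \<in> dual_lattice V"
  and dual_minus: "v \<in> dual_lattice V \<Longrightarrow> - v \<in> dual_lattice V"
  by (simp_all add: dual_lattice_def inner_add_left inner_diff_left)

lemma summable_dual_gaussian: "t > 0 \<Longrightarrow> summable (\<lambda>n. exp (- t * (norm (dw n))\<^sup>2))"
  unfolding dw_def using unimodular_lattice.summable_gaussian[OF dualV, of t 0] by simp

lemma finite_dual_ball: "finite {w \<in> dual_lattice V. norm w \<le> R}"
  using unimodular_lattice.finite_lattice_ball[OF dualV, of 0 R] by (simp add: dual_lattice_eq)

definition lattice_periodic :: "(real^'d \<Rightarrow> 'a) \<Rightarrow> bool" where
  "lattice_periodic f \<longleftrightarrow> (\<forall>x. \<forall>v\<in>lattice V. f (x + v) = f x)"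

lemma lattice_periodicD: "lattice_periodic f \<Longrightarrow> x - y \<in> lattice V \<Longrightarrow> f x = f y"
  unfolding lattice_periodic_def by (metis add.commute diff_add_cancel)

lemma cis_dual_periodic: "w \<in> dual_lattice V \<Longrightarrow> lattice_periodic (\<lambda>x. cis (2 * pi * (w \<bullet> x)))"
  unfolding lattice_periodic_def
proof (intro allI ballI)
  fix x v assume "w \<in> dual_lattice V" "v \<in> lattice V"
  then have "w \<bullet> v \<in> \<int>" by (simp add: dual_lattice_def)
  then have "cis (2 * pi * (w \<bullet> v)) = 1" by (simp add: cis_multiple_2pi)
  then show "cis (2 * pi * (w \<bullet> (x + v))) = cis (2 * pi * (w \<bullet> x))"
    by (simp add: inner_add_right distrib_left cis_mult[symmetric])
qed

text \<open>Products are not among the rules, so a claim that is linear in the function has to be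
  checked on single waves only. Closure under products is proved afterwards.\<close>

inductive trig_poly :: "(real^'d \<Rightarrow> real) \<Rightarrow> bool" where
  cos: "w \<in> dual_lattice V \<Longrightarrow> trig_poly (\<lambda>x. cos (2 * pi * (w \<bullet> x)))"
| sin: "w \<in> dual_lattice V \<Longrightarrow> trig_poly (\<lambda>x. sin (2 * pi * (w \<bullet> x)))"
| add: "trig_poly f \<Longrightarrow> trig_poly g \<Longrightarrow> trig_poly (\<lambda>x. f x + g x)"
| scale: "trig_poly f \<Longrightarrow> trig_poly (\<lambda>x. c * f x)"

lemma trig_poly_const: "trig_poly (\<lambda>x. c)"
  using trig_poly.scale[OF trig_poly.cos[OF dual_0], of c] by simp

lemma trig_poly_diff: "trig_poly f \<Longrightarrow> trig_poly g \<Longrightarrow> trig_poly (\<lambda>x. f x - g x)"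
  using trig_poly.add[OF _ trig_poly.scale[of g "-1"], of f] by simp

lemma trig_poly_sum: "finite I \<Longrightarrow> (\<And>i. i \<in> I \<Longrightarrow> trig_poly (f i)) \<Longrightarrow> trig_poly (\<lambda>x. \<Sum>i\<in>I. f i x)"
  by (induction I rule: finite_induct) (auto intro: trig_poly_const trig_poly.add)

text \<open>Product-to-sum formulas, whose frequencies stay in the dual lattice. There are two
  nested inductions: \<open>base\<close> runs over \<open>g\<close> for a fixed left factor
  \<open>h\<close>, the outer one over \<open>f\<close>.\<close>

lemma trig_poly_mult:
  assumes "trig_poly f" "trig_poly g"
  shows "trig_poly (\<lambda>x. f x * g x)"
proof -
  have base: "trig_poly (\<lambda>x. h x * g x)"
    if h: "\<And>w. w \<in> dual_lattice V \<Longrightarrow> trig_poly (\<lambda>x. h x * cos (2 * pi * (w \<bullet> x)))"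
      "\<And>w. w \<in> dual_lattice V \<Longrightarrow> trig_poly (\<lambda>x. h x * sin (2 * pi * (w \<bullet> x)))" for h
    using assms(2)
  proof induction
    case (add f g)
    then show ?case using trig_poly.add[OF add.IH] by (simp add: distrib_left)
  next
    case (scale f c)
    then show ?case using trig_poly.scale[OF scale.IH, of c] by (simp add: mult.left_commute)
  qed (use h in auto)
  from assms(1) show ?thesis
  proof induction
    case (cos w)
    show ?case
    proof (rule base)
      fix w' assume w': "w' \<in> dual_lattice V"
      have "trig_poly (\<lambda>x. 1/2 * (cos (2 * pi * ((w - w') \<bullet> x)) + cos (2 * pi * ((w + w') \<bullet> x))))"
        by (intro trig_poly.intros dual_add dual_diff cos w')
      then show "trig_poly (\<lambda>x. cos (2 * pi * (w \<bullet> x)) * cos (2 * pi * (w' \<bullet> x)))"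
        by (simp add: cos_times_cos inner_diff_left inner_add_left right_diff_distrib distrib_left add_divide_distrib diff_divide_distrib)
      have "trig_poly (\<lambda>x. 1/2 * (sin (2 * pi * ((w + w') \<bullet> x)) - sin (2 * pi * ((w - w') \<bullet> x))))"
        by (intro trig_poly.intros trig_poly_diff dual_add dual_diff cos w')
      then show "trig_poly (\<lambda>x. cos (2 * pi * (w \<bullet> x)) * sin (2 * pi * (w' \<bullet> x)))"
        by (simp add: cos_times_sin inner_diff_left inner_add_left right_diff_distrib distrib_left add_divide_distrib diff_divide_distrib)
    qed
  next
    case (sin w)
    show ?case
    proof (rule base)
      fix w' assume w': "w' \<in> dual_lattice V"
      have "trig_poly (\<lambda>x. 1/2 * (sin (2 * pi * ((w + w') \<bullet> x)) + sin (2 * pi * ((w - w') \<bullet> x))))"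
        by (intro trig_poly.intros dual_add dual_diff sin w')
      then show "trig_poly (\<lambda>x. sin (2 * pi * (w \<bullet> x)) * cos (2 * pi * (w' \<bullet> x)))"
        by (simp add: sin_times_cos inner_diff_left inner_add_left right_diff_distrib distrib_left add_divide_distrib diff_divide_distrib)
      have "trig_poly (\<lambda>x. 1/2 * (cos (2 * pi * ((w - w') \<bullet> x)) - cos (2 * pi * ((w + w') \<bullet> x))))"
        by (intro trig_poly.intros trig_poly_diff dual_add dual_diff sin w')
      then show "trig_poly (\<lambda>x. sin (2 * pi * (w \<bullet> x)) * sin (2 * pi * (w' \<bullet> x)))"
        by (simp add: sin_times_sin inner_diff_left inner_add_left right_diff_distrib distrib_left add_divide_distrib diff_divide_distrib)
    qed
  next
    case (add f h)
    then show ?case using trig_poly.add[OF add.IH] by (simp add: distrib_right)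
  next
    case (scale f c)
    then show ?case using trig_poly.scale[OF scale.IH, of c] by (simp add: mult.assoc)
  qed
qed

text \<open>The torus as a product of circles. The map separates cosets and has compact image, so
  results about compact subsets of Euclidean space become available for the quotient.\<close>

definition torus_embed :: "real^'d \<Rightarrow> complex^'d" where
  "torus_embed x = (\<chi> j. cis (2 * pi * (coord x $ j)))"

lemma continuous_torus_embed [continuous_intros]:
  "continuous_on S f \<Longrightarrow> continuous_on S (\<lambda>x. torus_embed (f x))"
  unfolding torus_embed_def by (intro continuous_intros continuous_on_vec_lambda)

lemma torus_embed_eq_iff: "torus_embed x = torus_embed y \<longleftrightarrow> x - y \<in> lattice V"
proof -
  have "cis (2 * pi * a) = cis (2 * pi * b) \<longleftrightarrow> a - b \<in> \<int>" for a b :: real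
  proof
    assume "cis (2 * pi * a) = cis (2 * pi * b)"
    then have "sin (2 * pi * a) = sin (2 * pi * b) \<and> cos (2 * pi * a) = cos (2 * pi * b)" by (simp add: complex_eq_iff)
    then obtain n :: int where "2 * pi * a = 2 * pi * b + 2 * pi * n" by (auto simp: sin_cos_eq_iff)
    then have "2 * pi * (a - b) = 2 * pi * of_int n" by (simp add: algebra_simps)
    then have "a - b = of_int n" by simp
    then show "a - b \<in> \<int>" by simp
  next
    assume "a - b \<in> \<int>"
    then have "cis (2 * pi * (a - b)) = 1" by (rule cis_multiple_2pi)
    then show "cis (2 * pi * a) = cis (2 * pi * b)"
      by (simp add: right_diff_distrib cis_divide[symmetric] divide_eq_1_iff)
  qed
  then show ?thesis by (simp add: torus_embed_def vec_eq_iff in_lattice_iff coord_diff)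
qed

lemma torus_embed_proj [simp]: "torus_embed (torus_proj V x) = torus_embed x"
  unfolding torus_embed_eq_iff using lattice_minus[OF diff_torus_proj[of x]] by simp

lemma inj_on_torus_embed: "inj_on torus_embed (fundamental_cell V)"
proof (rule inj_onI)
  fix x y assume "x \<in> fundamental_cell V" "y \<in> fundamental_cell V" "torus_embed x = torus_embed y"
  then show "x = y" by (metis torus_embed_eq_iff torus_proj_cong torus_proj_cell)
qed

definition closed_cell :: "(real^'d) set" where "closed_cell = (\<lambda>u. V *v u) ` cbox 0 (\<chi> i. 1)"

lemma compact_closed_cell: "compact closed_cell"
  unfolding closed_cell_def
  by (intro compact_continuous_image linear_continuous_on matrix_vector_mul_bounded_linear compact_cbox)

lemma cell_subset_closed_cell: "fundamental_cell V \<subseteq> closed_cell"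
proof
  fix x assume "x \<in> fundamental_cell V"
  then have "coord x \<in> cbox 0 (\<chi> i. 1)" by (auto simp: in_cell_iff mem_box_cart less_imp_le)
  then show "x \<in> closed_cell" unfolding closed_cell_def by (metis V_coord imageI)
qed

lemma range_torus_embed: "torus_embed ` closed_cell = range torus_embed" "torus_embed ` fundamental_cell V = range torus_embed"
proof -
  have "range torus_embed \<subseteq> torus_embed ` fundamental_cell V"
    using torus_embed_proj torus_proj_in_cell by (metis image_subsetI imageI)
  then show "torus_embed ` closed_cell = range torus_embed" "torus_embed ` fundamental_cell V = range torus_embed"
    using cell_subset_closed_cell by blast+
qed

lemma compact_range_torus_embed: "compact (range torus_embed)"
  unfolding range_torus_embed(1)[symmetric]
  by (intro compact_continuous_image continuous_intros compact_closed_cell)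

text \<open>By invariance the image is already attained on the part of \<open>C\<close> in the
  closed cell, which is compact. This is what makes the embedding compatible with the quotient
  topology.\<close>

lemma closed_torus_embed_image:
  assumes "closed C" "\<And>x v. x \<in> C \<Longrightarrow> v \<in> lattice V \<Longrightarrow> x + v \<in> C"
  shows "closed (torus_embed ` C)"
proof -
  have "torus_embed ` C = torus_embed ` (closed_cell \<inter> C)"
  proof (intro equalityI image_subsetI)
    fix x assume "x \<in> C"
    have "torus_proj V x = x + (- (x - torus_proj V x))" by simp
    also have "\<dots> \<in> C" using assms(2)[OF \<open>x \<in> C\<close> lattice_minus[OF diff_torus_proj]] .
    finally have "torus_proj V x \<in> closed_cell \<inter> C" using torus_proj_in_cell cell_subset_closed_cell by blast
    then show "torus_embed x \<in> torus_embed ` (closed_cell \<inter> C)" using torus_embed_proj by (metis imageI)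
  qed auto
  moreover have "compact (torus_embed ` (closed_cell \<inter> C))"
    by (intro compact_continuous_image continuous_intros compact_Int_closed compact_closed_cell assms)
  ultimately show ?thesis by (simp add: compact_imp_closed)
qed

text \<open>The factor on the image is well defined by periodicity and continuous because saturated
  closed sets have closed images; Tietze extends it to the whole space.\<close>

lemma periodic_factors:
  fixes g :: "real^'d \<Rightarrow> 'b::euclidean_space"
  assumes g: "continuous_on UNIV g" "lattice_periodic g"
  obtains h :: "complex^'d \<Rightarrow> 'b" where "continuous_on UNIV h" "\<And>x. h (torus_embed x) = g x"
proof -
  define h0 where "h0 z = g (SOME x. torus_embed x = z)" for z
  have h0: "h0 (torus_embed x) = g x" for x
  proof -
    have "torus_embed (SOME y. torus_embed y = torus_embed x) = torus_embed x" by (rule someI) simp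
    then show ?thesis unfolding h0_def torus_embed_eq_iff by (rule lattice_periodicD[OF g(2)])
  qed
  have "continuous_on (range torus_embed) h0"
    unfolding continuous_on_closed_invariant
  proof (intro allI impI)
    fix B :: "'b set" assume B: "closed B"
    show "\<exists>A. closed A \<and> A \<inter> range torus_embed = h0 -` B \<inter> range torus_embed"
    proof (intro exI conjI)
      show "closed (torus_embed ` (g -` B))"
        by (rule closed_torus_embed_image) (use B g in \<open>auto simp: lattice_periodic_def continuous_on_eq_continuous_at intro: continuous_closed_vimage\<close>)
      show "torus_embed ` (g -` B) \<inter> range torus_embed = h0 -` B \<inter> range torus_embed" using h0 by auto
    qed
  qed
  then obtain h where "continuous_on UNIV h" "\<And>z. z \<in> range torus_embed \<Longrightarrow> h z = h0 z"
    using Tietze_unbounded[of "range torus_embed" h0 UNIV] compact_imp_closed[OF compact_range_torus_embed] by auto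
  then show thesis using that h0 by (metis rangeI)
qed

text \<open>Stone-Weierstrass on the image of the torus. The rows of \<open>matrix_inv V\<close> lie
  in the dual lattice, so the real coordinates of \<open>torus_embed x\<close> are single cosines
  and sines, and polynomials in them are trigonometric polynomials.\<close>

theorem trig_poly_dense:
  assumes g: "continuous_on UNIV g" "lattice_periodic g" and e: "e > 0"
  obtains p where "trig_poly p" "\<And>x. \<bar>g x - p x\<bar> < e"
proof -
  obtain h :: "complex^'d \<Rightarrow> real" where h: "continuous_on UNIV h" "\<And>x. h (torus_embed x) = g x"
    using periodic_factors[OF g] by blast
  obtain q where q: "real_polynomial_function q" "\<And>z. z \<in> range torus_embed \<Longrightarrow> \<bar>h z - q z\<bar> < e"
    using Stone_Weierstrass_real_polynomial_function[OF compact_range_torus_embed continuous_on_subset[OF h(1) subset_UNIV] e] by blast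
  from q(1) have "trig_poly (\<lambda>x. q (torus_embed x))"
  proof induction
    case (linear f)
    have row: "matrix_inv V $ j \<in> dual_lattice V" for j
      by (auto simp: dual_lattice_def in_lattice_iff coord_def matrix_vector_mul_component)
    have "trig_poly (\<lambda>x. torus_embed x \<bullet> b)" if b': "b \<in> Basis" for b
    proof -
      obtain j u where b: "b = axis j u" "u \<in> Basis" using b' unfolding Basis_vec_def by blast
      have c: "torus_embed x \<bullet> b = cis (2 * pi * (matrix_inv V $ j \<bullet> x)) \<bullet> u" for x
        by (simp add: b inner_axis torus_embed_def coord_def matrix_vector_mul_component)
      show ?thesis using b(2) trig_poly.cos[OF row[of j]] trig_poly.sin[OF row[of j]]
        unfolding c by (auto simp: Basis_complex_def inner_complex_def)
    qed
    then have "trig_poly (\<lambda>x. \<Sum>b\<in>Basis. f b * (torus_embed x \<bullet> b))"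
      by (intro trig_poly_sum trig_poly.scale) auto
    moreover have "(\<Sum>b\<in>Basis. f b * (z \<bullet> b)) = f z" for z
    proof -
      interpret bounded_linear f by fact
      have "f z = f (\<Sum>b\<in>Basis. (z \<bullet> b) *\<^sub>R b)" by (simp add: euclidean_representation)
      then show ?thesis by (simp add: sum scale mult.commute[of "z \<bullet> _"])
    qed
    ultimately show ?case by simp
  qed (auto intro: trig_poly_const trig_poly.add trig_poly_mult)
  moreover have "\<bar>g x - q (torus_embed x)\<bar> < e" for x using q(2)[of "torus_embed x"] h(2) by simp
  ultimately show thesis by (rule that)
qed


section \<open>Poisson summation\<close>

definition theta :: "real \<Rightarrow> real^'d \<Rightarrow> real" where
  "theta t x = (\<Sum>n. exp (- t * (norm (x + lv n))\<^sup>2))"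

lemma has_sum_theta:
  assumes "t > 0"
  shows "((\<lambda>v. exp (- t * (norm (x + v))\<^sup>2)) has_sum theta t x) (lattice V)"
proof -
  have "((\<lambda>n. exp (- t * (norm (x + lv n))\<^sup>2)) has_sum theta t x) UNIV"
    unfolding theta_def
    by (rule sums_nonneg_imp_has_sum) (use summable_sums[OF summable_gaussian[OF assms, of x]] in auto)
  then show ?thesis using has_sum_reindex_bij_betw[OF bij_lv] by blast
qed

lemma theta_pos: "t > 0 \<Longrightarrow> 0 < theta t x"
  unfolding theta_def by (rule suminf_pos[OF summable_gaussian]) auto

lemma theta_periodic:
  assumes "t > 0"
  shows "lattice_periodic (theta t)"
  unfolding lattice_periodic_def
proof (intro allI ballI)
  fix x v assume v: "v \<in> lattice V"
  have "bij_betw (\<lambda>u. v + u) (lattice V) (lattice V)"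
    by (rule bij_betw_byWitness[where f'="\<lambda>u. u - v"]) (use v lattice_add lattice_diff in auto)
  from has_sum_reindex_bij_betw[OF this, of "\<lambda>u. exp (- t * (norm (x + u))\<^sup>2)" "theta t x"] has_sum_theta[OF assms, of x]
  have "((\<lambda>u. exp (- t * (norm (x + v + u))\<^sup>2)) has_sum theta t x) (lattice V)" by (simp add: add.assoc)
  then show "theta t (x + v) = theta t x" using has_sum_theta[OF assms, of "x + v"] has_sum_unique by blast
qed

lemma theta_bounded: assumes "t > 0" obtains C where "\<And>x. theta t x \<le> C"
  using gaussian_lattice_sum[OF assms] unfolding theta_def by metis

lemma theta_continuous:
  assumes t: "t > 0"
  shows "continuous_on UNIV (theta t)"
proof -
  have "continuous_on (ball 0 r) (theta t)" for r
  proof -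
    have "uniform_limit (ball 0 r) (\<lambda>n x. \<Sum>i<n. exp (- t * (norm (x + lv i))\<^sup>2)) (theta t) sequentially"
      unfolding theta_def[abs_def]
    proof (rule Weierstrass_m_test)
      fix n x assume x: "x \<in> ball (0 :: real^'d) r"
      \<comment> \<open>On a ball the dependence on \<open>x\<close> is absorbed into a constant,
        again at the price of half the exponent.\<close>
      have "(norm (lv n))\<^sup>2 \<le> 2 * (norm (x + lv n))\<^sup>2 + 2 * (norm x)\<^sup>2" using norm_add_sq_le[of "x + lv n" "- x"] by simp
      moreover have "(norm x)\<^sup>2 \<le> r\<^sup>2" using x by (intro power_mono) auto
      ultimately have "(norm (lv n))\<^sup>2 / 2 - r\<^sup>2 \<le> (norm (x + lv n))\<^sup>2" by simp
      then have "t * ((norm (lv n))\<^sup>2 / 2 - r\<^sup>2) \<le> t * (norm (x + lv n))\<^sup>2" using t by (intro mult_left_mono) auto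
      then show "norm (exp (- t * (norm (x + lv n))\<^sup>2)) \<le> exp (t * r\<^sup>2) * exp (- (t/2) * (norm (0 + lv n))\<^sup>2)"
        by (simp add: exp_add[symmetric] algebra_simps)
    next
      show "summable (\<lambda>n. exp (t * r\<^sup>2) * exp (- (t/2) * (norm (0 + lv n))\<^sup>2))"
        using t by (intro summable_mult summable_gaussian) simp
    qed
    then show ?thesis by (rule uniform_limit_theorem[rotated]) (auto intro!: always_eventually continuous_intros)
  qed
  then have "continuous_on (\<Union>r\<in>UNIV. ball 0 r) (theta t)" by (intro continuous_on_open_UN) auto
  moreover have "(\<Union>r\<in>UNIV. ball (0::real^'d) r) = UNIV" using gt_ex by (auto simp: set_eq_iff)
  ultimately show ?thesis by simp
qed

lemma theta_measurable [measurable]: "t > 0 \<Longrightarrow> theta t \<in> borel_measurable borel"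
  by (rule borel_measurable_continuous_onI[OF theta_continuous])

lemma dual_weight_eq: "dual_weight (w :: real^'d) t = dual_weight (0 :: real^'d) t * exp (- (pi\<^sup>2 / t) * (norm w)\<^sup>2)"
  by (simp add: dual_weight_def)

lemma dual_weight_nonneg: "0 \<le> dual_weight w t"
  by (simp add: dual_weight_def)

lemma summable_dual_weight: "t > 0 \<Longrightarrow> summable (\<lambda>n. dual_weight (dw n) t)"
  unfolding dual_weight_eq[of "dw _"] by (intro summable_mult summable_dual_gaussian) simp

text \<open>Cosines suffice: \<open>w\<close> and \<open>- w\<close> have the same weight, so the
  sines cancel.\<close>

definition dual_theta :: "real \<Rightarrow> real^'d \<Rightarrow> real" where
  "dual_theta t x = (\<Sum>n. dual_weight (dw n) t * cos (2 * pi * (dw n \<bullet> x)))"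

lemma dual_theta_term_bound: "norm (dual_weight (dw n) t * cos y) \<le> dual_weight (dw n) t"
  using mult_left_mono[OF abs_cos_le_one[of y] dual_weight_nonneg[of "dw n" t]] dual_weight_nonneg[of "dw n" t]
  by (simp add: abs_mult)

lemma dual_theta_continuous: "t > 0 \<Longrightarrow> continuous_on UNIV (dual_theta t)"
proof -
  assume t: "t > 0"
  have "uniform_limit UNIV (\<lambda>n x. \<Sum>i<n. dual_weight (dw i) t * cos (2 * pi * (dw i \<bullet> x))) (dual_theta t) sequentially"
    unfolding dual_theta_def[abs_def] by (rule Weierstrass_m_test[OF dual_theta_term_bound summable_dual_weight[OF t]])
  then show ?thesis by (rule uniform_limit_theorem[rotated]) (auto intro!: always_eventually continuous_intros)
qed

lemma cos_dual_periodic: "w \<in> dual_lattice V \<Longrightarrow> v \<in> lattice V \<Longrightarrow> cos (2 * pi * (w \<bullet> (x + v))) = cos (2 * pi * (w \<bullet> x))"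
  and sin_dual_periodic: "w \<in> dual_lattice V \<Longrightarrow> v \<in> lattice V \<Longrightarrow> sin (2 * pi * (w \<bullet> (x + v))) = sin (2 * pi * (w \<bullet> x))"
  using cis_dual_periodic[of w] unfolding lattice_periodic_def by (metis cis.simps)+

lemma dual_theta_periodic: "lattice_periodic (dual_theta t)"
  unfolding lattice_periodic_def dual_theta_def by (simp add: cos_dual_periodic)

section \<open>Integration over the fundamental cell\<close>

definition cell_measure :: "(real^'d) measure" where
  "cell_measure = density lborel (indicator (fundamental_cell V))"

lemma sets_cell_measure [simp, measurable_cong]: "sets cell_measure = sets borel"
  and space_cell_measure [simp]: "space cell_measure = UNIV"
  by (simp_all add: cell_measure_def)

lemma prob_space_cell_measure: "prob_space cell_measure"
  by (rule prob_spaceI) (simp add: cell_measure_def emeasure_density emeasure_cell)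

lemma measure_cell_measure_UNIV [simp]: "measure cell_measure UNIV = 1"
  using prob_space.prob_space[OF prob_space_cell_measure] by simp

lemma nn_integral_cell_measure:
  "f \<in> borel_measurable borel \<Longrightarrow> (\<integral>\<^sup>+x. f x \<partial>cell_measure) = (\<integral>\<^sup>+x. f x * indicator (fundamental_cell V) x \<partial>lborel)"
  unfolding cell_measure_def by (subst nn_integral_density) (auto simp: mult.commute)

lemma integrable_cell_measure:
  fixes f :: "real^'d \<Rightarrow> real"
  assumes "f \<in> borel_measurable borel" "\<And>x. \<bar>f x\<bar> \<le> B"
  shows "integrable cell_measure f"
proof -
  interpret prob_space cell_measure by (rule prob_space_cell_measure)
  show ?thesis by (rule integrable_const_bound[of _ B]) (use assms in auto)
qed

text \<open>The shifted cell tiles as well. The integral over it is unfolded into pieces over the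
  original cell, where the indicators of its translates add up to 1.\<close>

lemma nn_integral_cell_shift:
  fixes F :: "real^'d \<Rightarrow> ennreal"
  assumes F[measurable]: "F \<in> borel_measurable borel" and per: "lattice_periodic F"
  shows "(\<integral>\<^sup>+x. F (x + a) \<partial>cell_measure) = (\<integral>\<^sup>+x. F x \<partial>cell_measure)"
proof -
  have "(\<integral>\<^sup>+x. F (x + a) \<partial>cell_measure) = (\<integral>\<^sup>+x. F (x + a) * indicator (fundamental_cell V) x \<partial>lborel)"
    by (rule nn_integral_cell_measure) measurable
  also have "\<dots> = (\<integral>\<^sup>+x. F x * indicator (fundamental_cell V) (x - a) \<partial>distr lborel borel ((+) a))"
    by (subst nn_integral_distr) (auto simp: add.commute)
  also have "\<dots> = (\<integral>\<^sup>+x. F x * indicator (fundamental_cell V) (x - a) \<partial>lborel)" by (simp add: lborel_distr_plus)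
  also have "\<dots> = (\<Sum>n. \<integral>\<^sup>+x. F (x + lv n) * indicator (fundamental_cell V) (x + lv n - a) * indicator (fundamental_cell V) x \<partial>lborel)"
    by (rule tiling_nn_integral) measurable
  also have "\<dots> = (\<integral>\<^sup>+x. (\<Sum>n. F (x + lv n) * indicator (fundamental_cell V) (x + lv n - a) * indicator (fundamental_cell V) x) \<partial>lborel)"
    by (rule nn_integral_suminf[symmetric]) measurable
  also have "\<dots> = (\<integral>\<^sup>+x. F x * indicator (fundamental_cell V) x \<partial>lborel)"
  proof (rule nn_integral_cong)
    fix x
    have "(\<Sum>n. F (x + lv n) * indicator (fundamental_cell V) (x + lv n - a) * indicator (fundamental_cell V) x)
      = (\<Sum>n. (F x * indicator (fundamental_cell V) x) * indicator (fundamental_cell V) ((x - a) + lv n))"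
      using per by (intro suminf_cong) (simp add: lattice_periodic_def algebra_simps)
    then show "(\<Sum>n. F (x + lv n) * indicator (fundamental_cell V) (x + lv n - a) * indicator (fundamental_cell V) x) = F x * indicator (fundamental_cell V) x"
      using sum_indicator_translates[OF bij_neg_lv, of "x - a"] by (simp add: ennreal_suminf_cmult)
  qed
  also have "\<dots> = (\<integral>\<^sup>+x. F x \<partial>cell_measure)" by (rule nn_integral_cell_measure[symmetric]) measurable
  finally show ?thesis .
qed

text \<open>A shift by \<open>a\<close> flips the sign of \<open>f\<close> and preserves the
  integral. The shift lemma concerns nonnegative functions, hence the detour through
  \<open>1 + f\<close>.\<close>

lemma integral_antiperiodic_eq_0:
  fixes f :: "real^'d \<Rightarrow> real"
  assumes f[measurable]: "f \<in> borel_measurable borel" and per: "lattice_periodic f" and b: "\<And>x. \<bar>f x\<bar> \<le> 1"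
    and anti: "\<And>x. f (x + a) = - f x"
  shows "(\<integral>x. f x \<partial>cell_measure) = 0"
proof -
  interpret prob_space cell_measure by (rule prob_space_cell_measure)
  have i: "integrable cell_measure f" by (rule integrable_cell_measure[OF f b])
  have b': "- 1 \<le> f x" "f x \<le> 1" for x using b[of x] by auto
  have "(\<integral>\<^sup>+x. ennreal (1 + f (x + a)) \<partial>cell_measure) = (\<integral>\<^sup>+x. ennreal (1 + f x) \<partial>cell_measure)"
    by (rule nn_integral_cell_shift) (use per in \<open>auto simp: lattice_periodic_def\<close>)
  then have "(\<integral>\<^sup>+x. ennreal (1 - f x) \<partial>cell_measure) = (\<integral>\<^sup>+x. ennreal (1 + f x) \<partial>cell_measure)" by (simp add: anti)
  moreover have "(\<integral>\<^sup>+x. ennreal (1 - f x) \<partial>cell_measure) = ennreal (1 - (\<integral>x. f x \<partial>cell_measure))"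
    using i b' by (subst nn_integral_eq_integral) (auto simp: prob_space)
  moreover have "(\<integral>\<^sup>+x. ennreal (1 + f x) \<partial>cell_measure) = ennreal (1 + (\<integral>x. f x \<partial>cell_measure))"
  proof -
    have "0 \<le> 1 + f x" for x using b'(1)[of x] by linarith
    then show ?thesis using i by (subst nn_integral_eq_integral) auto
  qed
  moreover have "\<bar>\<integral>x. f x \<partial>cell_measure\<bar> \<le> 1"
    using integral_mono[OF integrable_norm[OF i] integrable_const, of 1] b
    by (intro order_trans[OF integral_abs_bound]) (simp add: prob_space)
  ultimately show ?thesis by (auto simp: abs_le_iff)
qed

lemma integral_cos_dual:
  assumes w: "w \<in> dual_lattice V"
  shows "(\<integral>x. cos (2 * pi * (w \<bullet> x)) \<partial>cell_measure) = (if w = 0 then 1 else 0)"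
    and "(\<integral>x. sin (2 * pi * (w \<bullet> x)) \<partial>cell_measure) = 0"
proof -
  interpret prob_space cell_measure by (rule prob_space_cell_measure)
  \<comment> \<open>Half a wavelength: \<open>w \<bullet> a\<close> is 1/2 for nonzero
    \<open>w\<close>, so the phase changes by \<open>pi\<close>.\<close>
  define a where "a = (1 / (2 * (norm w)\<^sup>2)) *\<^sub>R w"
  have a: "2 * pi * (w \<bullet> (x + a)) = 2 * pi * (w \<bullet> x) + pi" if "w \<noteq> 0" for x
    using that by (simp add: a_def inner_add_right distrib_left power2_norm_eq_inner)
  have m: "(\<lambda>x. cos (2 * pi * (w \<bullet> x))) \<in> borel_measurable borel" "(\<lambda>x. sin (2 * pi * (w \<bullet> x))) \<in> borel_measurable borel"
    by (intro borel_measurable_continuous_onI continuous_intros)+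
  show "(\<integral>x. cos (2 * pi * (w \<bullet> x)) \<partial>cell_measure) = (if w = 0 then 1 else 0)"
    using integral_antiperiodic_eq_0[OF m(1), of a] a w
    by (auto simp: prob_space lattice_periodic_def cos_dual_periodic cos_add)
  show "(\<integral>x. sin (2 * pi * (w \<bullet> x)) \<partial>cell_measure) = 0"
    using integral_antiperiodic_eq_0[OF m(2), of a] a w
    by (cases "w = 0") (auto simp: prob_space lattice_periodic_def sin_dual_periodic sin_add)
qed

lemma gaussian_fourier_parts:
  assumes t: "t > 0"
  shows "(\<integral>x. exp (- t * (norm x)\<^sup>2) * cos (2 * pi * (w \<bullet> x)) \<partial>lborel) = dual_weight w t"
    "(\<integral>x. exp (- t * (norm x)\<^sup>2) * sin (2 * pi * (w \<bullet> x)) \<partial>lborel) = 0"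
    "integrable lborel (\<lambda>x::real^'d. exp (- t * (norm x)\<^sup>2) * cos (2 * pi * (w \<bullet> x)))"
    "integrable lborel (\<lambda>x::real^'d. exp (- t * (norm x)\<^sup>2) * sin (2 * pi * (w \<bullet> x)))"
proof -
  note G = gaussian_fourier[OF t, of w]
  show "(\<integral>x. exp (- t * (norm x)\<^sup>2) * cos (2 * pi * (w \<bullet> x)) \<partial>lborel) = dual_weight w t"
    using arg_cong[OF G(1), of Re] integral_Re[OF G(2)] by simp
  show "(\<integral>x. exp (- t * (norm x)\<^sup>2) * sin (2 * pi * (w \<bullet> x)) \<partial>lborel) = 0"
    using arg_cong[OF G(1), of Im] integral_Im[OF G(2)] by simp
  show "integrable lborel (\<lambda>x::real^'d. exp (- t * (norm x)\<^sup>2) * cos (2 * pi * (w \<bullet> x)))"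
    using integrable_Re[OF G(2)] by simp
  show "integrable lborel (\<lambda>x::real^'d. exp (- t * (norm x)\<^sup>2) * sin (2 * pi * (w \<bullet> x)))"
    using integrable_Im[OF G(2)] by simp
qed

text \<open>Unfolding turns the integral of the periodized Gaussian over the cell into one over the
  whole space. The factor \<open>1 + c\<close> is nonnegative, so sum and integral may be
  interchanged without further conditions.\<close>

lemma integral_theta_times:
  assumes t: "t > 0" and c[measurable]: "c \<in> borel_measurable borel" and per: "lattice_periodic c" and b: "\<And>x. \<bar>c x\<bar> \<le> 1"
    and i: "integrable lborel (\<lambda>x. exp (- t * (norm x)\<^sup>2) * c x)"
  shows "(\<integral>x. theta t x * (1 + c x) \<partial>cell_measure) = dual_weight (0::real^'d) t + (\<integral>x. exp (- t * (norm x)\<^sup>2) * c x \<partial>lborel)"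
proof -
  note [measurable] = theta_measurable[OF t]
  obtain C where C: "\<And>x. theta t x \<le> C" using theta_bounded[OF t] by blast
  have th0: "0 \<le> theta t x" for x using theta_pos[OF t, of x] by simp
  have c0: "0 \<le> 1 + c x" "1 + c x \<le> 2" for x using b[of x] by (auto simp: abs_le_iff)
  have i0: "integrable lborel (\<lambda>x::real^'d. exp (- t * (norm x)\<^sup>2))" "integral\<^sup>L lborel (\<lambda>x::real^'d. exp (- t * (norm x)\<^sup>2)) = dual_weight (0::real^'d) t"
    using gaussian_fourier_parts(1,3)[OF t, of 0] by simp_all
  have i1: "integrable lborel (\<lambda>x. exp (- t * (norm x)\<^sup>2) * (1 + c x))"
    using Bochner_Integration.integrable_add[OF i0(1) i] by (simp add: distrib_left)
  have bd: "\<bar>theta t x * (1 + c x)\<bar> \<le> C * 2" for x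
    using mult_mono[OF C[of x] c0(2)[of x] order_trans[OF th0 C[of x]] c0(1)] th0[of x] c0(1)[of x] by (simp add: abs_mult)
  have i2: "integrable cell_measure (\<lambda>x. theta t x * (1 + c x))"
    by (rule integrable_cell_measure[OF _ bd]) measurable
  have "ennreal (\<integral>x. theta t x * (1 + c x) \<partial>cell_measure) = (\<integral>\<^sup>+x. ennreal (theta t x * (1 + c x)) \<partial>cell_measure)"
    by (rule nn_integral_eq_integral[symmetric, OF i2]) (use th0 c0 in auto)
  also have "\<dots> = (\<integral>\<^sup>+x. ennreal (theta t x * (1 + c x)) * indicator (fundamental_cell V) x \<partial>lborel)"
    by (rule nn_integral_cell_measure) measurable
  also have "\<dots> = (\<integral>\<^sup>+x. (\<Sum>n. ennreal (exp (- t * (norm (x + lv n))\<^sup>2) * (1 + c (x + lv n))) * indicator (fundamental_cell V) x) \<partial>lborel)"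
  proof (rule nn_integral_cong)
    fix x
    have cp: "c (x + lv n) = c x" for n using per by (simp add: lattice_periodic_def)
    have "ennreal (theta t x) = (\<Sum>n. ennreal (exp (- t * (norm (x + lv n))\<^sup>2)))"
      unfolding theta_def by (rule suminf_ennreal2[symmetric]) (use summable_gaussian[OF t] in auto)
    then have "ennreal (theta t x * (1 + c x)) * indicator (fundamental_cell V) x =
      (\<Sum>n. ennreal (exp (- t * (norm (x + lv n))\<^sup>2))) * (ennreal (1 + c x) * indicator (fundamental_cell V) x)"
      using th0 c0 by (simp add: ennreal_mult mult.assoc)
    also have "\<dots> = (\<Sum>n. ennreal (exp (- t * (norm (x + lv n))\<^sup>2)) * (ennreal (1 + c x) * indicator (fundamental_cell V) x))"
      by simp
    also have "\<dots> = (\<Sum>n. ennreal (exp (- t * (norm (x + lv n))\<^sup>2) * (1 + c (x + lv n))) * indicator (fundamental_cell V) x)"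
      using c0 by (intro suminf_cong) (simp add: cp ennreal_mult mult.assoc)
    finally show "ennreal (theta t x * (1 + c x)) * indicator (fundamental_cell V) x =
      (\<Sum>n. ennreal (exp (- t * (norm (x + lv n))\<^sup>2) * (1 + c (x + lv n))) * indicator (fundamental_cell V) x)" .
  qed
  also have "\<dots> = (\<Sum>n. \<integral>\<^sup>+x. ennreal (exp (- t * (norm (x + lv n))\<^sup>2) * (1 + c (x + lv n))) * indicator (fundamental_cell V) x \<partial>lborel)"
    by (rule nn_integral_suminf) measurable
  also have "\<dots> = (\<integral>\<^sup>+x. ennreal (exp (- t * (norm x)\<^sup>2) * (1 + c x)) \<partial>lborel)"
    by (rule tiling_nn_integral[symmetric]) measurable
  also have "\<dots> = ennreal (\<integral>x. exp (- t * (norm x)\<^sup>2) * (1 + c x) \<partial>lborel)"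
    by (rule nn_integral_eq_integral[OF i1]) (use c0 in auto)
  finally have "(\<integral>x. theta t x * (1 + c x) \<partial>cell_measure) = (\<integral>x. exp (- t * (norm x)\<^sup>2) * (1 + c x) \<partial>lborel)"
    using th0 c0 by (subst (asm) ennreal_inj) (auto intro!: integral_nonneg_AE)
  also have "\<dots> = dual_weight (0::real^'d) t + (\<integral>x. exp (- t * (norm x)\<^sup>2) * c x \<partial>lborel)"
    using i0 i by (simp add: distrib_left)
  finally show ?thesis .
qed

lemma trig_measurable [measurable]:
  "(\<lambda>x::real^'d. cos (2 * pi * (w \<bullet> x))) \<in> borel_measurable borel" "(\<lambda>x::real^'d. sin (2 * pi * (w \<bullet> x))) \<in> borel_measurable borel"
  by (intro borel_measurable_continuous_onI continuous_intros)+

lemma integral_theta_cos: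
  assumes t: "t > 0" and w: "w \<in> dual_lattice V"
  shows "(\<integral>x. theta t x * cos (2 * pi * (w \<bullet> x)) \<partial>cell_measure) = dual_weight w t"
    and "(\<integral>x. theta t x * sin (2 * pi * (w \<bullet> x)) \<partial>cell_measure) = 0"
proof -
  note [measurable] = theta_measurable[OF t]
  obtain C where C: "\<And>x. theta t x \<le> C" using theta_bounded[OF t] by blast
  have th: "\<bar>theta t x\<bar> \<le> C" for x using theta_pos[OF t, of x] C[of x] by simp
  have i: "integrable cell_measure (\<lambda>x. theta t x * c x)" if [measurable]: "c \<in> borel_measurable borel" and "\<And>x. \<bar>c x\<bar> \<le> 1" for c
  proof (rule integrable_cell_measure)
    show "\<bar>theta t x * c x\<bar> \<le> C * 1" for x
      unfolding abs_mult by (rule mult_mono[OF th that(2)]) (use th[of x] in auto)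
  qed measurable
  have it: "integrable cell_measure (theta t)" by (rule integrable_cell_measure[OF _ th]) measurable
  note g = gaussian_fourier_parts[OF t]
  have c: "(\<integral>x. theta t x \<partial>cell_measure) + (\<integral>x. theta t x * cos (2 * pi * (w \<bullet> x)) \<partial>cell_measure) = dual_weight (0::real^'d) t + dual_weight w t"
    if w: "w \<in> dual_lattice V" for w
    using integral_theta_times[OF t trig_measurable(1) _ _ g(3), of w] cos_dual_periodic[OF w] i[OF trig_measurable(1), of w] it g(1)[of w]
    by (simp add: lattice_periodic_def distrib_left)
  \<comment> \<open>At \<open>w = 0\<close> the cosine is 1 and the identity reads twice the desired
    one.\<close>
  from c[OF dual_0] have 0: "(\<integral>x. theta t x \<partial>cell_measure) = dual_weight (0::real^'d) t" by simp
  show "(\<integral>x. theta t x * cos (2 * pi * (w \<bullet> x)) \<partial>cell_measure) = dual_weight w t" using c[OF w] 0 by simp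
  have "(\<integral>x. theta t x \<partial>cell_measure) + (\<integral>x. theta t x * sin (2 * pi * (w \<bullet> x)) \<partial>cell_measure) = dual_weight (0::real^'d) t"
    using integral_theta_times[OF t trig_measurable(2) _ _ g(4), of w] sin_dual_periodic[OF w] i[OF trig_measurable(2), of w] it g(2)[of w]
    by (simp add: lattice_periodic_def distrib_left)
  then show "(\<integral>x. theta t x * sin (2 * pi * (w \<bullet> x)) \<partial>cell_measure) = 0" using 0 by simp
qed

lemma integral_dual_theta_times:
  assumes t: "t > 0" and [measurable]: "c \<in> borel_measurable borel" and b: "\<And>x. \<bar>c x\<bar> \<le> 1"
  shows "(\<integral>x. dual_theta t x * c x \<partial>cell_measure) = (\<Sum>n. dual_weight (dw n) t * (\<integral>x. cos (2 * pi * (dw n \<bullet> x)) * c x \<partial>cell_measure))"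
proof -
  interpret prob_space cell_measure by (rule prob_space_cell_measure)
  have bd: "\<bar>dual_weight (dw n) t * cos y * c x\<bar> \<le> dual_weight (dw n) t" for n x y
    using mult_mono[OF dual_theta_term_bound[of n t y] b[of x] dual_weight_nonneg] by (simp add: abs_mult)
  have i: "integrable cell_measure (\<lambda>x. dual_weight (dw n) t * cos (2 * pi * (dw n \<bullet> x)) * c x)" for n
    by (rule integrable_cell_measure[OF _ bd]) measurable
  have "(\<integral>x. dual_theta t x * c x \<partial>cell_measure) = (\<integral>x. (\<Sum>n. dual_weight (dw n) t * cos (2 * pi * (dw n \<bullet> x)) * c x) \<partial>cell_measure)"
    unfolding dual_theta_def
    by (intro Bochner_Integration.integral_cong refl suminf_mult2
        summable_comparison_test'[OF summable_dual_weight[OF t] dual_theta_term_bound])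
  also have "\<dots> = (\<Sum>n. \<integral>x. dual_weight (dw n) t * cos (2 * pi * (dw n \<bullet> x)) * c x \<partial>cell_measure)"
  proof (rule integral_suminf[OF i])
    show "AE x in cell_measure. summable (\<lambda>n. norm (dual_weight (dw n) t * cos (2 * pi * (dw n \<bullet> x)) * c x))"
      by (intro AE_I2 summable_comparison_test'[OF summable_dual_weight[OF t], of 0]) (use bd in auto)
    have "(\<integral>x. norm (dual_weight (dw n) t * cos (2 * pi * (dw n \<bullet> x)) * c x) \<partial>cell_measure) \<le> (\<integral>x. dual_weight (dw n) t \<partial>cell_measure)" for n
      by (rule integral_mono) (use i bd in auto)
    then show "summable (\<lambda>n. \<integral>x. norm (dual_weight (dw n) t * cos (2 * pi * (dw n \<bullet> x)) * c x) \<partial>cell_measure)"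
      by (intro summable_comparison_test'[OF summable_dual_weight[OF t], of 0]) simp
  qed
  finally show ?thesis by (simp add: mult.assoc)
qed

lemma integral_dual_theta_cos:
  assumes t: "t > 0" and w: "w \<in> dual_lattice V"
  shows "(\<integral>x. dual_theta t x * cos (2 * pi * (w \<bullet> x)) \<partial>cell_measure) = dual_weight w t"
    and "(\<integral>x. dual_theta t x * sin (2 * pi * (w \<bullet> x)) \<partial>cell_measure) = 0"
proof -
  interpret prob_space cell_measure by (rule prob_space_cell_measure)
  have ic: "integrable cell_measure (\<lambda>x. cos (2 * pi * (u \<bullet> x)))" and isn: "integrable cell_measure (\<lambda>x. sin (2 * pi * (u \<bullet> x)))" for u :: "real^'d"
    by (rule integrable_cell_measure[of _ 1]; simp)+
  \<comment> \<open>A cosine correlates with the frequencies \<open>w\<close> and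
    \<open>- w\<close>, by 1/2 each. For \<open>w = 0\<close> the indices coincide and the halves
    add up to 1.\<close>
  obtain i j where ij: "dw i = w" "dw j = - w"
  proof -
    have "w \<in> range dw" "- w \<in> range dw" using w dual_minus[OF w] bij_dw by (auto simp: bij_betw_def)
    then show thesis using that by force
  qed
  have inj: "dw m = dw n \<longleftrightarrow> m = n" for m n using bij_dw by (auto simp: bij_betw_def dest: injD)
  have cc: "(\<integral>x. cos (2 * pi * (dw n \<bullet> x)) * cos (2 * pi * (w \<bullet> x)) \<partial>cell_measure) = (if n = i then 1/2 else 0) + (if n = j then 1/2 else 0)" for n
  proof -
    have "(\<integral>x. cos (2 * pi * (dw n \<bullet> x)) * cos (2 * pi * (w \<bullet> x)) \<partial>cell_measure) =
      (\<integral>x. (cos (2 * pi * ((dw n - w) \<bullet> x)) + cos (2 * pi * ((dw n + w) \<bullet> x))) / 2 \<partial>cell_measure)"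
      by (intro Bochner_Integration.integral_cong refl) (simp add: cos_times_cos inner_diff_left inner_add_left right_diff_distrib distrib_left)
    also have "\<dots> = ((if dw n - w = 0 then 1 else 0) + (if dw n + w = 0 then 1 else 0)) / 2"
      by (simp add: ic integral_cos_dual dual_add dual_diff w)
    also have "dw n - w = 0 \<longleftrightarrow> n = i" unfolding ij(1)[symmetric] by (simp add: inj)
    also have "dw n + w = 0 \<longleftrightarrow> n = j" using ij(2) inj[of n j] by (simp add: eq_neg_iff_add_eq_0[symmetric])
    finally show ?thesis by (simp add: add_divide_distrib)
  qed
  have cs: "(\<integral>x. cos (2 * pi * (dw n \<bullet> x)) * sin (2 * pi * (w \<bullet> x)) \<partial>cell_measure) = 0" for n
  proof -
    have "(\<integral>x. cos (2 * pi * (dw n \<bullet> x)) * sin (2 * pi * (w \<bullet> x)) \<partial>cell_measure) =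
      (\<integral>x. (sin (2 * pi * ((dw n + w) \<bullet> x)) - sin (2 * pi * ((dw n - w) \<bullet> x))) / 2 \<partial>cell_measure)"
      by (intro Bochner_Integration.integral_cong refl) (simp add: cos_times_sin inner_diff_left inner_add_left right_diff_distrib distrib_left)
    also have "\<dots> = 0" by (simp add: isn integral_cos_dual dual_add dual_diff w)
    finally show ?thesis .
  qed
  have "(\<integral>x. dual_theta t x * cos (2 * pi * (w \<bullet> x)) \<partial>cell_measure) =
      (\<Sum>n. dual_weight (dw n) t * ((if n = i then 1/2 else 0) + (if n = j then 1/2 else 0)))"
    by (subst integral_dual_theta_times[OF t]) (auto simp: cc)
  also have "\<dots> = (\<Sum>n\<in>{i, j}. dual_weight (dw n) t * ((if n = i then 1/2 else 0) + (if n = j then 1/2 else 0)))"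
    by (rule suminf_finite) auto
  also have "\<dots> = dual_weight w t"
    using ij by (cases "i = j") (auto simp: dual_weight_def)
  finally show "(\<integral>x. dual_theta t x * cos (2 * pi * (w \<bullet> x)) \<partial>cell_measure) = dual_weight w t" .
  show "(\<integral>x. dual_theta t x * sin (2 * pi * (w \<bullet> x)) \<partial>cell_measure) = 0"
    by (subst integral_dual_theta_times[OF t]) (auto simp: cs)
qed

lemma periodic_bounded:
  fixes g :: "real^'d \<Rightarrow> real"
  assumes "continuous_on UNIV g" "lattice_periodic g"
  obtains B where "\<And>x. \<bar>g x\<bar> \<le> B"
proof -
  have "bounded (g ` closed_cell)"
    by (intro compact_imp_bounded compact_continuous_image continuous_on_subset[OF assms(1)] compact_closed_cell) simp
  then obtain B where B: "\<And>x. x \<in> closed_cell \<Longrightarrow> \<bar>g x\<bar> \<le> B" unfolding bounded_iff by auto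
  have "\<bar>g x\<bar> \<le> B" for x
    using B[of "torus_proj V x"] lattice_periodicD[OF assms(2) diff_torus_proj[of x]] torus_proj_in_cell cell_subset_closed_cell by auto
  then show thesis by (rule that)
qed

text \<open>Such a function is orthogonal to all trigonometric polynomials. Approximating one factor
  of its square uniformly shows that the square integrates to 0, so it vanishes almost everywhere on
  the cell.\<close>

lemma periodic_eq_0_if_coeffs_0:
  fixes g :: "real^'d \<Rightarrow> real"
  assumes g: "continuous_on UNIV g" "lattice_periodic g"
    and z: "\<And>w. w \<in> dual_lattice V \<Longrightarrow> (\<integral>x. g x * cos (2 * pi * (w \<bullet> x)) \<partial>cell_measure) = 0"
      "\<And>w. w \<in> dual_lattice V \<Longrightarrow> (\<integral>x. g x * sin (2 * pi * (w \<bullet> x)) \<partial>cell_measure) = 0"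
  shows "g x = 0"
proof -
  interpret prob_space cell_measure by (rule prob_space_cell_measure)
  have gm[measurable]: "g \<in> borel_measurable borel" by (rule borel_measurable_continuous_onI[OF g(1)])
  obtain B where B: "\<And>x. \<bar>g x\<bar> \<le> B" using periodic_bounded[OF g] by blast
  have B0: "0 \<le> B" using B[of 0] by linarith
  have trig: "p \<in> borel_measurable borel \<and> (\<exists>C. \<forall>x. \<bar>p x\<bar> \<le> C) \<and> (\<integral>x. g x * p x \<partial>cell_measure) = 0" if "trig_poly p" for p
    using that
  proof induction
    case (add p q)
    then obtain C D where CD: "\<And>x. \<bar>p x\<bar> \<le> C" "\<And>x. \<bar>q x\<bar> \<le> D" by blast
    have [measurable]: "p \<in> borel_measurable borel" "q \<in> borel_measurable borel" using add.IH by blast+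
    have "integrable cell_measure (\<lambda>x. g x * p x)"
      by (rule integrable_cell_measure[of _ "B * C"]) (use B CD B0 in \<open>auto intro!: mult_mono simp: abs_mult\<close>)
    moreover have "integrable cell_measure (\<lambda>x. g x * q x)"
      by (rule integrable_cell_measure[of _ "B * D"]) (use B CD B0 in \<open>auto intro!: mult_mono simp: abs_mult\<close>)
    moreover have "\<bar>p x + q x\<bar> \<le> C + D" for x using CD[of x] by linarith
    ultimately show ?case using add.IH by (auto simp: distrib_left)
  next
    case (scale p c)
    then obtain C where C: "\<And>x. \<bar>p x\<bar> \<le> C" by blast
    have "\<bar>c * p x\<bar> \<le> \<bar>c\<bar> * C" for x using mult_left_mono[OF C[of x], of "\<bar>c\<bar>"] by (simp add: abs_mult)
    then show ?case using scale.IH by (auto simp: mult.left_commute)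
  qed (use z in \<open>auto intro: exI[of _ 1]\<close>)
  have ig2: "integrable cell_measure (\<lambda>x. g x * g x)"
  proof (rule integrable_cell_measure)
    show "\<bar>g x * g x\<bar> \<le> B * B" for x unfolding abs_mult using B B0 by (intro mult_mono) auto
  qed measurable
  have le: "(\<integral>x. g x * g x \<partial>cell_measure) \<le> B * e" if e: "e > 0" for e
  proof -
    obtain p where p: "trig_poly p" "\<And>x. \<bar>g x - p x\<bar> < e" using trig_poly_dense[OF g e] by blast
    obtain C where C: "\<And>x. \<bar>p x\<bar> \<le> C" and [measurable]: "p \<in> borel_measurable borel" and p0: "(\<integral>x. g x * p x \<partial>cell_measure) = 0"
      using trig[OF p(1)] by blast
    have ip: "integrable cell_measure (\<lambda>x. g x * p x)"
      by (rule integrable_cell_measure[of _ "B * C"]) (use B C B0 in \<open>auto intro!: mult_mono simp: abs_mult\<close>)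
    have bd: "\<bar>g x * (g x - p x)\<bar> \<le> B * e" for x
      unfolding abs_mult using B B0 p(2)[of x] by (intro mult_mono) auto
    have id: "integrable cell_measure (\<lambda>x. g x * (g x - p x))" by (rule integrable_cell_measure[OF _ bd]) measurable
    have "(\<integral>x. g x * g x \<partial>cell_measure) = (\<integral>x. g x * (g x - p x) \<partial>cell_measure)"
      using ig2 ip p0 by (simp add: right_diff_distrib)
    also have "\<dots> \<le> (\<integral>x. B * e \<partial>cell_measure)" using id bd by (intro integral_mono) (auto simp: abs_le_iff)
    finally show ?thesis by simp
  qed
  have "(\<integral>x. g x * g x \<partial>cell_measure) \<le> 0"
  proof (rule field_le_epsilon)
    fix e :: real assume "e > 0"
    have "(\<integral>x. g x * g x \<partial>cell_measure) \<le> B * (e / (B + 1))" using B0 \<open>e > 0\<close> by (intro le) simp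
    also have "\<dots> \<le> e" using B0 \<open>e > 0\<close> by (simp add: field_simps)
    finally show "(\<integral>x. g x * g x \<partial>cell_measure) \<le> 0 + e" by simp
  qed
  then have "(\<integral>x. g x * g x \<partial>cell_measure) = 0" by (intro antisym) (auto intro!: integral_nonneg_AE)
  then have AE: "AE x in cell_measure. g x = 0"
    using integral_nonneg_eq_0_iff_AE[OF ig2] by simp
  \<comment> \<open>By periodicity this open set is null in the whole space, and a nonempty open set
    never is.\<close>
  define O' where "O' = {x. g x \<noteq> 0}"
  have Om[measurable]: "O' \<in> sets borel" unfolding O'_def by measurable
  have open_O: "open O'" unfolding O'_def using g(1) by (intro open_Collect_neq continuous_on_const)
  have per: "indicator O' (x + lv n) = (indicator O' x :: ennreal)" for x n
    using g(2) by (simp add: O'_def lattice_periodic_def indicator_def)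
  have "(\<integral>\<^sup>+x. indicator O' x \<partial>cell_measure) = 0"
    using AE by (subst nn_integral_0_iff_AE) (auto simp: O'_def elim!: eventually_mono)
  then have 0: "(\<integral>\<^sup>+x. indicator O' x * indicator (fundamental_cell V) x \<partial>lborel) = 0"
    by (subst (asm) nn_integral_cell_measure) auto
  have "emeasure lborel O' = (\<integral>\<^sup>+x. indicator O' x \<partial>lborel)" by simp
  also have "\<dots> = 0" by (subst tiling_nn_integral) (auto simp: per 0)
  finally have "negligible O'" using Om by (simp add: negligible_iff_emeasure0)
  then have "O' = {}" using open_not_negligible[OF open_O] by blast
  then show ?thesis by (auto simp: O'_def)
qed

text \<open>Both sides are continuous and periodic with the same Fourier coefficients: on the left
  by unfolding the Gaussian integral, on the right by orthogonality.\<close>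

theorem poisson_summation:
  assumes t: "t > 0"
  shows "theta t x = dual_theta t x"
proof -
  note [measurable] = theta_measurable[OF t] borel_measurable_continuous_onI[OF dual_theta_continuous[OF t]]
  obtain C where C: "\<And>x. \<bar>theta t x\<bar> \<le> C" using periodic_bounded[OF theta_continuous[OF t] theta_periodic[OF t]] by blast
  obtain D where D: "\<And>x. \<bar>dual_theta t x\<bar> \<le> D" using periodic_bounded[OF dual_theta_continuous[OF t] dual_theta_periodic] by blast
  have CD: "0 \<le> C" "0 \<le> D" using C[of 0] D[of 0] by linarith+
  have i: "integrable cell_measure (\<lambda>x. theta t x * c x)" "integrable cell_measure (\<lambda>x. dual_theta t x * c x)"
    if [measurable]: "c \<in> borel_measurable borel" and "\<And>x. \<bar>c x\<bar> \<le> 1" for c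
  proof -
    have "\<bar>theta t x * c x\<bar> \<le> C * 1" "\<bar>dual_theta t x * c x\<bar> \<le> D * 1" for x
      unfolding abs_mult using C D CD that(2) by - (rule mult_mono; simp)+
    then show "integrable cell_measure (\<lambda>x. theta t x * c x)" "integrable cell_measure (\<lambda>x. dual_theta t x * c x)"
      by (intro integrable_cell_measure[of _ "C * 1"] integrable_cell_measure[of _ "D * 1"]; simp)+
  qed
  have "theta t x - dual_theta t x = 0"
  proof (rule periodic_eq_0_if_coeffs_0[of "\<lambda>x. theta t x - dual_theta t x"])
    show "continuous_on UNIV (\<lambda>x. theta t x - dual_theta t x)"
      by (intro continuous_on_diff theta_continuous dual_theta_continuous t)
    show "lattice_periodic (\<lambda>x. theta t x - dual_theta t x)"
      using theta_periodic[OF t] dual_theta_periodic[of t] by (simp add: lattice_periodic_def)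
    fix w assume w: "w \<in> dual_lattice V"
    show "(\<integral>x. (theta t x - dual_theta t x) * cos (2 * pi * (w \<bullet> x)) \<partial>cell_measure) = 0"
      using i[OF trig_measurable(1), of w] integral_theta_cos(1)[OF t w] integral_dual_theta_cos(1)[OF t w]
      by (simp add: left_diff_distrib)
    show "(\<integral>x. (theta t x - dual_theta t x) * sin (2 * pi * (w \<bullet> x)) \<partial>cell_measure) = 0"
      using i[OF trig_measurable(2), of w] integral_theta_cos(2)[OF t w] integral_dual_theta_cos(2)[OF t w]
      by (simp add: left_diff_distrib)
  qed
  then show ?thesis by simp
qed

end

section \<open>Measures on the torus\<close>

text \<open>The indicator of a closed set is a bounded pointwise limit of continuous functions of
  the distance, and closed sets form a generator stable under intersection.\<close>

lemma measure_eqI_continuous_integrals: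
  fixes N1 N2 :: "'a::metric_space measure"
  assumes N: "prob_space N1" "prob_space N2" "sets N1 = sets borel" "sets N2 = sets borel"
    and eq: "\<And>h :: 'a \<Rightarrow> real. continuous_on UNIV h \<Longrightarrow> (\<And>x. \<bar>h x\<bar> \<le> 1) \<Longrightarrow> (\<integral>x. h x \<partial>N1) = (\<integral>x. h x \<partial>N2)"
  shows "N1 = N2"
proof -
  have closed: "emeasure N1 C = emeasure N2 C" if C: "closed C" for C
  proof (cases "C = {}")
    case False
    define h where "h n x = max 0 (1 - real n * infdist x C)" for n x
    have hc: "continuous_on UNIV (h n)" for n unfolding h_def by (intro continuous_intros)
    have h1: "\<bar>h n x\<bar> \<le> 1" for n x unfolding h_def using infdist_nonneg[of x C] by (auto simp: max_def)
    have lim: "(\<lambda>n. h n x) \<longlonglongrightarrow> indicator C x" for x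
    proof (cases "x \<in> C")
      case True
      then show ?thesis by (simp add: h_def)
    next
      case notin: False
      then have pos: "0 < infdist x C" using in_closed_iff_infdist_zero[OF C False, of x] infdist_nonneg[of x C] by linarith
      obtain k where k: "1 < real k * infdist x C" using reals_Archimedean3[OF pos] by blast
      have "h n x = 0" if "n \<ge> k" for n
      proof -
        have "real k * infdist x C \<le> real n * infdist x C" using that pos by (intro mult_right_mono) auto
        then show ?thesis using k by (simp add: h_def)
      qed
      then have "\<forall>\<^sub>F n in sequentially. h n x = 0" unfolding eventually_sequentially by blast
      then show ?thesis using notin by (simp add: tendsto_eventually)
    qed
    have conv: "(\<lambda>n. \<integral>x. h n x \<partial>N) \<longlonglongrightarrow> measure N C" if "prob_space N" "sets N = sets borel" for N
    proof -
      interpret prob_space N by fact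
      have "(\<lambda>n. \<integral>x. h n x \<partial>N) \<longlonglongrightarrow> (\<integral>x. indicator C x \<partial>N)"
      proof (rule integral_dominated_convergence[of _ _ _ "\<lambda>_. 1"])
        show "h n \<in> borel_measurable N" for n
          using borel_measurable_continuous_onI[OF hc] that(2) measurable_cong_sets by blast
        show "(indicator C :: 'a \<Rightarrow> real) \<in> borel_measurable N"
          by (rule borel_measurable_indicator) (use C that(2) in auto)
      qed (use lim h1 in auto)
      then show ?thesis using C that(2) by simp
    qed
    have "measure N1 C = measure N2 C"
      using conv[OF N(1,3)] conv[OF N(2,4)] eq[OF hc h1] by (simp add: LIMSEQ_unique)
    then show ?thesis using N(1,2) by (simp add: finite_measure.emeasure_eq_measure prob_space_def)
  qed simp
  show ?thesis
  proof (rule measure_eqI_generator_eq[of "Collect closed" UNIV N1 N2 "\<lambda>_. UNIV"])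
    show "Int_stable (Collect closed)" by (auto simp: Int_stable_def)
    show "sets N1 = sigma_sets UNIV (Collect closed)" "sets N2 = sigma_sets UNIV (Collect closed)"
      using N(3,4) by (simp_all add: borel_eq_closed)
    show "emeasure N1 UNIV \<noteq> \<infinity>"
      using prob_space.emeasure_space_1[OF N(1)] sets_eq_imp_space_eq[OF N(3)] by simp
  qed (auto simp: closed)
qed

context unimodular_lattice
begin

lemma topspace_torus [simp]: "topspace (torus_topology V) = fundamental_cell V"
proof -
  have "openin (torus_topology V) (fundamental_cell V)"
    using torus_proj_in_cell by (auto simp: openin_torus_topology vimage_def)
  then show ?thesis by (auto simp: topspace_def openin_torus_topology)
qed

text \<open>The quotient topology is the one pulled back along \<open>torus_embed\<close>. The
  nontrivial direction uses that the complement of a saturated open set has closed image.\<close>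

lemma openin_torus_iff: "openin (torus_topology V) U \<longleftrightarrow> (\<exists>W. open W \<and> U = fundamental_cell V \<inter> torus_embed -` W)"
proof
  assume "openin (torus_topology V) U"
  then have U: "U \<subseteq> fundamental_cell V" "open (torus_proj V -` U)" by (auto simp: openin_torus_topology)
  define C where "C = - (torus_proj V -` U)"
  have C: "x \<in> C \<longleftrightarrow> y \<in> C" if "x - y \<in> lattice V" for x y using that torus_proj_cong[of x y] by (simp add: C_def)
  have cl: "closed (torus_embed ` C)"
  proof (rule closed_torus_embed_image)
    show "closed C" using U(2) unfolding C_def by (rule closed_Compl)
    show "x + v \<in> C" if "x \<in> C" "v \<in> lattice V" for x v using C[of "x + v" x] that by simp
  qed
  have "U = fundamental_cell V \<inter> torus_embed -` (- (torus_embed ` C))"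
  proof (intro set_eqI)
    fix x
    have "torus_embed x \<in> torus_embed ` C \<longleftrightarrow> x \<in> C" using C torus_embed_eq_iff by blast
    then show "x \<in> U \<longleftrightarrow> x \<in> fundamental_cell V \<inter> torus_embed -` (- (torus_embed ` C))"
      using U(1) torus_proj_cell[of x] by (auto simp: C_def)
  qed
  then show "\<exists>W. open W \<and> U = fundamental_cell V \<inter> torus_embed -` W" using cl by (intro exI[of _ "- (torus_embed ` C)"]) auto
next
  assume "\<exists>W. open W \<and> U = fundamental_cell V \<inter> torus_embed -` W"
  then obtain W where W: "open W" "U = fundamental_cell V \<inter> torus_embed -` W" by blast
  have "torus_proj V -` U = torus_embed -` W" using torus_proj_in_cell by (auto simp: W(2))
  moreover have "open (torus_embed -` W)"
    using W(1) continuous_torus_embed[OF continuous_on_id] by (simp add: open_vimage)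
  ultimately show "openin (torus_topology V) U" by (simp add: openin_torus_topology W(2))
qed

lemma space_torus_borel [simp]: "space (torus_borel V) = fundamental_cell V"
  unfolding torus_borel_def by (subst space_measure_of) (auto simp: openin_torus_topology)

lemma sets_torus_borel: "sets (torus_borel V) = {torus_embed -` B \<inter> fundamental_cell V | B. B \<in> sets borel}"
proof -
  have "{U. openin (torus_topology V) U} = {torus_embed -` W \<inter> fundamental_cell V | W. W \<in> {S. open S}}"
    by (auto simp: openin_torus_iff)
  then have "torus_borel V = vimage_algebra (fundamental_cell V) torus_embed borel"
    unfolding torus_borel_def borel_def by (simp add: vimage_algebra_sigma)
  then show ?thesis by (simp add: sets_vimage_algebra2)
qed

lemma torus_embed_measurable [measurable]: "torus_embed \<in> torus_borel V \<rightarrow>\<^sub>M borel"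
  by (rule measurableI) (auto simp: sets_torus_borel)

lemma periodic_measurable_torus:
  fixes g :: "real^'d \<Rightarrow> 'b::euclidean_space"
  assumes "continuous_on UNIV g" "lattice_periodic g"
  shows "g \<in> borel_measurable (torus_borel V)"
proof -
  obtain h :: "complex^'d \<Rightarrow> 'b" where h: "continuous_on UNIV h" "\<And>x. h (torus_embed x) = g x"
    using periodic_factors[OF assms] by blast
  have "(\<lambda>x. h (torus_embed x)) \<in> borel_measurable (torus_borel V)"
    by (rule measurable_compose[OF torus_embed_measurable borel_measurable_continuous_onI[OF h(1)]])
  then show ?thesis by (simp add: h(2))
qed

definition character :: "nat \<Rightarrow> real^'d \<Rightarrow> complex" where
  "character i x = cis (2 * pi * (dw i \<bullet> x))"

lemma character_continuous: "continuous_on UNIV (character i)"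
  unfolding character_def by (intro continuous_intros)

lemma character_periodic: "lattice_periodic (character i)"
  unfolding character_def[abs_def] by (rule cis_dual_periodic) simp

lemma character_measurable: "character i \<in> borel_measurable (torus_borel V)"
  by (rule periodic_measurable_torus[OF character_continuous character_periodic])

lemma norm_character [simp]: "norm (character i x) = 1"
  by (simp add: character_def)

lemma trig_poly_periodic: "trig_poly p \<Longrightarrow> continuous_on UNIV p \<and> lattice_periodic p"
  by (induction rule: trig_poly.induct)
    (auto simp: lattice_periodic_def cos_dual_periodic sin_dual_periodic intro!: continuous_intros)

text \<open>Coefficients determine integrals of trigonometric polynomials, and by uniform density
  those of all continuous periodic functions. The two images in complex space therefore agree, and
  this suffices because the Borel sets of the torus are pulled back from there.\<close>

theorem torus_measure_unique:
  assumes M1: "prob_space M1" "sets M1 = sets (torus_borel V)" and M2: "prob_space M2" "sets M2 = sets (torus_borel V)"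
    and eq: "fourier_coeff character M1 = fourier_coeff character M2"
  shows "M1 = M2"
proof -
  interpret M1: prob_space M1 by fact
  interpret M2: prob_space M2 by fact
  have mc1: "f \<in> borel_measurable M1" and mc2: "f \<in> borel_measurable M2" if "f \<in> borel_measurable (torus_borel V)"
    for f :: "real^'d \<Rightarrow> 'b::topological_space"
    using that measurable_cong_sets[OF M1(2) refl] measurable_cong_sets[OF M2(2) refl] by blast+
  have ic: "integrable M1 (character i)" "integrable M2 (character i)" for i
    by (rule M1.integrable_const_bound[of _ 1] M2.integrable_const_bound[of _ 1]; use mc1[OF character_measurable] mc2[OF character_measurable] in simp)+
  have ip: "integrable M1 g" "integrable M2 g" if g: "continuous_on UNIV g" "lattice_periodic g" for g :: "real^'d \<Rightarrow> real"
  proof -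
    obtain B where "\<And>x. \<bar>g x\<bar> \<le> B" using periodic_bounded[OF g] by blast
    then show "integrable M1 g" "integrable M2 g"
      using mc1[OF periodic_measurable_torus[OF g]] mc2[OF periodic_measurable_torus[OF g]]
      by (auto intro!: M1.integrable_const_bound[of _ B] M2.integrable_const_bound[of _ B])
  qed
  have trig: "(\<integral>x. p x \<partial>M1) = (\<integral>x. p x \<partial>M2)" if "trig_poly p" for p
    using that
  proof induction
    case (cos w)
    then obtain i where i: "w = dw i" using bij_dw by (auto simp: bij_betw_def image_iff)
    have "Re (fourier_coeff character M1 i) = Re (fourier_coeff character M2 i)" using eq by simp
    then show ?case unfolding fourier_coeff_def using ic[of i] by (simp add: integral_Re[symmetric] character_def i)
  next
    case (sin w)
    then obtain i where i: "w = dw i" using bij_dw by (auto simp: bij_betw_def image_iff)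
    have "Im (fourier_coeff character M1 i) = Im (fourier_coeff character M2 i)" using eq by simp
    then show ?case unfolding fourier_coeff_def using ic[of i] by (simp add: integral_Im[symmetric] character_def i)
  next
    case (add f g)
    then show ?case using ip trig_poly_periodic[OF add.hyps(1)] trig_poly_periodic[OF add.hyps(2)] by simp
  next
    case (scale f c)
    then show ?case by simp
  qed
  have cont: "(\<integral>x. g x \<partial>M1) = (\<integral>x. g x \<partial>M2)" if g: "continuous_on UNIV g" "lattice_periodic g" for g :: "real^'d \<Rightarrow> real"
  proof -
    have "\<bar>(\<integral>x. g x \<partial>M1) - (\<integral>x. g x \<partial>M2)\<bar> \<le> 0 + e" if e: "e > 0" for e
    proof -
      obtain p where p: "trig_poly p" "\<And>x. \<bar>g x - p x\<bar> < e / 2" using trig_poly_dense[OF g, of "e / 2"] e by auto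
      note pp = trig_poly_periodic[OF p(1)]
      have "\<bar>(\<integral>x. g x \<partial>M1) - (\<integral>x. p x \<partial>M1)\<bar> \<le> e / 2"
      proof -
        have "\<bar>\<integral>x. g x - p x \<partial>M1\<bar> \<le> (\<integral>x. \<bar>g x - p x\<bar> \<partial>M1)" by (rule integral_abs_bound)
        also have "\<dots> \<le> (\<integral>x. e / 2 \<partial>M1)" using ip g pp p(2) by (intro integral_mono) (auto simp: less_imp_le)
        finally show ?thesis using ip g pp by (simp add: M1.prob_space)
      qed
      moreover have "\<bar>(\<integral>x. g x \<partial>M2) - (\<integral>x. p x \<partial>M2)\<bar> \<le> e / 2"
      proof -
        have "\<bar>\<integral>x. g x - p x \<partial>M2\<bar> \<le> (\<integral>x. \<bar>g x - p x\<bar> \<partial>M2)" by (rule integral_abs_bound)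
        also have "\<dots> \<le> (\<integral>x. e / 2 \<partial>M2)" using ip g pp p(2) by (intro integral_mono) (auto simp: less_imp_le)
        finally show ?thesis using ip g pp by (simp add: M2.prob_space)
      qed
      ultimately show ?thesis using trig[OF p(1)] by linarith
    qed
    then have "\<bar>(\<integral>x. g x \<partial>M1) - (\<integral>x. g x \<partial>M2)\<bar> \<le> 0" by (rule field_le_epsilon)
    then show ?thesis by simp
  qed
  have em: "torus_embed \<in> M1 \<rightarrow>\<^sub>M borel" "torus_embed \<in> M2 \<rightarrow>\<^sub>M borel"
    using mc1[OF torus_embed_measurable] mc2[OF torus_embed_measurable] .
  have "distr M1 borel torus_embed = distr M2 borel torus_embed"
  proof (rule measure_eqI_continuous_integrals)
    fix h :: "complex^'d \<Rightarrow> real" assume h: "continuous_on UNIV h"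
    have hm: "h \<in> borel_measurable borel" by (rule borel_measurable_continuous_onI[OF h])
    have "(\<integral>x. h (torus_embed x) \<partial>M1) = (\<integral>x. h (torus_embed x) \<partial>M2)"
    proof (rule cont)
      show "continuous_on UNIV (\<lambda>x. h (torus_embed x))"
        by (rule continuous_on_compose2[OF h]) (auto intro!: continuous_intros)
      show "lattice_periodic (\<lambda>x. h (torus_embed x))"
        unfolding lattice_periodic_def
      proof (intro allI ballI arg_cong[of _ _ h])
        show "torus_embed (x + v) = torus_embed x" if "v \<in> lattice V" for x v using that by (simp add: torus_embed_eq_iff)
      qed
    qed
    then show "(\<integral>x. h x \<partial>distr M1 borel torus_embed) = (\<integral>x. h x \<partial>distr M2 borel torus_embed)"
      using em hm by (simp add: integral_distr)
  qed (use em M1.prob_space_distr M2.prob_space_distr in auto)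
  note dist_eq = this
  show ?thesis
  proof (rule measure_eqI)
    fix S assume "S \<in> sets M1"
    then obtain B where B: "B \<in> sets borel" "S = torus_embed -` B \<inter> fundamental_cell V" unfolding M1(2) sets_torus_borel by blast
    have sp: "space M1 = fundamental_cell V" "space M2 = fundamental_cell V"
      using sets_eq_imp_space_eq[OF M1(2)] sets_eq_imp_space_eq[OF M2(2)] by simp_all
    show "emeasure M1 S = emeasure M2 S"
      using arg_cong[OF dist_eq, of "\<lambda>N. emeasure N B"] B em by (simp add: emeasure_distr sp)
  qed (simp add: M1 M2)
qed

end

section \<open>Measures supported in a compact subset of the torus\<close>

locale torus_subset = unimodular_lattice V for V :: "real^'d^'d" +
  fixes A :: "(real^'d) set"
  assumes A_sub: "A \<subseteq> fundamental_cell V" and A_compact: "compactin (torus_topology V) A" and A_nonempty: "A \<noteq> {}"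
begin

lemma compact_embed_A: "compact (torus_embed ` A)"
proof -
  have "continuous_map (torus_topology V) euclidean torus_embed"
    unfolding continuous_map_def
  proof (intro conjI allI impI)
    fix W :: "(complex^'d) set" assume "openin euclidean W"
    then have "openin (torus_topology V) (fundamental_cell V \<inter> torus_embed -` W)" unfolding openin_torus_iff by auto
    moreover have "{x \<in> topspace (torus_topology V). torus_embed x \<in> W} = fundamental_cell V \<inter> torus_embed -` W" by auto
    ultimately show "openin (torus_topology V) {x \<in> topspace (torus_topology V). torus_embed x \<in> W}" by simp
  qed simp
  from image_compactin[OF A_compact this] show ?thesis by simp
qed

lemma A_eq: "A = torus_embed -` (torus_embed ` A) \<inter> fundamental_cell V"
  using A_sub inj_on_torus_embed by (auto simp: inj_on_def)

lemma A_in_sets: "A \<in> sets (torus_borel V)"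
  unfolding sets_torus_borel using compact_imp_closed[OF compact_embed_A]
  by (intro CollectI exI[of _ "torus_embed ` A"] conjI A_eq) simp

text \<open>Points outside the support have null open neighborhoods, and by Lindelof countably many
  of these cover the complement of \<open>A\<close>. Conversely that complement is open, because
  \<open>A\<close> is compact.\<close>

lemma prob_measures_on_eq: "prob_measures_on V A = {M. sets M = sets (torus_borel V) \<and> prob_space M \<and> emeasure M A = 1}"
proof -
  have "measure_support (torus_topology V) M \<subseteq> A \<longleftrightarrow> emeasure M A = 1"
    if M: "sets M = sets (torus_borel V)" "prob_space M" for M
  proof -
    interpret prob_space M by fact
    have sp: "space M = fundamental_cell V" using sets_eq_imp_space_eq[OF M(1)] by simp
    have AM: "A \<in> sets M" using A_in_sets M(1) by simp
    have "emeasure M A = 1 \<longleftrightarrow> emeasure M (space M - A) = 0"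
      using prob_compl[OF AM] by (simp add: emeasure_eq_measure)
    also have "\<dots> \<longleftrightarrow> measure_support (torus_topology V) M \<subseteq> A"
    proof
      assume 0: "emeasure M (space M - A) = 0"
      show "measure_support (torus_topology V) M \<subseteq> A"
      proof
        fix x assume x: "x \<in> measure_support (torus_topology V) M"
        have "openin (torus_topology V) (fundamental_cell V - A)"
          unfolding openin_torus_iff
        proof (intro exI conjI)
          show "open (- (torus_embed ` A))" using compact_imp_closed[OF compact_embed_A] by (rule open_Compl)
          show "fundamental_cell V - A = fundamental_cell V \<inter> torus_embed -` (- (torus_embed ` A))"
            by (subst A_eq) auto
        qed
        then have "x \<notin> fundamental_cell V - A" using x 0 by (auto simp: measure_support_def sp)
        then show "x \<in> A" using x by (auto simp: measure_support_def)
      qed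
    next
      assume supp: "measure_support (torus_topology V) M \<subseteq> A"
      define F where "F = {W. open W \<and> emeasure M (fundamental_cell V \<inter> torus_embed -` W) = 0}"
      obtain F' where F': "F' \<subseteq> F" "countable F'" "\<Union>F' = \<Union>F"
        using Lindelof[of F] by (auto simp: F_def)
      have sub: "space M - A \<subseteq> (\<Union>W\<in>F'. fundamental_cell V \<inter> torus_embed -` W)"
      proof
        fix x assume x: "x \<in> space M - A"
        then have "x \<notin> measure_support (torus_topology V) M" using supp by blast
        then obtain U where "openin (torus_topology V) U" "x \<in> U" "emeasure M U = 0"
          using x by (auto simp: measure_support_def sp not_gr_zero)
        then obtain W where "W \<in> F" "x \<in> fundamental_cell V \<inter> torus_embed -` W" by (auto simp: openin_torus_iff F_def)
        then have "torus_embed x \<in> \<Union>F'" "x \<in> fundamental_cell V" using F'(3) by auto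
        then show "x \<in> (\<Union>W\<in>F'. fundamental_cell V \<inter> torus_embed -` W)" by auto
      qed
      have sets: "fundamental_cell V \<inter> torus_embed -` W \<in> sets M" if "W \<in> F'" for W
        using that F'(1) unfolding M(1) sets_torus_borel F_def by (intro CollectI exI[of _ W]) auto
      have "(\<Union>W\<in>F'. fundamental_cell V \<inter> torus_embed -` W) \<in> null_sets M"
        by (rule null_sets_UN'[OF F'(2)]) (use sets F'(1) in \<open>auto simp: F_def\<close>)
      then show "emeasure M (space M - A) = 0"
        using null_sets_subset[OF _ _ sub] AM by (meson null_setsD1 sets.compl_sets)
    qed
    finally show ?thesis by simp
  qed
  then show ?thesis unfolding prob_measures_on_def by blast
qed

lemma empirical_torus_compact:
  assumes \<omega>: "\<And>n j. \<omega> n j \<in> A" and s: "\<And>n. 0 < s n"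
  shows "\<exists>r M. strict_mono (r :: nat \<Rightarrow> nat) \<and> M \<in> prob_measures_on V A \<and>
    (\<forall>i. (\<lambda>n. (\<Sum>j<s (r n). character i (\<omega> (r n) j)) / of_nat (s (r n))) \<longlonglongrightarrow> fourier_coeff character M i)"
proof -
  let ?S = "torus_embed ` A"
  obtain r N where r: "strict_mono (r :: nat \<Rightarrow> nat)" and N: "prob_space N" "sets N = sets (borel :: (complex^'d) measure)" "emeasure N ?S = 1"
    and lim: "\<And>h :: complex^'d \<Rightarrow> complex. continuous_on UNIV h \<Longrightarrow>
      (\<lambda>n. (\<Sum>j<s (r n). h (torus_embed (\<omega> (r n) j))) /\<^sub>R real (s (r n))) \<longlonglongrightarrow> (\<integral>x. h x \<partial>N)"
    using empirical_measures_weakly_compact[OF compact_embed_A, of s "\<lambda>n j. torus_embed (\<omega> n j)", where 'b=complex] \<omega> s by blast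
  interpret N: prob_space N by fact
  obtain a where a: "a \<in> A" using A_nonempty by blast
  \<comment> \<open>An inverse of the embedding with values in \<open>A\<close>, used to bring the
    limit measure back to the torus. The default value \<open>a\<close> occurs only on a null
    set.\<close>
  define \<psi> where "\<psi> z = (if z \<in> ?S then inv_into A torus_embed z else a)" for z
  have \<psi>A: "\<psi> z \<in> A" for z using a by (auto simp: \<psi>_def inv_into_into)
  have \<psi>e: "torus_embed (\<psi> z) = z" if "z \<in> ?S" for z using that by (simp add: \<psi>_def f_inv_into_f)
  have S[measurable]: "?S \<in> sets N" using compact_imp_closed[OF compact_embed_A] N(2) by simp
  have \<psi>m[measurable]: "\<psi> \<in> N \<rightarrow>\<^sub>M torus_borel V"
  proof (rule measurableI)
    show "\<psi> z \<in> space (torus_borel V)" for z using \<psi>A A_sub by auto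
    fix X assume "X \<in> sets (torus_borel V)"
    then obtain B where B: "B \<in> sets borel" "X = torus_embed -` B \<inter> fundamental_cell V" unfolding sets_torus_borel by blast
    have "\<psi> z \<in> X \<longleftrightarrow> z \<in> ?S \<inter> B \<or> (z \<notin> ?S \<and> torus_embed a \<in> B)" for z
    proof (cases "z \<in> ?S")
      case True
      then show ?thesis using \<psi>e \<psi>A A_sub unfolding B(2) by auto
    next
      case False
      then show ?thesis using a A_sub unfolding B(2) \<psi>_def by auto
    qed
    then have "\<psi> -` X \<inter> space N = (?S \<inter> B) \<inter> space N \<union> (if torus_embed a \<in> B then space N - ?S else {})" by auto
    also have "\<dots> \<in> sets N" using S B(1) N(2) by auto
    finally show "\<psi> -` X \<inter> space N \<in> sets N" .
  qed
  define M where "M = distr N (torus_borel V) \<psi>"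
  have M: "M \<in> prob_measures_on V A"
  proof -
    have "\<psi> -` A \<inter> space N = space N" using \<psi>A by auto
    then have "emeasure M A = 1" unfolding M_def by (simp add: emeasure_distr[OF \<psi>m A_in_sets] N.emeasure_space_1)
    then show ?thesis unfolding prob_measures_on_eq using N.prob_space_distr[OF \<psi>m] by (simp add: M_def)
  qed
  have "(\<lambda>n. (\<Sum>j<s (r n). character i (\<omega> (r n) j)) / of_nat (s (r n))) \<longlonglongrightarrow> fourier_coeff character M i" for i
  proof -
    obtain h :: "complex^'d \<Rightarrow> complex" where h: "continuous_on UNIV h" "\<And>x. h (torus_embed x) = character i x"
      using periodic_factors[OF character_continuous character_periodic] by blast
    have hm: "h \<in> borel_measurable N" using borel_measurable_continuous_onI[OF h(1)] measurable_cong_sets[OF N(2) refl] by blast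
    have "fourier_coeff character M i = (\<integral>z. character i (\<psi> z) \<partial>N)"
      unfolding fourier_coeff_def M_def by (rule integral_distr[OF \<psi>m character_measurable])
    also have "\<dots> = (\<integral>z. h z \<partial>N)"
    proof (rule integral_cong_AE)
      show "(\<lambda>z. character i (\<psi> z)) \<in> borel_measurable N" by (rule measurable_compose[OF \<psi>m character_measurable])
      have "AE z in N. z \<in> ?S" using N(3) S N.AE_in_set_eq_1 by (simp add: N.emeasure_eq_measure)
      then show "AE z in N. character i (\<psi> z) = h z" by eventually_elim (simp add: h(2)[symmetric] \<psi>e)
    qed (rule hm)
    finally show ?thesis using lim[OF h(1)] by (simp add: h(2) scaleR_conv_of_real divide_inverse mult.commute)
  qed
  then show ?thesis using r M by blast
qed

end

section \<open>The periodic kernel\<close>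

lemma nn_integral_density_indicator:
  assumes "S \<in> sets M" "g \<in> borel_measurable M"
  shows "(\<integral>\<^sup>+t. g t \<partial>density M (indicator S)) = (\<integral>\<^sup>+t\<in>S. g t \<partial>M)"
  using assms by (subst nn_integral_density) (auto simp: mult.commute)

text \<open>Serves to split the lattice sum of the kernel into the contributions of the positive
  part, possibly infinite, and of the negative part, which has a finite sum.\<close>

lemma has_sum_ennreal_minus_real:
  fixes a :: "'i \<Rightarrow> ennreal" and b :: "'i \<Rightarrow> real"
  assumes b: "(b has_sum s) I"
  shows "((\<lambda>i. enn2ereal (a i) - ereal (b i)) has_sum (enn2ereal (infsum a I) - ereal s)) I"
proof -
  have "(a has_sum infsum a I) I" by (rule has_sum_infsum) (simp add: nonneg_summable_on_complete)
  then have a: "((\<lambda>F. enn2ereal (sum a F)) \<longlongrightarrow> enn2ereal (infsum a I)) (finite_subsets_at_top I)"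
    unfolding has_sum_def by (rule tendsto_enn2erealI)
  have b': "((\<lambda>F. ereal (sum b F)) \<longlongrightarrow> ereal s) (finite_subsets_at_top I)"
    using b unfolding has_sum_def by simp
  have "((\<lambda>F. enn2ereal (sum a F) - ereal (sum b F)) \<longlongrightarrow> enn2ereal (infsum a I) - ereal s) (finite_subsets_at_top I)"
    by (rule tendsto_diff_ereal_general[OF a b']) simp
  moreover have "enn2ereal (sum a F) - ereal (sum b F) = (\<Sum>i\<in>F. enn2ereal (a i) - ereal (b i))" if "finite F" for F
    using that
  proof induction
    case (insert i F)
    have "enn2ereal (a i + sum a F) - ereal (b i + sum b F) = (enn2ereal (a i) - ereal (b i)) + (enn2ereal (sum a F) - ereal (sum b F))"
      by (cases "a i"; cases "sum a F") (auto simp: plus_ennreal.rep_eq)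
    then show ?case using insert by simp
  qed (simp add: zero_ennreal.rep_eq zero_ereal_def)
  ultimately show ?thesis unfolding has_sum_def
    by (elim Lim_transform_eventually) (auto intro!: eventually_finite_subsets_at_top_weakI)
qed

text \<open>With \<open>k = d + 1\<close> the power of \<open>s\<close> is at most
  \<open>s ^ k\<close>, and the constant comes from raising
  \<open>c * s / k \<le> exp (c * s / k)\<close> to the power \<open>k\<close>.\<close>

lemma power_le_exp:
  assumes "c > 0" "s \<ge> 1"
  shows "s powr (real d / 2) * exp (- c * s) \<le> (real (Suc d) / c) ^ Suc d"
proof -
  let ?k = "Suc d"
  have "s powr (real d / 2) \<le> s powr real ?k" using assms by (intro powr_mono) auto
  also have "\<dots> = s ^ ?k" using assms by (subst powr_realpow) auto
  also have "\<dots> = (real ?k / c) ^ ?k * (c * s / real ?k) ^ ?k" using assms by (simp add: power_mult_distrib[symmetric] del: power_Suc)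
  also have "\<dots> \<le> (real ?k / c) ^ ?k * exp (c * s / real ?k) ^ ?k"
  proof -
    have "c * s / real ?k \<le> exp (c * s / real ?k)" using exp_ge_add_one_self[of "c * s / real ?k"] by linarith
    then show ?thesis using assms by (intro mult_left_mono power_mono) (auto simp del: power_Suc of_nat_Suc)
  qed
  also have "exp (c * s / real ?k) ^ ?k = exp (c * s)" by (subst exp_of_nat_mult[symmetric]) (simp del: of_nat_Suc)
  finally have "s powr (real d / 2) * exp (- c * s) \<le> (real ?k / c) ^ ?k * exp (c * s) * exp (- c * s)"
    by (intro mult_right_mono) (auto simp del: power_Suc of_nat_Suc)
  then show ?thesis by (simp add: mult.assoc exp_minus del: power_Suc of_nat_Suc)
qed

lemma dual_weight_powr:
  fixes w :: "real^'d"
  assumes "t > 0"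
  shows "dual_weight w t = pi powr (real CARD('d) / 2) * (t powr (- real CARD('d) / 2) * exp (- pi\<^sup>2 * (norm w)\<^sup>2 / t))"
  using assms by (simp add: dual_weight_def powr_minus_divide)

text \<open>The exponential beats the power of \<open>t\<close>, as seen in the variable
  \<open>1 / t\<close>. Boundedness makes the integral against a finite negative part
  finite.\<close>

lemma weight_bounded:
  fixes w :: "real^'d"
  assumes "w \<noteq> 0"
  obtains B where "0 \<le> B" "\<And>t. 0 < t \<Longrightarrow> t < 1 \<Longrightarrow> t powr (- real CARD('d) / 2) * exp (- pi\<^sup>2 * (norm w)\<^sup>2 / t) \<le> B"
proof
  define c where "c = pi\<^sup>2 * (norm w)\<^sup>2"
  have c: "c > 0" using assms by (simp add: c_def)
  show "0 \<le> (real (Suc CARD('d)) / c) ^ Suc CARD('d)" using c by simp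
  fix t :: real assume t: "0 < t" "t < 1"
  have "t powr (- real CARD('d) / 2) * exp (- pi\<^sup>2 * (norm w)\<^sup>2 / t) = (1 / t) powr (real CARD('d) / 2) * exp (- c * (1 / t))"
    using t by (simp add: c_def powr_divide powr_minus_divide)
  also have "\<dots> \<le> (real (Suc CARD('d)) / c) ^ Suc CARD('d)" using t by (intro power_le_exp c) simp
  finally show "t powr (- real CARD('d) / 2) * exp (- pi\<^sup>2 * (norm w)\<^sup>2 / t) \<le> (real (Suc CARD('d)) / c) ^ Suc CARD('d)" .
qed

lemma dual_weight_measurable [measurable]: "dual_weight (w :: real^'d) \<in> borel_measurable borel"
  unfolding dual_weight_def[abs_def] by measurable

lemma measurable_pos_reals:
  "sets N = sets pos_reals \<Longrightarrow> g \<in> borel_measurable borel \<Longrightarrow> g \<in> borel_measurable N"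
  unfolding pos_reals_def using measurable_restrict_space1 measurable_cong_sets by blast

context unimodular_lattice
begin

lemma theta_le_theta_1:
  assumes "1 \<le> t"
  shows "theta t x \<le> theta 1 x"
  unfolding theta_def
proof (rule suminf_le)
  show "exp (- t * (norm (x + lv n))\<^sup>2) \<le> exp (- 1 * (norm (x + lv n))\<^sup>2)" for n
    using mult_right_mono[OF assms, of "(norm (x + lv n))\<^sup>2"] by simp
  show "summable (\<lambda>n. exp (- t * (norm (x + lv n))\<^sup>2))" by (rule summable_gaussian) (use assms in simp)
  show "summable (\<lambda>n. exp (- 1 * (norm (x + lv n))\<^sup>2))" by (rule summable_gaussian) simp
qed

lemma theta_measurable_time [measurable]: "(\<lambda>t. theta t x) \<in> borel_measurable borel"
  unfolding theta_def by measurable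

lemma dual_theta_0: "dual_theta t 0 = (\<Sum>n. dual_weight (dw n) t)"
  by (simp add: dual_theta_def)

text \<open>Poisson summation integrated over time. For \<open>t\<close> at least 1 every weight is
  one nonnegative term of \<open>dual_theta t 0\<close>, which equals \<open>theta t 0\<close> and
  is bounded by \<open>theta 1 0\<close>; this dominates everything.\<close>

lemma dual_weight_series_integral:
  assumes R: "finite_measure R" "sets R = sets pos_reals" "AE t in R. 1 \<le> t"
  shows "integrable R (dual_weight (dw i))"
    and "summable (\<lambda>i. \<integral>t. dual_weight (dw i) t \<partial>R)"
    and "(\<Sum>i. (\<integral>t. dual_weight (dw i) t \<partial>R) * cos (2 * pi * (dw i \<bullet> z))) = (\<integral>t. theta t z \<partial>R)"
    and "integrable R (\<lambda>t. theta t z)"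
proof -
  interpret finite_measure R by fact
  have Dm[measurable]: "dual_weight (w :: real^'d) \<in> borel_measurable R" for w by (rule measurable_pos_reals[OF R(2)]) measurable
  have Tm[measurable]: "(\<lambda>t. theta t x) \<in> borel_measurable R" for x by (rule measurable_pos_reals[OF R(2)]) measurable
  have D: "dual_weight (dw i) t \<le> theta t 0" if "1 \<le> t" for i t
    unfolding poisson_summation[OF less_le_trans[OF zero_less_one that]] dual_theta_0
    using that dual_weight_nonneg by (intro order_trans[OF _ sum_le_suminf[OF summable_dual_weight, of t "{i}"]]) auto
  have iT: "integrable R (\<lambda>t. theta t x)" for x
  proof (rule integrable_const_bound[of _ "theta 1 x"])
    show "AE t in R. norm (theta t x) \<le> theta 1 x"
      using R(3) by eventually_elim (use theta_le_theta_1 theta_pos in \<open>auto simp: less_imp_le abs_of_pos\<close>)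
  qed measurable
  then show "integrable R (\<lambda>t. theta t z)" .
  have iD: "integrable R (dual_weight (dw i))" for i
  proof (rule Bochner_Integration.integrable_bound[OF iT[of 0]])
    show "AE t in R. norm (dual_weight (dw i) t) \<le> norm (theta t 0)"
      using R(3) by eventually_elim (simp add: abs_of_nonneg[OF dual_weight_nonneg] order_trans[OF D abs_ge_self])
  qed measurable
  then show "integrable R (dual_weight (dw i))" .
  show s: "summable (\<lambda>i. \<integral>t. dual_weight (dw i) t \<partial>R)"
  proof (rule summableI_nonneg_bounded)
    show "0 \<le> (\<integral>t. dual_weight (dw i) t \<partial>R)" for i by (rule integral_nonneg_AE) (simp add: dual_weight_nonneg)
    fix n
    have "(\<Sum>i<n. \<integral>t. dual_weight (dw i) t \<partial>R) = (\<integral>t. (\<Sum>i<n. dual_weight (dw i) t) \<partial>R)" using iD by simp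
    also have "\<dots> \<le> (\<integral>t. theta t 0 \<partial>R)"
    proof (rule integral_mono_AE)
      show "AE t in R. (\<Sum>i<n. dual_weight (dw i) t) \<le> theta t 0"
        using R(3)
      proof eventually_elim
        case (elim t)
        then show ?case unfolding poisson_summation[OF less_le_trans[OF zero_less_one elim]] dual_theta_0
          using dual_weight_nonneg by (intro sum_le_suminf summable_dual_weight) auto
      qed
    qed (use iD iT in auto)
    finally show "(\<Sum>i<n. \<integral>t. dual_weight (dw i) t \<partial>R) \<le> (\<integral>t. theta t 0 \<partial>R)" .
  qed
  have bd: "norm (dual_weight (dw i) t * cos y) \<le> dual_weight (dw i) t" for i t y by (rule dual_theta_term_bound)
  have iDc: "integrable R (\<lambda>t. dual_weight (dw i) t * cos (2 * pi * (dw i \<bullet> z)))" for i using iD by simp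
  have "(\<Sum>i. (\<integral>t. dual_weight (dw i) t \<partial>R) * cos (2 * pi * (dw i \<bullet> z))) = (\<Sum>i. \<integral>t. dual_weight (dw i) t * cos (2 * pi * (dw i \<bullet> z)) \<partial>R)"
    by simp
  also have "\<dots> = (\<integral>t. (\<Sum>i. dual_weight (dw i) t * cos (2 * pi * (dw i \<bullet> z))) \<partial>R)"
  proof (rule integral_suminf[symmetric, OF iDc])
    show "AE t in R. summable (\<lambda>i. norm (dual_weight (dw i) t * cos (2 * pi * (dw i \<bullet> z))))"
      using R(3)
    proof eventually_elim
      case (elim t)
      then show ?case by (intro summable_comparison_test'[OF summable_dual_weight[of t], of 0]) (use bd in auto)
    qed
    have "(\<integral>t. norm (dual_weight (dw i) t * cos (2 * pi * (dw i \<bullet> z))) \<partial>R) \<le> (\<integral>t. dual_weight (dw i) t \<partial>R)" for i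
      by (rule integral_mono) (use iDc iD bd in auto)
    then show "summable (\<lambda>i. \<integral>t. norm (dual_weight (dw i) t * cos (2 * pi * (dw i \<bullet> z))) \<partial>R)"
      by (intro summable_comparison_test'[OF s, of 0]) simp
  qed
  also have "\<dots> = (\<integral>t. theta t z \<partial>R)"
  proof (rule integral_cong_AE)
    show "AE t in R. (\<Sum>i. dual_weight (dw i) t * cos (2 * pi * (dw i \<bullet> z))) = theta t z"
      using R(3)
    proof eventually_elim
      case (elim t)
      then show ?case using poisson_summation[of t z] by (simp add: dual_theta_def)
    qed
  qed measurable
  finally show "(\<Sum>i. (\<integral>t. dual_weight (dw i) t \<partial>R) * cos (2 * pi * (dw i \<bullet> z))) = (\<integral>t. theta t z \<partial>R)" .
qed

lemma exists_shortest_dual: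
  obtains w0 where "is_arg_min norm (\<lambda>w. w \<in> dual_lattice V - {0}) w0"
proof -
  have d1: "dw (Suc 0) \<in> dual_lattice V - {0}" using bij_dw_Suc by (auto simp: bij_betw_def)
  let ?F = "{w \<in> dual_lattice V. norm w \<le> norm (dw (Suc 0))} - {0}"
  have "dw (Suc 0) \<in> ?F" using d1 by simp
  then have F: "finite ?F" "?F \<noteq> {}" using finite_dual_ball by blast+
  define w0 where "w0 = arg_min_on norm ?F"
  have w0: "w0 \<in> ?F" "\<And>w. w \<in> ?F \<Longrightarrow> norm w0 \<le> norm w"
    unfolding w0_def using arg_min_if_finite[OF F, of norm] by (auto simp: not_less)
  have "norm w0 \<le> norm w" if "w \<in> dual_lattice V - {0}" for w
    using w0 that by (cases "norm w \<le> norm (dw (Suc 0))") auto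
  then have "is_arg_min norm (\<lambda>w. w \<in> dual_lattice V - {0}) w0"
    using w0(1) by (auto simp: is_arg_min_def not_less)
  then show thesis by (rule that)
qed

text \<open>The ratio of the two weights increases with \<open>t\<close>, so its value at
  \<open>t = 1\<close> is an upper bound. Thus the integrability condition, imposed only on shortest
  dual vectors, extends to all nonzero ones with a factor summable over the dual lattice.\<close>

lemma dual_weight_le_shortest:
  assumes w0: "is_arg_min norm (\<lambda>w. w \<in> dual_lattice V - {0}) w0" and w: "w \<in> dual_lattice V - {0}" and t: "0 < t" "t < 1"
  shows "dual_weight w t \<le> exp (pi\<^sup>2 * (norm w0)\<^sup>2) * exp (- pi\<^sup>2 * (norm w)\<^sup>2) * dual_weight w0 t"
proof -
  have "norm w0 \<le> norm w" using w0 w by (auto simp: is_arg_min_def not_less)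
  then have "(norm w0)\<^sup>2 \<le> (norm w)\<^sup>2" by (intro power_mono) auto
  then have "0 \<le> pi\<^sup>2 * (((norm w)\<^sup>2 - (norm w0)\<^sup>2) * (1 / t - 1))" using t by (intro mult_nonneg_nonneg) auto
  then have "- pi\<^sup>2 * (norm w)\<^sup>2 / t \<le> pi\<^sup>2 * (norm w0)\<^sup>2 + - pi\<^sup>2 * (norm w)\<^sup>2 + - pi\<^sup>2 * (norm w0)\<^sup>2 / t"
    by (simp add: algebra_simps)
  then have "exp (- pi\<^sup>2 * (norm w)\<^sup>2 / t) \<le> exp (pi\<^sup>2 * (norm w0)\<^sup>2) * exp (- pi\<^sup>2 * (norm w)\<^sup>2) * exp (- pi\<^sup>2 * (norm w0)\<^sup>2 / t)"
    by (simp only: exp_add[symmetric] exp_le_cancel_iff)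
  from mult_left_mono[OF this, of "pi powr (real CARD('d) / 2) / t powr (real CARD('d) / 2)"]
  show ?thesis unfolding dual_weight_def by (simp add: mult_ac)
qed

lemma dual_weight_small_time:
  assumes w0: "is_arg_min norm (\<lambda>w. w \<in> dual_lattice V - {0}) w0"
    and R: "sets R = sets pos_reals" "AE t in R. 0 < t \<and> t < 1" and i0: "integrable R (dual_weight w0)"
  shows "i \<noteq> 0 \<Longrightarrow> integrable R (dual_weight (dw i))"
    and "summable (\<lambda>i. if i = 0 then 0 else \<integral>t. dual_weight (dw i) t \<partial>R)"
proof -
  have Dm[measurable]: "dual_weight (w :: real^'d) \<in> borel_measurable R" for w by (rule measurable_pos_reals[OF R(1)]) measurable
  have dwn: "dw i \<in> dual_lattice V - {0}" if "i \<noteq> 0" for i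
    using that bij_dw_Suc by (cases i) (auto simp: bij_betw_def)
  define C where "C i = exp (pi\<^sup>2 * (norm w0)\<^sup>2) * exp (- pi\<^sup>2 * (norm (dw i))\<^sup>2)" for i
  have bd: "AE t in R. dual_weight (dw i) t \<le> C i * dual_weight w0 t" if "i \<noteq> 0" for i
    using R(2) by eventually_elim (use dual_weight_le_shortest[OF w0 dwn[OF that]] in \<open>auto simp: C_def\<close>)
  have ii: "integrable R (dual_weight (dw i))" if "i \<noteq> 0" for i
  proof (rule Bochner_Integration.integrable_bound)
    show "integrable R (\<lambda>t. C i * dual_weight w0 t)" using i0 by simp
    show "AE t in R. norm (dual_weight (dw i) t) \<le> norm (C i * dual_weight w0 t)"
      using bd[OF that] by eventually_elim (auto simp: C_def abs_mult abs_of_nonneg[OF dual_weight_nonneg])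
  qed measurable
  then show "i \<noteq> 0 \<Longrightarrow> integrable R (dual_weight (dw i))" .
  show "summable (\<lambda>i. if i = 0 then 0 else \<integral>t. dual_weight (dw i) t \<partial>R)"
  proof (rule summable_comparison_test'[of _ 0])
    show "summable (\<lambda>i. C i * (\<integral>t. dual_weight w0 t \<partial>R))"
      unfolding C_def by (intro summable_mult2 summable_mult summable_dual_gaussian) simp
    fix i
    have nn: "0 \<le> (\<integral>t. dual_weight w t \<partial>R)" for w :: "real^'d" by (rule integral_nonneg_AE) (simp add: dual_weight_nonneg)
    have "(\<integral>t. dual_weight (dw i) t \<partial>R) \<le> (\<integral>t. C i * dual_weight w0 t \<partial>R)" if "i \<noteq> 0"
      by (rule integral_mono_AE) (use ii bd that i0 in auto)
    then show "norm (if i = 0 then 0 else \<integral>t. dual_weight (dw i) t \<partial>R) \<le> C i * (\<integral>t. dual_weight w0 t \<partial>R)"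
      using nn by (auto simp: C_def intro!: mult_nonneg_nonneg)
  qed
qed

end

section \<open>Jordan parts and Fourier coefficients of the periodic kernel\<close>

lemma signed_integral_nonneg_eq:
  assumes "\<And>t. 0 \<le> h t"
  shows "signed_integral \<mu> S h = enn2ereal (\<integral>\<^sup>+t\<in>S. ennreal (h t) \<partial>positive_part pos_reals \<mu>)
    - enn2ereal (\<integral>\<^sup>+t\<in>S. ennreal (h t) \<partial>negative_part pos_reals \<mu>)"
  using assms by (simp add: signed_integral_def ereal_set_integral_def ennreal_neg zero_ennreal.rep_eq)

lemma AE_density_indicator:
  assumes "S \<in> sets M" "\<And>t. t \<in> S \<Longrightarrow> p t"
  shows "AE t in density M (indicator S). p t"
  using assms by (subst AE_density) (auto simp: indicator_def intro!: AE_I2)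

lemma space_pos_reals [simp]: "space pos_reals = {0<..}"
  by (simp add: pos_reals_def space_restrict_space)

lemma sets_measure_of_sets: "sets (measure_of (space M) (sets M) \<nu>) = sets M"
  by simp

locale weak_G_kernel = unimodular_lattice V for V :: "real^'d^'d" +
  fixes f :: "real^'d \<Rightarrow> ereal" and fstar :: "real \<Rightarrow> real" and \<mu> :: "real set \<Rightarrow> ereal"
  assumes weak_G: "weak_G_type V f fstar \<mu>"
    and weights_pos: "\<And>w. w \<in> dual_lattice V - {0} \<Longrightarrow> signed_integral \<mu> {0<..} (dual_weight w) > 0"
begin

abbreviation "P \<equiv> positive_part pos_reals \<mu>"
abbreviation "Q \<equiv> negative_part pos_reals \<mu>"

lemma sets_P [simp, measurable_cong]: "sets P = sets pos_reals" and sets_Q [simp, measurable_cong]: "sets Q = sets pos_reals"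
  by (simp_all only: positive_part_def negative_part_def sets_measure_of_sets)

lemma space_P [simp]: "space P = {0<..}" and space_Q [simp]: "space Q = {0<..}"
  using sets_eq_imp_space_eq[OF sets_P] sets_eq_imp_space_eq[OF sets_Q] by simp_all

lemma pos_sets: "S \<in> sets borel \<Longrightarrow> S \<subseteq> {0<..} \<Longrightarrow> S \<in> sets pos_reals"
  unfolding pos_reals_def by (subst sets_restrict_space_iff) auto

lemma interval_sets [simp]: "{1..real n} \<in> sets pos_reals" "{0<..<1} \<in> sets pos_reals" "{1..} \<in> sets pos_reals"
  by (rule pos_sets; force)+

lemma Q_finite: "emeasure Q {0<..} < \<infinity>"
  using weak_G by (simp add: weak_G_type_def)

lemma nn_integral_Q_finite:
  assumes "0 \<le> B" "\<And>t. t \<in> S \<Longrightarrow> 0 < t \<Longrightarrow> h t \<le> B"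
  shows "(\<integral>\<^sup>+t\<in>S. ennreal (h t) \<partial>Q) < \<infinity>"
proof -
  have "(\<integral>\<^sup>+t\<in>S. ennreal (h t) \<partial>Q) \<le> (\<integral>\<^sup>+t. ennreal B \<partial>Q)"
    by (intro nn_integral_mono) (use assms in \<open>auto simp: indicator_def intro!: ennreal_leI\<close>)
  also have "\<dots> < \<infinity>" using Q_finite by (simp add: ennreal_mult_less_top)
  finally show ?thesis .
qed

text \<open>Boundedness of \<open>h\<close> makes the integral against the negative part finite, so
  an infinite positive part could not be compensated.\<close>

lemma nn_integral_P_finite:
  assumes "\<And>t. 0 \<le> h t" "signed_integral \<mu> S h < \<infinity>" "0 \<le> B" "\<And>t. t \<in> S \<Longrightarrow> 0 < t \<Longrightarrow> h t \<le> B"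
  shows "(\<integral>\<^sup>+t\<in>S. ennreal (h t) \<partial>P) < \<infinity>"
proof -
  have q: "(\<integral>\<^sup>+t\<in>S. ennreal (h t) \<partial>Q) < \<infinity>" by (rule nn_integral_Q_finite[OF assms(3,4)])
  have "signed_integral \<mu> S h = enn2ereal (\<integral>\<^sup>+t\<in>S. ennreal (h t) \<partial>P) - enn2ereal (\<integral>\<^sup>+t\<in>S. ennreal (h t) \<partial>Q)"
    by (rule signed_integral_nonneg_eq[OF assms(1)])
  then show ?thesis using assms(2) q
    by (cases "\<integral>\<^sup>+t\<in>S. ennreal (h t) \<partial>P"; cases "\<integral>\<^sup>+t\<in>S. ennreal (h t) \<partial>Q") auto
qed

lemma exp_integral_P_finite: "(\<integral>\<^sup>+t\<in>{1..}. ennreal (exp (- t)) \<partial>P) < \<infinity>"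
proof (rule nn_integral_P_finite[where B=1])
  \<comment> \<open>Condition (W1) at a unit vector, with lower limit 1, is finiteness of the
    integral of \<open>exp (- t)\<close>.\<close>
  define q :: "real^'d" where "q = axis undefined 1"
  have "norm q = 1" by (simp add: q_def)
  moreover from this have "q \<noteq> 0" by auto
  ultimately show "signed_integral \<mu> {1..} (\<lambda>t. exp (- t)) < \<infinity>"
    using weak_G unfolding weak_G_type_def by (auto dest!: spec[of _ q] spec[of _ "1::real"])
qed auto

lemma P_interval_finite: "emeasure P {1..real n} < \<infinity>"
proof -
  have "{1..real n} \<in> sets P" by simp
  then have "emeasure P {1..real n} = (\<integral>\<^sup>+t. indicator {1..real n} t \<partial>P)" by simp
  also have "\<dots> \<le> (\<integral>\<^sup>+t. ennreal (exp n) * (ennreal (exp (- t)) * indicator {1..} t) \<partial>P)"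
    by (intro nn_integral_mono) (auto simp: indicator_def ennreal_mult[symmetric] exp_add[symmetric])
  also have "\<dots> = ennreal (exp n) * (\<integral>\<^sup>+t\<in>{1..}. ennreal (exp (- t)) \<partial>P)"
    by (rule nn_integral_cmult) (rule measurable_pos_reals[OF sets_P], measurable)
  also have "\<dots> < \<infinity>" using exp_integral_P_finite by (simp add: ennreal_mult_less_top)
  finally show ?thesis .
qed

definition "Pn n = density P (indicator {1..real n})"
definition "P0 = density P (indicator {0<..<1})"
definition "Q1 = density Q (indicator {1..})"
definition "Q0 = density Q (indicator {0<..<1})"

lemma sets_densities [simp]: "sets (Pn n) = sets pos_reals" "sets P0 = sets pos_reals" "sets Q1 = sets pos_reals" "sets Q0 = sets pos_reals"
  by (simp_all add: Pn_def P0_def Q1_def Q0_def)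

lemma nn_integral_densities:
  assumes "g \<in> borel_measurable borel"
  shows "(\<integral>\<^sup>+t. g t \<partial>Pn n) = (\<integral>\<^sup>+t\<in>{1..real n}. g t \<partial>P)" "(\<integral>\<^sup>+t. g t \<partial>P0) = (\<integral>\<^sup>+t\<in>{0<..<1}. g t \<partial>P)"
    "(\<integral>\<^sup>+t. g t \<partial>Q1) = (\<integral>\<^sup>+t\<in>{1..}. g t \<partial>Q)" "(\<integral>\<^sup>+t. g t \<partial>Q0) = (\<integral>\<^sup>+t\<in>{0<..<1}. g t \<partial>Q)"
  using measurable_pos_reals[OF sets_P assms] measurable_pos_reals[OF sets_Q assms] unfolding Pn_def P0_def Q1_def Q0_def
  by (auto intro!: nn_integral_density_indicator)

lemma AE_densities: "AE t in Pn n. 1 \<le> t" "AE t in Q1. 1 \<le> t" "AE t in P0. 0 < t \<and> t < 1" "AE t in Q0. 0 < t \<and> t < 1"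
  unfolding Pn_def P0_def Q1_def Q0_def
  by - (rule AE_density_indicator; auto)+

lemma finite_Pn: "finite_measure (Pn n)" and finite_Q1: "finite_measure Q1"
proof -
  have "emeasure (Pn n) (space (Pn n)) = (\<integral>\<^sup>+t. 1 \<partial>Pn n)" by simp
  also have "\<dots> = (\<integral>\<^sup>+t. indicator {1..real n} t \<partial>P)" by (subst nn_integral_densities) auto
  also have "\<dots> = emeasure P {1..real n}" by (rule nn_integral_indicator) simp
  finally show "finite_measure (Pn n)" using P_interval_finite[of n] by (intro finite_measureI) auto
  have "emeasure Q1 (space Q1) = (\<integral>\<^sup>+t. 1 \<partial>Q1)" by simp
  also have "\<dots> = (\<integral>\<^sup>+t\<in>{1..}. ennreal 1 \<partial>Q)" by (subst nn_integral_densities) auto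
  also have "\<dots> < \<infinity>" by (rule nn_integral_Q_finite[of 1]) auto
  finally show "finite_measure Q1" by (intro finite_measureI) auto
qed

lemma integrable_small_time:
  assumes w: "is_arg_min norm (\<lambda>w. w \<in> dual_lattice V - {0}) w"
  shows "integrable P0 (dual_weight w)" "integrable Q0 (dual_weight w)"
proof -
  \<comment> \<open>The integrand of condition (W2), which is \<open>dual_weight w\<close> without
    its power of \<open>pi\<close>.\<close>
  define k where "k t = t powr (- real CARD('d) / 2) * exp (- pi\<^sup>2 * (norm w)\<^sup>2 / t)" for t
  have [measurable]: "k \<in> borel_measurable borel" unfolding k_def[abs_def] by measurable
  have "w \<noteq> 0" using w by (auto simp: is_arg_min_def)
  then obtain B where B: "0 \<le> B" "\<And>t. 0 < t \<Longrightarrow> t < 1 \<Longrightarrow> k t \<le> B" unfolding k_def by (rule weight_bounded) blast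
  have kn: "0 \<le> k t" for t by (simp add: k_def)
  have sk: "signed_integral \<mu> {0<..<1} k < \<infinity>" using weak_G w unfolding weak_G_type_def k_def[abs_def] by blast
  have p: "(\<integral>\<^sup>+t\<in>{0<..<1}. ennreal (k t) \<partial>P) < \<infinity>"
    by (rule nn_integral_P_finite[OF kn sk B(1)]) (auto simp: B(2))
  have q: "(\<integral>\<^sup>+t\<in>{0<..<1}. ennreal (k t) \<partial>Q) < \<infinity>"
    by (rule nn_integral_Q_finite[OF B(1)]) (auto simp: B(2))
  have eq: "(\<integral>\<^sup>+t\<in>{0<..<1}. ennreal (dual_weight w t) \<partial>R) = ennreal (pi powr (real CARD('d) / 2)) * (\<integral>\<^sup>+t\<in>{0<..<1}. ennreal (k t) \<partial>R)"
    if "sets R = sets pos_reals" for R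
  proof -
    have "(\<integral>\<^sup>+t\<in>{0<..<1}. ennreal (dual_weight w t) \<partial>R) = (\<integral>\<^sup>+t. ennreal (pi powr (real CARD('d) / 2)) * (ennreal (k t) * indicator {0<..<1} t) \<partial>R)"
      by (rule nn_integral_cong) (auto simp: indicator_def dual_weight_powr ennreal_mult[symmetric] k_def)
    also have "\<dots> = ennreal (pi powr (real CARD('d) / 2)) * (\<integral>\<^sup>+t\<in>{0<..<1}. ennreal (k t) \<partial>R)"
      by (rule nn_integral_cmult) (rule measurable_pos_reals[OF that], measurable)
    finally show ?thesis .
  qed
  show "integrable P0 (dual_weight w)"
  proof (rule integrableI_nonneg)
    have "(\<integral>\<^sup>+t. ennreal (dual_weight w t) \<partial>P0) = ennreal (pi powr (real CARD('d) / 2)) * (\<integral>\<^sup>+t\<in>{0<..<1}. ennreal (k t) \<partial>P)"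
      unfolding eq[OF sets_P, symmetric] by (rule nn_integral_densities) measurable
    then show "(\<integral>\<^sup>+t. ennreal (dual_weight w t) \<partial>P0) < \<infinity>" using p by (simp add: ennreal_mult_less_top)
    show "dual_weight w \<in> borel_measurable P0" by (rule measurable_pos_reals[OF _ dual_weight_measurable]) simp
  qed (simp add: dual_weight_nonneg)
  show "integrable Q0 (dual_weight w)"
  proof (rule integrableI_nonneg)
    have "(\<integral>\<^sup>+t. ennreal (dual_weight w t) \<partial>Q0) = ennreal (pi powr (real CARD('d) / 2)) * (\<integral>\<^sup>+t\<in>{0<..<1}. ennreal (k t) \<partial>Q)"
      unfolding eq[OF sets_Q, symmetric] by (rule nn_integral_densities) measurable
    then show "(\<integral>\<^sup>+t. ennreal (dual_weight w t) \<partial>Q0) < \<infinity>" using q by (simp add: ennreal_mult_less_top)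
    show "dual_weight w \<in> borel_measurable Q0" by (rule measurable_pos_reals[OF _ dual_weight_measurable]) simp
  qed (simp add: dual_weight_nonneg)
qed

text \<open>
  The constant \<open>\<pi>\<^bsup>d/2\<^esup> t\<^bsup>-d/2\<^esup>\<close> need not be integrable near \<open>t = 0\<close>, and the periodic kernel omits
  the frequency \<open>0\<close> there.
\<close>

definition small_coeff :: "nat \<Rightarrow> real" where
  "small_coeff i = (if i = 0 then 0 else (\<integral>t. dual_weight (dw i) t \<partial>P0) - (\<integral>t. dual_weight (dw i) t \<partial>Q0))"

text \<open>The negative part enters in full at every stage, so that only the first term depends on
  \<open>n\<close> and the coefficients increase.\<close>

definition kernel_coeff :: "nat \<Rightarrow> nat \<Rightarrow> real" where
  "kernel_coeff n i = (\<integral>t. dual_weight (dw i) t \<partial>Pn n) - (\<integral>t. dual_weight (dw i) t \<partial>Q1) + small_coeff i"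

lemma small_integrable: "i \<noteq> 0 \<Longrightarrow> integrable P0 (dual_weight (dw i))" "i \<noteq> 0 \<Longrightarrow> integrable Q0 (dual_weight (dw i))"
  and small_coeff_summable: "summable (\<lambda>i. \<bar>small_coeff i\<bar>)"
proof -
  obtain w0 where w0: "is_arg_min norm (\<lambda>w. w \<in> dual_lattice V - {0}) w0" by (rule exists_shortest_dual)
  note S = dual_weight_small_time[OF w0 sets_densities(2) AE_densities(3) integrable_small_time(1)[OF w0]]
    dual_weight_small_time[OF w0 sets_densities(4) AE_densities(4) integrable_small_time(2)[OF w0]]
  show "i \<noteq> 0 \<Longrightarrow> integrable P0 (dual_weight (dw i))" "i \<noteq> 0 \<Longrightarrow> integrable Q0 (dual_weight (dw i))" by (fact S(1), fact S(3))
  have nn: "0 \<le> (\<integral>t. dual_weight (dw i) t \<partial>R)" for i R by (rule integral_nonneg_AE) (simp add: dual_weight_nonneg)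
  show "summable (\<lambda>i. \<bar>small_coeff i\<bar>)"
  proof (rule summable_comparison_test'[OF summable_add[OF S(2,4)], of 0])
    show "norm \<bar>small_coeff i\<bar> \<le> (if i = 0 then 0 else \<integral>t. dual_weight (dw i) t \<partial>P0) + (if i = 0 then 0 else \<integral>t. dual_weight (dw i) t \<partial>Q0)" for i
      using nn[of P0 i] nn[of Q0 i] by (auto simp: small_coeff_def abs_le_iff)
  qed
qed

lemmas Pn_series = dual_weight_series_integral[OF finite_Pn sets_densities(1) AE_densities(1)]
lemmas Q1_series = dual_weight_series_integral[OF finite_Q1 sets_densities(3) AE_densities(2)]

lemma kernel_coeff_summable: "summable (\<lambda>i. \<bar>kernel_coeff n i\<bar>)"
proof (rule summable_comparison_test'[OF summable_add[OF summable_add[OF Pn_series(2)[of n] Q1_series(2)] small_coeff_summable], of 0])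
  have nn: "0 \<le> (\<integral>t. dual_weight (dw i) t \<partial>R)" for i R by (rule integral_nonneg_AE) (simp add: dual_weight_nonneg)
  show "norm \<bar>kernel_coeff n i\<bar> \<le> (\<integral>t. dual_weight (dw i) t \<partial>Pn n) + (\<integral>t. dual_weight (dw i) t \<partial>Q1) + \<bar>small_coeff i\<bar>" for i
    using nn[of "Pn n" i] nn[of Q1 i] by (auto simp: kernel_coeff_def)
qed

lemma nonneg_integral_Pn_mono:
  fixes g :: "real \<Rightarrow> real"
  assumes [measurable]: "g \<in> borel_measurable borel" and nn: "\<And>t. 1 \<le> t \<Longrightarrow> 0 \<le> g t" and i: "integrable (Pn n) g" "integrable (Pn (Suc n)) g"
  shows "(\<integral>t. g t \<partial>Pn n) \<le> (\<integral>t. g t \<partial>Pn (Suc n))"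
proof -
  have AE: "AE t in Pn n. 0 \<le> g t" "AE t in Pn (Suc n). 0 \<le> g t" using AE_densities(1)[of n] AE_densities(1)[of "Suc n"] by (auto elim!: eventually_mono intro: nn)
  have "ennreal (\<integral>t. g t \<partial>Pn n) = (\<integral>\<^sup>+t\<in>{1..real n}. ennreal (g t) \<partial>P)"
    by (subst nn_integral_eq_integral[symmetric, OF i(1) AE(1)]) (simp add: nn_integral_densities)
  also have "\<dots> \<le> (\<integral>\<^sup>+t\<in>{1..real (Suc n)}. ennreal (g t) \<partial>P)"
    by (intro nn_integral_mono) (auto simp: indicator_def)
  also have "\<dots> = ennreal (\<integral>t. g t \<partial>Pn (Suc n))"
    by (subst nn_integral_eq_integral[symmetric, OF i(2) AE(2)]) (simp add: nn_integral_densities)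
  finally show ?thesis using integral_nonneg_AE[OF AE(2)] by (simp add: ennreal_le_iff)
qed

lemma kernel_coeff_mono: "kernel_coeff n i \<le> kernel_coeff (Suc n) i"
  unfolding kernel_coeff_def
  using nonneg_integral_Pn_mono[OF dual_weight_measurable dual_weight_nonneg Pn_series(1) Pn_series(1)] by simp

lemma nn_integral_P_from_1:
  assumes [measurable]: "g \<in> borel_measurable borel"
  shows "(\<integral>\<^sup>+t\<in>{1..}. g t \<partial>P) = (SUP n. \<integral>\<^sup>+t. g t \<partial>Pn n)"
proof -
  have m: "(\<lambda>t. g t * indicator {1..real n} t) \<in> borel_measurable P" for n by (rule measurable_pos_reals[OF sets_P]) measurable
  have "(\<integral>\<^sup>+t\<in>{1..}. g t \<partial>P) = (\<integral>\<^sup>+t. (SUP n. g t * indicator {1..real n} t) \<partial>P)"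
  proof (rule nn_integral_cong)
    fix t :: real
    show "g t * indicator {1..} t = (SUP n. g t * indicator {1..real n} t)"
    proof (rule antisym)
      obtain n where "t \<le> real n" using real_arch_simple by blast
      then show "g t * indicator {1..} t \<le> (SUP n. g t * indicator {1..real n} t)"
        by (intro SUP_upper2[of n]) (auto simp: indicator_def)
    qed (auto intro!: SUP_least simp: indicator_def)
  qed
  also have "\<dots> = (SUP n. \<integral>\<^sup>+t\<in>{1..real n}. g t \<partial>P)"
    by (rule nn_integral_monotone_convergence_SUP[OF _ m]) (auto simp: incseq_def le_fun_def indicator_def)
  finally show ?thesis by (simp add: nn_integral_densities)
qed

text \<open>The truncated integrals increase to the integral assumed to be positive. With the
  negative contributions moved to the other side, the hypothesis is a strict inequality below a
  supremum, hence below one of its members.\<close>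

lemma kernel_coeff_eventually_pos:
  assumes i: "i \<noteq> 0"
  shows "\<exists>n. 0 < kernel_coeff n i"
proof -
  let ?D = "dual_weight (dw i)"
  have dwi: "dw i \<in> dual_lattice V - {0}" using i bij_dw_Suc by (cases i) (auto simp: bij_betw_def)
  have split: "(\<integral>\<^sup>+t\<in>{0<..}. ennreal (?D t) \<partial>R) = (\<integral>\<^sup>+t\<in>{0<..<1}. ennreal (?D t) \<partial>R) + (\<integral>\<^sup>+t\<in>{1..}. ennreal (?D t) \<partial>R)"
    if R: "sets R = sets pos_reals" for R
  proof -
    have "(\<integral>\<^sup>+t\<in>{0<..}. ennreal (?D t) \<partial>R) = (\<integral>\<^sup>+t. ennreal (?D t) * indicator {0<..<1} t + ennreal (?D t) * indicator {1..} t \<partial>R)"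
      by (rule nn_integral_cong) (auto simp: indicator_def)
    also have "\<dots> = (\<integral>\<^sup>+t\<in>{0<..<1}. ennreal (?D t) \<partial>R) + (\<integral>\<^sup>+t\<in>{1..}. ennreal (?D t) \<partial>R)"
      by (rule nn_integral_add) (rule measurable_pos_reals[OF R], measurable)+
    finally show ?thesis .
  qed
  have nn: "AE t in R. 0 \<le> ?D t" "0 \<le> (\<integral>t. ?D t \<partial>R)" for R
    using dual_weight_nonneg by (auto intro!: integral_nonneg_AE)
  have eq: "(\<integral>\<^sup>+t\<in>{0<..<1}. ennreal (?D t) \<partial>P) = ennreal (\<integral>t. ?D t \<partial>P0)" "(\<integral>\<^sup>+t\<in>{0<..<1}. ennreal (?D t) \<partial>Q) = ennreal (\<integral>t. ?D t \<partial>Q0)"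
    "(\<integral>\<^sup>+t\<in>{1..}. ennreal (?D t) \<partial>Q) = ennreal (\<integral>t. ?D t \<partial>Q1)" "(\<integral>\<^sup>+t. ennreal (?D t) \<partial>Pn n) = ennreal (\<integral>t. ?D t \<partial>Pn n)" for n
    using small_integrable[OF i] Q1_series(1)[of i] Pn_series(1)[of n i] nn
    by (auto simp: nn_integral_densities(2-4)[symmetric] intro!: nn_integral_eq_integral)
  have "0 < signed_integral \<mu> {0<..} ?D" by (rule weights_pos[OF dwi])
  then have "enn2ereal (ennreal (\<integral>t. ?D t \<partial>Q0) + ennreal (\<integral>t. ?D t \<partial>Q1)) < enn2ereal (ennreal (\<integral>t. ?D t \<partial>P0) + (\<integral>\<^sup>+t\<in>{1..}. ennreal (?D t) \<partial>P))"
    unfolding signed_integral_nonneg_eq[OF dual_weight_nonneg] split[OF sets_P] split[OF sets_Q] eq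
    by (simp add: ereal_minus_less_iff ereal_less_minus_iff)
  then have "ennreal (\<integral>t. ?D t \<partial>Q0) + ennreal (\<integral>t. ?D t \<partial>Q1) < ennreal (\<integral>t. ?D t \<partial>P0) + (SUP n. ennreal (\<integral>t. ?D t \<partial>Pn n))"
    by (subst (asm) nn_integral_P_from_1) (auto simp: less_ennreal.rep_eq eq(4))
  also have "\<dots> = (SUP n. ennreal (\<integral>t. ?D t \<partial>P0) + ennreal (\<integral>t. ?D t \<partial>Pn n))"
    by (rule ennreal_SUP_add_right) simp
  finally obtain n where "ennreal (\<integral>t. ?D t \<partial>Q0) + ennreal (\<integral>t. ?D t \<partial>Q1) < ennreal (\<integral>t. ?D t \<partial>P0) + ennreal (\<integral>t. ?D t \<partial>Pn n)"
    unfolding less_SUP_iff by blast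
  then have "(\<integral>t. ?D t \<partial>Q0) + (\<integral>t. ?D t \<partial>Q1) < (\<integral>t. ?D t \<partial>P0) + (\<integral>t. ?D t \<partial>Pn n)"
    using nn(2) by (simp add: ennreal_plus[symmetric] ennreal_less_iff del: ennreal_plus)
  then show ?thesis using i by (intro exI[of _ n]) (simp add: kernel_coeff_def small_coeff_def)
qed

definition truncated_kernel :: "nat \<Rightarrow> real^'d \<Rightarrow> real" where
  "truncated_kernel n z = (\<integral>t. theta t z \<partial>Pn n) - (\<integral>t. theta t z \<partial>Q1) + (\<Sum>i. small_coeff i * cos (2 * pi * (dw i \<bullet> z)))"

text \<open>The integrated Poisson formula expands the part with times at least 1; the remaining
  part is a Fourier series by definition.\<close>

lemma truncated_kernel_eq: "truncated_kernel n z = (\<Sum>i. kernel_coeff n i * cos (2 * pi * (dw i \<bullet> z)))"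
proof -
  have sc: "summable (\<lambda>i. a i * cos (2 * pi * (dw i \<bullet> z)))" if "summable (\<lambda>i. \<bar>a i\<bar>)" for a
    by (rule summable_comparison_test'[OF that, of 0]) (simp add: abs_mult mult_left_le abs_cos_le_one)
  have nn: "\<bar>\<integral>t. dual_weight (dw i) t \<partial>R\<bar> = (\<integral>t. dual_weight (dw i) t \<partial>R)" for i R
    by (rule abs_of_nonneg, rule integral_nonneg_AE) (simp add: dual_weight_nonneg)
  have s: "summable (\<lambda>i. (\<integral>t. dual_weight (dw i) t \<partial>Pn n) * cos (2 * pi * (dw i \<bullet> z)))"
    "summable (\<lambda>i. (\<integral>t. dual_weight (dw i) t \<partial>Q1) * cos (2 * pi * (dw i \<bullet> z)))"
    "summable (\<lambda>i. small_coeff i * cos (2 * pi * (dw i \<bullet> z)))"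
    by (rule sc; simp add: nn Pn_series(2) Q1_series(2) small_coeff_summable)+
  show ?thesis
    unfolding truncated_kernel_def kernel_coeff_def distrib_right left_diff_distrib
    by (subst suminf_add[symmetric, OF summable_diff[OF s(1,2)] s(3)], subst suminf_diff[symmetric, OF s(1,2)])
      (simp add: Pn_series(3) Q1_series(3))
qed

text \<open>Evident on the lattice side, where the added time interval contributes an integral of
  the positive function \<open>theta\<close>; the cosine series does not show it.\<close>

lemma truncated_kernel_mono: "truncated_kernel n z \<le> truncated_kernel (Suc n) z"
  unfolding truncated_kernel_def
  using nonneg_integral_Pn_mono[OF theta_measurable_time _ Pn_series(4) Pn_series(4), of z n] theta_pos[of _ z] by (simp add: less_imp_le)

lemma infsum_lattice_gaussians:
  assumes R: "sets R = sets pos_reals"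
  shows "infsum (\<lambda>v. \<integral>\<^sup>+t\<in>{1..}. ennreal (exp (- (norm (z + v))\<^sup>2 * t)) \<partial>R) (lattice V) = (\<integral>\<^sup>+t\<in>{1..}. ennreal (theta t z) \<partial>R)"
proof -
  have "infsum (\<lambda>v. \<integral>\<^sup>+t\<in>{1..}. ennreal (exp (- (norm (z + v))\<^sup>2 * t)) \<partial>R) (lattice V)
    = infsum (\<lambda>n. \<integral>\<^sup>+t\<in>{1..}. ennreal (exp (- (norm (z + lv n))\<^sup>2 * t)) \<partial>R) UNIV"
    by (rule infsum_reindex_bij_betw[OF bij_lv, symmetric])
  also have "\<dots> = (\<Sum>n. \<integral>\<^sup>+t\<in>{1..}. ennreal (exp (- (norm (z + lv n))\<^sup>2 * t)) \<partial>R)"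
    by (rule sums_unique[OF has_sum_imp_sums[OF has_sum_infsum]]) (simp add: nonneg_summable_on_complete)
  also have "\<dots> = (\<integral>\<^sup>+t. (\<Sum>n. ennreal (exp (- (norm (z + lv n))\<^sup>2 * t)) * indicator {1..} t) \<partial>R)"
    by (rule nn_integral_suminf[symmetric]) (rule measurable_pos_reals[OF R], measurable)
  also have "\<dots> = (\<integral>\<^sup>+t\<in>{1..}. ennreal (theta t z) \<partial>R)"
  proof (rule nn_integral_cong)
    fix t
    show "(\<Sum>n. ennreal (exp (- (norm (z + lv n))\<^sup>2 * t)) * indicator {1..} t) = ennreal (theta t z) * indicator {1..} t"
    proof (cases "1 \<le> t")
      case True
      then have "(\<Sum>n. ennreal (exp (- t * (norm (z + lv n))\<^sup>2))) = ennreal (theta t z)"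
        unfolding theta_def by (intro suminf_ennreal2 summable_gaussian) auto
      then show ?thesis using True by (simp add: mult.commute)
    qed simp
  qed
  finally show ?thesis .
qed

text \<open>For times at least 1, Tonelli exchanges lattice sum and time integral for the positive
  and the negative part separately, and the positive part is the supremum of its truncations. For
  small times the series over nonzero frequencies is the one with coefficients
  \<open>small_coeff\<close>.\<close>

theorem periodic_kernel_eq: "periodic_kernel V \<mu> x y = (SUP n. ereal (truncated_kernel n (x - y)))"
proof -
  define z where "z = x - y"
  let ?g = "\<lambda>v t. exp (- (norm (z + v))\<^sup>2 * t)"
  let ?pv = "\<lambda>v. \<integral>\<^sup>+t\<in>{1..}. ennreal (?g v t) \<partial>P" and ?qv = "\<lambda>v. \<integral>\<^sup>+t\<in>{1..}. ennreal (?g v t) \<partial>Q"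
  have thm': "(\<lambda>t. ennreal (theta t z)) \<in> borel_measurable borel" by measurable
  have thn: "AE t in R. 0 \<le> theta t z" if "AE t in R. 1 \<le> t" for R
    using that by eventually_elim (use theta_pos in \<open>auto simp: less_imp_le\<close>)
  have qsum: "infsum ?qv (lattice V) = ennreal (\<integral>t. theta t z \<partial>Q1)"
    unfolding infsum_lattice_gaussians[OF sets_Q] nn_integral_densities(3)[OF thm', symmetric]
    by (rule nn_integral_eq_integral[OF Q1_series(4) thn[OF AE_densities(2)]])
  have qfin: "?qv v < top" for v
    using nn_integral_Q_finite[of 1 "{1..}" "?g v"] by simp
  define b where "b v = enn2real (?qv v)" for v
  have b: "?qv v = ennreal (b v)" "0 \<le> b v" for v unfolding b_def using qfin[of v] by simp_all
  have hb: "(b has_sum (\<integral>t. theta t z \<partial>Q1)) (lattice V)"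
  proof -
    have 0: "0 \<le> (\<integral>t. theta t z \<partial>Q1)" by (rule integral_nonneg_AE[OF thn[OF AE_densities(2)]])
    have "((\<lambda>v. ennreal (b v)) has_sum ennreal (\<integral>t. theta t z \<partial>Q1)) (lattice V)"
      using qsum unfolding b(1) by (metis has_sum_infsum nonneg_summable_on_complete zero_le)
    moreover have "sum (\<lambda>v. ennreal (b v)) = (\<lambda>F. ennreal (sum b F))"
      by (intro ext sum_ennreal b)
    ultimately have "((\<lambda>F. ennreal (sum b F)) \<longlongrightarrow> ennreal (\<integral>t. theta t z \<partial>Q1)) (finite_subsets_at_top (lattice V))"
      unfolding has_sum_def by simp
    then show ?thesis unfolding has_sum_def
      by (rule tendsto_ennrealD) (use b(2) 0 in \<open>auto simp: sum_nonneg\<close>)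
  qed
  have "((\<lambda>v. signed_integral \<mu> {1..} (?g v)) has_sum (enn2ereal (infsum ?pv (lattice V)) - ereal (\<integral>t. theta t z \<partial>Q1))) (lattice V)"
  proof -
    have "signed_integral \<mu> {1..} (?g v) = enn2ereal (?pv v) - ereal (b v)" for v
      unfolding signed_integral_nonneg_eq[of "?g v", OF exp_ge_zero] b(1) enn2ereal_ennreal[OF b(2)] ..
    then show ?thesis using has_sum_ennreal_minus_real[OF hb, of ?pv] by presburger
  qed
  then have F1: "(\<Sum>\<^sub>\<infinity>v\<in>lattice V. signed_integral \<mu> {1..} (?g v)) = enn2ereal (infsum ?pv (lattice V)) - ereal (\<integral>t. theta t z \<partial>Q1)"
    by (rule infsumI)
  have "infsum ?pv (lattice V) = (SUP n. ennreal (\<integral>t. theta t z \<partial>Pn n))"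
    unfolding infsum_lattice_gaussians[OF sets_P] nn_integral_P_from_1[OF thm']
    by (intro SUP_cong refl nn_integral_eq_integral Pn_series(4) thn AE_densities)
  moreover have "enn2ereal (SUP n. ennreal (\<integral>t. theta t z \<partial>Pn n)) = (SUP n. ereal (\<integral>t. theta t z \<partial>Pn n))"
  proof -
    have inc: "incseq (\<lambda>n. \<integral>t. theta t z \<partial>Pn n)"
      using theta_pos[of _ z] by (intro incseq_SucI nonneg_integral_Pn_mono[OF theta_measurable_time _ Pn_series(4) Pn_series(4)]) (simp add: less_imp_le)
    have "0 \<le> (SUP n. ereal (\<integral>t. theta t z \<partial>Pn n))"
      by (rule SUP_upper2[of 0]) (auto intro!: integral_nonneg_AE thn AE_densities)
    then show ?thesis unfolding e2ennreal_SUP_incseq[OF inc, symmetric] by (rule enn2ereal_e2ennreal)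
  qed
  ultimately have F1': "(\<Sum>\<^sub>\<infinity>v\<in>lattice V. signed_integral \<mu> {1..} (?g v)) = (SUP n. ereal (\<integral>t. theta t z \<partial>Pn n)) - ereal (\<integral>t. theta t z \<partial>Q1)"
    using F1 by simp
  let ?h = "\<lambda>w. exp (2 * complex_of_real pi * \<i> * complex_of_real (w \<bullet> z)) * complex_of_real (real_of_ereal (signed_integral \<mu> {0<..<1} (dual_weight w)))"
  have h: "?h (dw (Suc n)) = cis (2 * pi * (dw (Suc n) \<bullet> z)) * complex_of_real (small_coeff (Suc n))" for n
  proof -
    have i: "integrable P0 (dual_weight (dw (Suc n)))" "integrable Q0 (dual_weight (dw (Suc n)))" by (auto intro: small_integrable)
    have "signed_integral \<mu> {0<..<1} (dual_weight (dw (Suc n))) = enn2ereal (\<integral>\<^sup>+t. ennreal (dual_weight (dw (Suc n)) t) \<partial>P0) - enn2ereal (\<integral>\<^sup>+t. ennreal (dual_weight (dw (Suc n)) t) \<partial>Q0)"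
      by (subst signed_integral_nonneg_eq[OF dual_weight_nonneg]) (simp add: nn_integral_densities)
    also have "\<dots> = ereal (small_coeff (Suc n))"
      using i by (simp add: nn_integral_eq_integral dual_weight_nonneg small_coeff_def integral_nonneg_AE)
    finally show ?thesis by (simp add: cis_conv_exp mult_ac)
  qed
  have ss: "summable (\<lambda>n. norm (?h (dw (Suc n))))"
    unfolding h using small_coeff_summable summable_Suc_iff[of "\<lambda>i. \<bar>small_coeff i\<bar>"] by (simp add: norm_mult)
  have "infsum ?h (dual_lattice V - {0}) = infsum (\<lambda>n. ?h (dw (Suc n))) UNIV"
    by (rule infsum_reindex_bij_betw[OF bij_dw_Suc, symmetric])
  also have "\<dots> = (\<Sum>n. ?h (dw (Suc n)))"
    by (rule infsumI, rule norm_summable_imp_has_sum[OF ss], rule summable_sums, rule summable_norm_cancel[OF ss])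
  finally have "Re (infsum ?h (dual_lattice V - {0})) = (\<Sum>n. Re (?h (dw (Suc n))))"
    using bounded_linear.suminf[OF bounded_linear_Re summable_norm_cancel[OF ss]] by simp
  also have "\<dots> = (\<Sum>n. small_coeff (Suc n) * cos (2 * pi * (dw (Suc n) \<bullet> z)))"
    unfolding h by (intro suminf_cong) simp
  \<comment> \<open>Index 0 may be included, because \<open>small_coeff\<close> is 0 there.\<close>
  also have "\<dots> = (\<Sum>n. small_coeff n * cos (2 * pi * (dw n \<bullet> z)))"
  proof -
    have "summable (\<lambda>i. small_coeff i * cos (2 * pi * (dw i \<bullet> z)))"
      by (rule summable_comparison_test'[OF small_coeff_summable, of 0]) (simp add: abs_mult mult_left_le abs_cos_le_one)
    from suminf_split_head[OF this] show ?thesis by (simp add: small_coeff_def)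
  qed
  finally have F2: "Re (infsum ?h (dual_lattice V - {0})) = (\<Sum>n. small_coeff n * cos (2 * pi * (dw n \<bullet> z)))" .
  have "periodic_kernel V \<mu> x y = (SUP n. ereal (\<integral>t. theta t z \<partial>Pn n)) - ereal (\<integral>t. theta t z \<partial>Q1) + ereal (\<Sum>n. small_coeff n * cos (2 * pi * (dw n \<bullet> z)))"
    unfolding periodic_kernel_def z_def[symmetric] F2 F1' ..
  also have "\<dots> = (SUP n. ereal (\<integral>t. theta t z \<partial>Pn n)) + ereal ((\<Sum>n. small_coeff n * cos (2 * pi * (dw n \<bullet> z))) - (\<integral>t. theta t z \<partial>Q1))"
    by (cases "SUP n. ereal (\<integral>t. theta t z \<partial>Pn n)") auto
  also have "\<dots> = (SUP n. ereal (\<integral>t. theta t z \<partial>Pn n) + ereal ((\<Sum>n. small_coeff n * cos (2 * pi * (dw n \<bullet> z))) - (\<integral>t. theta t z \<partial>Q1)))"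
    by (rule SUP_ereal_add_left[symmetric]) auto
  also have "\<dots> = (SUP n. ereal (truncated_kernel n z))"
    by (simp add: truncated_kernel_def algebra_simps)
  finally show ?thesis by (simp add: z_def)
qed

end

section \<open>Asymptotics of the minimal periodic energy\<close>

lemma fourier_kernel_torus:
  assumes "torus_subset V A" and G: "weak_G_kernel V f fstar \<mu>"
  shows "fourier_kernel (torus_borel V) A (prob_measures_on V A) (unimodular_lattice.character V)
    (weak_G_kernel.kernel_coeff V \<mu>) (periodic_kernel V \<mu>)"
proof -
  interpret torus_subset V A by fact
  interpret weak_G_kernel V f fstar \<mu> by fact
  \<comment> \<open>The product of one character and the conjugate of the same at another point is
    the character at the difference, and its real part is the cosine in the expansion.\<close>
  have tk: "weighted_form (kernel_coeff n) (\<lambda>i. character i x) (\<lambda>i. character i y) = truncated_kernel n (x - y)" for n x y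
    unfolding weighted_form_def truncated_kernel_eq
    by (intro suminf_cong) (simp add: character_def cis_cnj cis_mult inner_diff_right right_diff_distrib)
  show ?thesis
  proof
    show "A \<in> sets (torus_borel V)" by (rule A_in_sets)
    show "A \<noteq> {}" by (rule A_nonempty)
    show "prob_measures_on V A = {M. sets M = sets (torus_borel V) \<and> prob_space M \<and> emeasure M A = 1}" by (rule prob_measures_on_eq)
    show "character i \<in> borel_measurable (torus_borel V)" for i by (rule character_measurable)
    show "norm (character i x) \<le> 1" for i x by simp
    show "character 0 x = 1" for x by (simp add: character_def)
    show "summable (\<lambda>i. \<bar>kernel_coeff n i\<bar>)" for n by (rule kernel_coeff_summable)
    show "kernel_coeff n i \<le> kernel_coeff (Suc n) i" for n i by (rule kernel_coeff_mono)
    show "\<exists>n. 0 < kernel_coeff n i" if "i \<noteq> 0" for i using that by (rule kernel_coeff_eventually_pos)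
    show "weighted_form (kernel_coeff n) (\<lambda>i. character i x) (\<lambda>i. character i y)
      \<le> weighted_form (kernel_coeff (Suc n)) (\<lambda>i. character i x) (\<lambda>i. character i y)" for n x y
      unfolding tk by (rule truncated_kernel_mono)
    show "periodic_kernel V \<mu> x y = (SUP n. ereal (weighted_form (kernel_coeff n) (\<lambda>i. character i x) (\<lambda>i. character i y)))" for x y
      unfolding tk by (rule periodic_kernel_eq)
    show "\<exists>r M. strict_mono (r :: nat \<Rightarrow> nat) \<and> M \<in> prob_measures_on V A \<and>
        (\<forall>i. (\<lambda>n. (\<Sum>j<s (r n). character i (\<omega> (r n) j)) / of_nat (s (r n))) \<longlonglongrightarrow> fourier_coeff character M i)"
      if "\<And>n j. \<omega> n j \<in> A" "\<And>n. 0 < s n" for \<omega> :: "nat \<Rightarrow> nat \<Rightarrow> real^'a" and s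
      using that by (rule empirical_torus_compact)
    show "M = M'" if "M \<in> prob_measures_on V A" "M' \<in> prob_measures_on V A" "fourier_coeff character M = fourier_coeff character M'" for M M'
      using that by (intro torus_measure_unique) (auto simp: prob_measures_on_eq)
  qed
qed

theorem theorem2p2:
  fixes V :: "real^'d^'d" and A :: "(real^'d) set"
    and f :: "real^'d \<Rightarrow> ereal" and fstar :: "real \<Rightarrow> real" and \<mu> :: "real set \<Rightarrow> ereal"
  assumes "independent (columns V)" and "det V = 1"
    and "A \<subseteq> fundamental_cell V" and "infinite A" and "compactin (torus_topology V) A"
    and "weak_G_type V f fstar \<mu>"
    and "\<And>w. w \<in> dual_lattice V - {0} \<Longrightarrow> signed_integral \<mu> {0<..} (dual_weight w) > 0"
  shows "((\<exists>M\<in>prob_measures_on V A. continuous_energy V \<mu> M < \<infinity>) \<longrightarrow>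
           (\<exists>\<nu>. {M \<in> prob_measures_on V A. continuous_energy V \<mu> M =
                    (INF M'\<in>prob_measures_on V A. continuous_energy V \<mu> M')} = {\<nu>} \<and>
                ((\<lambda>N. min_periodic_energy V \<mu> A N / ereal ((real N)\<^sup>2)) \<longlonglongrightarrow>
                   ereal_set_integral \<nu> A
                     (\<lambda>y. ereal_set_integral \<nu> A (\<lambda>x. periodic_kernel V \<mu> x y))))) \<and>
         ((\<forall>M\<in>prob_measures_on V A. continuous_energy V \<mu> M = \<infinity>) \<longrightarrow>
           (\<lambda>N. min_periodic_energy V \<mu> A N / ereal ((real N)\<^sup>2)) \<longlonglongrightarrow> \<infinity>)"
proof -
  have lat: "unimodular_lattice V" by standard (rule assms(2))
  have "A \<noteq> {}" using assms(4) by auto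
  then have sub: "torus_subset V A"
    using lat assms(3,5) by (simp add: torus_subset_def torus_subset_axioms_def)
  have G: "weak_G_kernel V f fstar \<mu>"
    using lat assms(6,7) by (simp add: weak_G_kernel_def weak_G_kernel_axioms_def)
  interpret torus_subset V A by (rule sub)
  interpret fourier_kernel "torus_borel V" A "prob_measures_on V A" "unimodular_lattice.character V"
    "weak_G_kernel.kernel_coeff V \<mu>" "periodic_kernel V \<mu>"
    by (rule fourier_kernel_torus[OF sub G])
  have min: "min_periodic_energy V \<mu> A = min_energy"
    by (simp add: fun_eq_iff min_energy_def min_periodic_energy_def periodic_energy_def)
  \<comment> \<open>Here the set of full measure is the cell; for the value of the limit it is
    \<open>A\<close>.\<close>
  have cont: "continuous_energy V \<mu> M = energy M" if M: "M \<in> prob_measures_on V A" for M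
    unfolding continuous_energy_def
  proof (rule energy_eq[OF M])
    have sp: "space M = fundamental_cell V" using PM_D(3)[OF M] by simp
    show "fundamental_cell V \<in> sets M" unfolding sp[symmetric] by (rule sets.top)
    show "emeasure M (fundamental_cell V) = 1"
      unfolding sp[symmetric] by (rule prob_space.emeasure_space_1[OF PM_D(1)[OF M]])
  qed
  have inf: "(INF M'\<in>prob_measures_on V A. continuous_energy V \<mu> M') = (INF M'\<in>prob_measures_on V A. energy M')"
    by (intro INF_cong refl cont)
  show ?thesis
  proof (intro conjI impI)
    assume "\<exists>M\<in>prob_measures_on V A. continuous_energy V \<mu> M < \<infinity>"
    then have "\<exists>M\<in>prob_measures_on V A. energy M < \<infinity>" using cont by auto
    then obtain \<nu> where \<nu>: "{M \<in> prob_measures_on V A. energy M = (INF M'\<in>prob_measures_on V A. energy M')} = {\<nu>}"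
      "(\<lambda>N. min_energy N / ereal ((real N)\<^sup>2)) \<longlonglongrightarrow> energy \<nu>"
      using min_energy_asymptotics(1) by blast
    have "{M \<in> prob_measures_on V A. continuous_energy V \<mu> M = (INF M'\<in>prob_measures_on V A. continuous_energy V \<mu> M')} = {\<nu>}"
      unfolding \<nu>(1)[symmetric] inf using cont by auto
    moreover have "\<nu> \<in> prob_measures_on V A" using \<nu>(1) by blast
    then have eq: "energy \<nu> = ereal_set_integral \<nu> A (\<lambda>y. ereal_set_integral \<nu> A (\<lambda>x. periodic_kernel V \<mu> x y))"
      using energy_eq[of \<nu> A] PM_D(4,5) by simp
    ultimately show "\<exists>\<nu>. {M \<in> prob_measures_on V A. continuous_energy V \<mu> M =
          (INF M'\<in>prob_measures_on V A. continuous_energy V \<mu> M')} = {\<nu>} \<and>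
        (\<lambda>N. min_periodic_energy V \<mu> A N / ereal ((real N)\<^sup>2)) \<longlonglongrightarrow>
          ereal_set_integral \<nu> A (\<lambda>y. ereal_set_integral \<nu> A (\<lambda>x. periodic_kernel V \<mu> x y))"
      using \<nu>(2) unfolding min eq by blast
  next
    assume "\<forall>M\<in>prob_measures_on V A. continuous_energy V \<mu> M = \<infinity>"
    then show "(\<lambda>N. min_periodic_energy V \<mu> A N / ereal ((real N)\<^sup>2)) \<longlonglongrightarrow> \<infinity>"
      unfolding min using min_energy_asymptotics(2) cont by auto
  qed
qed

end
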